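(* For a positive integer $n$, let $N(n)$ denote the number of distinct Steiner quadruple systems on a fixed $n$-element point set $X$, i.e. the number of collections $B$ of $4$-element subsets of $X$ such that every $3$-element subset of $X$ is contained in exactly one member of $B$. Then $\ln N(n)=\Theta(n^3\ln n)$ as $n\to\infty$ with $n\equiv 2 \pmod 6$ or $n\equiv 4\pmod 6$; that is, there exist constants $c_2\ge c_1>0$ and $n_0$ such that $c_1 n^3\ln n\le \ln N(n)\le c_2 n^3\ln n$ for all $n\ge n_0$ with $n\equiv 2$ or $4 \pmod 6$.
   Context: A Steiner quadruple system $SQS(n)$ (also written $S(3,4,n)$) is a pair $(X,B)$ with $|X|=n$ and $B$ a collection of $4$-element subsets (blocks) of $X$ such that every $3$-subset of $X$ lies in exactly one block. *)

theory Defs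
  imports Main "HOL-Analysis.Analysis"
begin

definition is_SQS :: "'a set \<Rightarrow> 'a set set \<Rightarrow> bool" where
  "is_SQS X B \<longleftrightarrow>
     (\<forall>b\<in>B. b \<subseteq> X \<and> card b = 4) \<and>
     (\<forall>T. T \<subseteq> X \<and> card T = 3 \<longrightarrow> (\<exists>!b. b \<in> B \<and> T \<subseteq> b))"

definition num_SQS :: "nat \<Rightarrow> nat" where
  "num_SQS n = card {B. is_SQS {0..<n} B}"

end

theory Submission
  imports Defs
begin

text \<open>For the lower bound, consider trades: periodic sequences \<open>p\<close>, \<open>q\<close>, \<open>r\<close>, \<open>s\<close> of points for which all
  \<open>{p i, q j, r k, s l}\<close> with \<open>i + j + k + l = 0\<close> are blocks. Replacing these blocks by those with
  \<open>i + j + k + l = 1\<close> gives another system. If a system has at least \<open>n^4 / D\<close> trades, one can choose of the order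
  of \<open>n^3\<close> pairwise disjoint ones greedily with of the order of \<open>n^4\<close> options each, and a switched system
  arises from few enough choices, so there are at least \<open>n^(c n^3)\<close> systems.

  Systems with that many trades come from recursive constructions. Inflating the points of a system on \<open>v\<close>
  points, with one point replaced by a stem, gives systems on \<open>2 v\<close>, \<open>6 v - 2\<close> and \<open>12 v - 10\<close> points and multiplies
  the number of trades by the fourth power of the factor. The remaining residues modulo 72 are reached by a
  quadrupling and a tripling construction. There the trades come from blocks formed by two equally coloured
  edges of an edge colouring that is built from a Latin square with a large subsquare over an elementary
  abelian 2-group.\<close>

text \<open>A trade is fixed by three points and one further value of \<open>p\<close>, so there are
  at most \<open>n ^ 4\<close> of them; the constructions must supply a fixed positive proportion.
  The gain is a difference of exponents: a list of \<open>K\<close> disjoint trades has, up to a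
  constant factor per entry, \<open>n ^ (4 * K)\<close> choices, but it is recovered from the
  switched system and at most \<open>n ^ (3 * K)\<close> base triples. The obstacle is that the
  proportion must survive a recursion of unbounded depth. Inflation is harmless, since
  \<open>n ^ 4\<close> grows at most as fast as the number of trades. Tripling with inherited trades
  would lose a constant factor at every use. So quadrupling and tripling take their trades afresh
  from an edge colouring, with one exception that inherits from a system just made by quadrupling.
  Elementary abelian 2-groups enter because sequences must have a bounded period: there every
  displacement has order 2, whereas a cyclic group has only boundedly many elements of order
  dividing 12.\<close>

section \<open>Counting and uniqueness in quadruple systems\<close>

lemma two_choose_two: "2 * (n choose 2) = n * (n - 1)" for n :: nat
  by (cases n) (simp_all add: choose_two)

lemma six_choose_three: "6 * (n choose 3) = n * (n - 1) * (n - 2)" for n :: nat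
proof (induction n)
  case 0
  then show ?case by (simp add: numeral_3_eq_3)
next
  case (Suc n)
  have two: "2 * (n choose 2) = n * (n - 1)"
    by (rule two_choose_two)
  have "Suc n choose 3 = (n choose 2) + (n choose 3)"
    by (simp add: numeral_3_eq_3 numeral_2_eq_2)
  then have "6 * (Suc n choose 3) = 3 * (n * (n - 1)) + n * (n - 1) * (n - 2)"
    using Suc two by simp
  also have "\<dots> = Suc n * (Suc n - 1) * (Suc n - 2)"
  proof (cases n)
    case 0
    then show ?thesis by simp
  next
    case (Suc m)
    then show ?thesis by (cases m) (auto simp: algebra_simps)
  qed
  finally show ?case .
qed

lemma card_triples:
  assumes "finite X"
  shows "6 * card {T. T \<subseteq> X \<and> card T = 3} = card X * (card X - 1) * (card X - 2)"
  using n_subsets[OF assms, of 3] six_choose_three by simp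

lemma card_triples_four:
  assumes "card b = 4"
  shows "card {T. T \<subseteq> b \<and> card T = 3} = 4"
proof -
  have "finite b" using assms by (auto intro: card_ge_0_finite)
  from card_triples[OF this] assms show ?thesis by simp
qed

lemma finite_blocks:
  assumes "finite X" "\<And>b. b \<in> B \<Longrightarrow> b \<subseteq> X \<and> card b = 4"
  shows "finite B"
  by (rule finite_subset[of _ "Pow X"]) (use assms in auto)

lemma sum_blocks_containing_triple:
  assumes fin: "finite X" and B: "\<And>b. b \<in> B \<Longrightarrow> b \<subseteq> X \<and> card b = 4"
  shows "(\<Sum>T\<in>{T. T \<subseteq> X \<and> card T = 3}. card {b \<in> B. T \<subseteq> b}) = 4 * card B"
proof -
  let ?Ts = "{T. T \<subseteq> X \<and> card T = 3}"
  have "(\<Sum>T\<in>?Ts. card {b \<in> B. T \<subseteq> b}) = (\<Sum>b\<in>B. card {T \<in> ?Ts. T \<subseteq> b})"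
    using sum.swap_restrict[of ?Ts B "\<lambda>_ _. 1::nat" "\<lambda>T b. T \<subseteq> b"] fin finite_blocks[OF fin B]
    by simp
  also have "\<dots> = (\<Sum>b\<in>B. 4)"
  proof (rule sum.cong[OF refl])
    fix b assume b: "b \<in> B"
    then have "{T \<in> ?Ts. T \<subseteq> b} = {T. T \<subseteq> b \<and> card T = 3}" using B by blast
    moreover have "card b = 4" using B b by blast
    ultimately show "card {T \<in> ?Ts. T \<subseteq> b} = 4" using card_triples_four by simp
  qed
  finally show ?thesis by simp
qed

text \<open>Counting makes uniqueness automatic: a family of quadruples that covers all triples and
  is no larger than a quadruple system covers each triple exactly once.\<close>

lemma is_SQS_I:
  assumes fin: "finite X"
    and B: "\<And>b. b \<in> B \<Longrightarrow> b \<subseteq> X \<and> card b = 4"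
    and cov: "\<And>x y z. \<lbrakk>x \<in> X; y \<in> X; z \<in> X; x \<noteq> y; x \<noteq> z; y \<noteq> z\<rbrakk> \<Longrightarrow> \<exists>b\<in>B. x \<in> b \<and> y \<in> b \<and> z \<in> b"
    and cnt: "24 * card B \<le> card X * (card X - 1) * (card X - 2)"
  shows "is_SQS X B"
proof -
  let ?Ts = "{T. T \<subseteq> X \<and> card T = 3}"
  have finB: "finite B" using finite_blocks[OF fin B] .
  have finT: "finite ?Ts" using fin by simp
  have ex: "card {b \<in> B. T \<subseteq> b} \<ge> 1" if "T \<in> ?Ts" for T
  proof -
    from that have "card T = 3" by simp
    then obtain x y z where T: "T = {x, y, z}" "x \<noteq> y" "x \<noteq> z" "y \<noteq> z"
      by (auto simp: card_3_iff)
    with that cov[of x y z] obtain b where "b \<in> B" "T \<subseteq> b" by auto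
    then have "{b \<in> B. T \<subseteq> b} \<noteq> {}" by blast
    then show ?thesis using finB by (simp add: Suc_le_eq card_gt_0_iff)
  qed
  have le: "(\<Sum>T\<in>?Ts. card {b \<in> B. T \<subseteq> b}) \<le> (\<Sum>T\<in>?Ts. 1)"
    using sum_blocks_containing_triple[OF fin B] card_triples[OF fin] cnt by simp
  have one: "card {b \<in> B. T \<subseteq> b} = 1" if T: "T \<in> ?Ts" for T
  proof (rule ccontr)
    assume "card {b \<in> B. T \<subseteq> b} \<noteq> 1"
    with ex[OF T] have "1 < card {b \<in> B. T \<subseteq> b}" by simp
    then have "(\<Sum>T\<in>?Ts. 1) < (\<Sum>T\<in>?Ts. card {b \<in> B. T \<subseteq> b})"
      by (intro sum_strict_mono_ex1 finT) (use ex T in auto)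
    with le show False by simp
  qed
  show ?thesis unfolding is_SQS_def
  proof (intro conjI allI impI ballI)
    fix T assume "T \<subseteq> X \<and> card T = 3"
    then obtain b where "{b \<in> B. T \<subseteq> b} = {b}" using one[of T] by (auto simp: card_1_singleton_iff)
    then have "c \<in> B \<and> T \<subseteq> c \<longleftrightarrow> c = b" for c
      using mem_Collect_eq[of c "\<lambda>b. b \<in> B \<and> T \<subseteq> b"] by simp
    then show "\<exists>!b. b \<in> B \<and> T \<subseteq> b" by simp
  qed (use B in auto)
qed

lemma is_SQS_blockD: "is_SQS X B \<Longrightarrow> b \<in> B \<Longrightarrow> b \<subseteq> X \<and> card b = 4"
  by (auto simp: is_SQS_def)

lemma is_SQS_ex1: "is_SQS X B \<Longrightarrow> T \<subseteq> X \<Longrightarrow> card T = 3 \<Longrightarrow> \<exists>!b. b \<in> B \<and> T \<subseteq> b"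
  by (simp add: is_SQS_def)

lemma is_SQS_block_ex: "is_SQS X B \<Longrightarrow> T \<subseteq> X \<Longrightarrow> card T = 3 \<Longrightarrow> \<exists>b\<in>B. T \<subseteq> b"
  by (drule (2) is_SQS_ex1) (auto dest: ex1_implies_ex)

lemma card_four_distinct:
  assumes "card {x, y, z, w} = 4"
  shows "x \<noteq> y" "x \<noteq> z" "x \<noteq> w" "y \<noteq> z" "y \<noteq> w" "z \<noteq> w"
  using card_distinct[of "[x, y, z, w]"] assms by auto

lemma is_SQS_distinct:
  assumes "is_SQS X B" "{x, y, z, w} \<in> B"
  shows "x \<noteq> y" "x \<noteq> z" "x \<noteq> w" "y \<noteq> z" "y \<noteq> w" "z \<noteq> w" "x \<in> X" "y \<in> X" "z \<in> X" "w \<in> X"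
proof -
  have c: "{x, y, z, w} \<subseteq> X" "card {x, y, z, w} = 4" using is_SQS_blockD[OF assms] by blast+
  show "x \<noteq> y" "x \<noteq> z" "x \<noteq> w" "y \<noteq> z" "y \<noteq> w" "z \<noteq> w"
    by (fact card_four_distinct[OF c(2)])+
  show "x \<in> X" "y \<in> X" "z \<in> X" "w \<in> X" using c(1) by auto
qed

lemma is_SQS_same_block:
  assumes S: "is_SQS X B" and b: "b \<in> B" "b' \<in> B" and T: "T \<subseteq> b" "T \<subseteq> b'" "card T = 3"
  shows "b = b'"
proof -
  have "T \<subseteq> X" using is_SQS_blockD[OF S b(1)] T by blast
  have eq: "\<exists>!x. P x \<Longrightarrow> P u \<Longrightarrow> P v \<Longrightarrow> u = v" for P and u v :: "'a set" by blast
  show ?thesis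
    by (rule eq[OF is_SQS_ex1[OF S \<open>T \<subseteq> X\<close> T(3)]]) (use b T in simp_all)
qed

lemma is_SQS_unique:
  assumes "is_SQS X B" "{x, y, z, w} \<in> B" "{x, y, z, w'} \<in> B"
  shows "w = w'"
proof -
  note d = is_SQS_distinct[OF assms(1,2)] is_SQS_distinct[OF assms(1,3)]
  have "{x, y, z, w} = {x, y, z, w'}"
    by (rule is_SQS_same_block[OF assms, of "{x, y, z}"]) (use d in auto)
  then have "w \<in> {x, y, z, w'}" by (metis insertCI)
  then show ?thesis using d by simp
qed

lemma is_SQS_ex:
  assumes "is_SQS X B" "x \<in> X" "y \<in> X" "z \<in> X" "x \<noteq> y" "x \<noteq> z" "y \<noteq> z"
  obtains w where "{x, y, z, w} \<in> B"
proof -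
  have "{x, y, z} \<subseteq> X" "card {x, y, z} = 3" using assms by auto
  from is_SQS_block_ex[OF assms(1) this] obtain b where b: "b \<in> B" "{x, y, z} \<subseteq> b" ..
  with is_SQS_blockD[OF assms(1)] have c: "card b = 4" by blast
  then have "finite b" by (auto intro: card_ge_0_finite)
  with b c assms have "card (b - {x, y, z}) = 1" by (subst card_Diff_subset) auto
  then obtain w where "b - {x, y, z} = {w}" by (auto simp: card_1_singleton_iff)
  with b have "b = {x, y, z, w}" by blast
  with b that show ?thesis by blast
qed

lemma is_SQS_card:
  assumes fin: "finite X" and S: "is_SQS X B"
  shows "24 * card B = card X * (card X - 1) * (card X - 2)"
proof -
  let ?Ts = "{T. T \<subseteq> X \<and> card T = 3}"
  have "card {b \<in> B. T \<subseteq> b} = 1" if "T \<in> ?Ts" for T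
  proof -
    have "\<exists>!b. b \<in> B \<and> T \<subseteq> b" using that is_SQS_ex1[OF S] by simp
    then obtain b where "\<And>c. c \<in> B \<and> T \<subseteq> c \<longleftrightarrow> c = b" by (elim ex1E) blast
    then have "{b \<in> B. T \<subseteq> b} = {b}" by (simp add: set_eq_iff)
    then show ?thesis by simp
  qed
  then have "(\<Sum>T\<in>?Ts. card {b \<in> B. T \<subseteq> b}) = card ?Ts" by simp
  with sum_blocks_containing_triple[OF fin is_SQS_blockD[OF S]] card_triples[OF fin]
  show ?thesis by simp
qed

text \<open>Deleting \<open>o'\<close> from the blocks through it leaves a Steiner triple system on
  the remaining points; its incidences of pairs and blocks are counted in two ways.\<close>

lemma is_SQS_card_point:
  assumes fin: "finite X" and S: "is_SQS X B" and o: "o' \<in> X"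
  shows "6 * card {b \<in> B. o' \<in> b} = (card X - 1) * (card X - 2)"
proof -
  let ?Ps = "{P. P \<subseteq> X - {o'} \<and> card P = 2}"
  let ?Bo = "{b \<in> B. o' \<in> b}"
  have finP: "finite ?Ps" using fin by simp
  have finB: "finite ?Bo" using finite_blocks[OF fin is_SQS_blockD[OF S]] by simp
  have one: "card {b \<in> ?Bo. P \<subseteq> b} = 1" if "P \<in> ?Ps" for P
  proof -
    have "finite P" using that by (auto intro: card_ge_0_finite)
    moreover have "o' \<notin> P" using that by blast
    ultimately have "insert o' P \<subseteq> X" "card (insert o' P) = 3" using o that by auto
    from is_SQS_ex1[OF S this] obtain b where "\<And>c. c \<in> B \<and> insert o' P \<subseteq> c \<longleftrightarrow> c = b" by (elim ex1E) blast
    then have "{b \<in> ?Bo. P \<subseteq> b} = {b}" by (auto simp: set_eq_iff)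
    then show ?thesis by simp
  qed
  have three: "card {P \<in> ?Ps. P \<subseteq> b} = 3" if "b \<in> ?Bo" for b
  proof -
    have b: "b \<subseteq> X" "card b = 4" "o' \<in> b" using that is_SQS_blockD[OF S] by auto
    then have "finite (b - {o'})" "card (b - {o'}) = 3"
      by (auto intro: card_ge_0_finite simp: card_Diff_singleton)
    moreover have "{P \<in> ?Ps. P \<subseteq> b} = {P. P \<subseteq> b - {o'} \<and> card P = 2}" using b by blast
    ultimately show ?thesis using n_subsets[of "b - {o'}" 2] by (simp add: choose_two)
  qed
  have "card ?Ps = (\<Sum>P\<in>?Ps. card {b \<in> ?Bo. P \<subseteq> b})" using one by simp
  also have "\<dots> = (\<Sum>b\<in>?Bo. card {P \<in> ?Ps. P \<subseteq> b})"
    using sum.swap_restrict[of ?Ps ?Bo "\<lambda>_ _. 1::nat" "\<lambda>P b. P \<subseteq> b"] finP finB by simp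
  also have "\<dots> = 3 * card ?Bo" using three by simp
  finally have "3 * card ?Bo = (card X - 1) choose 2"
    using n_subsets[of "X - {o'}" 2] fin o by simp
  moreover have "2 * ((card X - 1) choose 2) = (card X - 1) * (card X - 2)"
    using two_choose_two[of "card X - 1"] by (simp add: numeral_2_eq_2)
  ultimately show ?thesis by simp
qed

lemma is_SQS_image:
  assumes bij: "bij_betw f X Y" and S: "is_SQS X B"
  shows "is_SQS Y ((`) f ` B)"
proof -
  have inj: "inj_on f X" and Y: "Y = f ` X" using bij by (auto simp: bij_betw_def)
  show ?thesis unfolding is_SQS_def
  proof (intro conjI ballI allI impI)
    fix b assume "b \<in> (`) f ` B"
    then obtain c where c: "c \<in> B" "b = f ` c" by blast
    with is_SQS_blockD[OF S] have "c \<subseteq> X" "card c = 4" by blast+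
    then show "b \<subseteq> Y" "card b = 4" using c Y card_image[OF inj_on_subset[OF inj]] by auto
  next
    fix T assume T: "T \<subseteq> Y \<and> card T = 3"
    then obtain U where U: "U \<subseteq> X" "T = f ` U" using Y by (auto simp: subset_image_iff)
    then have "card U = 3" using T card_image[OF inj_on_subset[OF inj U(1)]] by simp
    from is_SQS_block_ex[OF S U(1) this] obtain b where b: "b \<in> B" "U \<subseteq> b" ..
    show "\<exists>!b. b \<in> (`) f ` B \<and> T \<subseteq> b"
    proof (intro ex1I[of _ "f ` b"] conjI)
      show "f ` b \<in> (`) f ` B" "T \<subseteq> f ` b" using b U by auto
      fix c assume "c \<in> (`) f ` B \<and> T \<subseteq> c"
      then obtain d where d: "d \<in> B" "c = f ` d" "f ` U \<subseteq> f ` d" using U by blast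
      have "d \<subseteq> X" using d is_SQS_blockD[OF S] by blast
      then have "U \<subseteq> d" using d(3) inj U(1) by (simp add: inj_on_image_subset_iff)
      have "d = b" by (rule is_SQS_same_block[OF S d(1) b(1) \<open>U \<subseteq> d\<close> b(2) \<open>card U = 3\<close>])
      then show "c = f ` b" using d by simp
    qed
  qed
qed

subsection \<open>Trades and switching\<close>

text \<open>The period 12 is a common multiple of the factors 2, 6 and 12 by which systems are inflated below.\<close>

definition trade :: "'a set set \<Rightarrow> (int \<Rightarrow> 'a) \<Rightarrow> (int \<Rightarrow> 'a) \<Rightarrow> (int \<Rightarrow> 'a) \<Rightarrow> (int \<Rightarrow> 'a) \<Rightarrow> bool" where
  "trade B p q r s \<longleftrightarrow> (\<forall>i j k. {p i, q j, r k, s (- i - j - k)} \<in> B) \<and>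
     (\<forall>i. p (i + 12) = p i \<and> q (i + 12) = q i \<and> r (i + 12) = r i \<and> s (i + 12) = s i)"

definition trade_blocks :: "int \<Rightarrow> (int \<Rightarrow> 'a) \<Rightarrow> (int \<Rightarrow> 'a) \<Rightarrow> (int \<Rightarrow> 'a) \<Rightarrow> (int \<Rightarrow> 'a) \<Rightarrow> 'a set set" where
  "trade_blocks c p q r s = {{p i, q j, r k, s (c - i - j - k)} | i j k. True}"

lemma trade_block: "trade B p q r s \<Longrightarrow> i + j + k + l = 0 \<Longrightarrow> {p i, q j, r k, s l} \<in> B"
proof -
  assume t: "trade B p q r s" and "i + j + k + l = 0"
  then have "l = - i - j - k" by simp
  with t show ?thesis by (simp add: trade_def)
qed

lemma trade_block_rotations:
  assumes "trade B p q r s" "i + j + k + l = 0"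
  shows "{q j, r k, s l, p i} \<in> B" "{p i, r k, s l, q j} \<in> B" "{p i, q j, s l, r k} \<in> B"
  using trade_block[OF assms] by (simp_all add: insert_commute)

lemma trade_blocks_iff:
  "b \<in> trade_blocks c p q r s \<longleftrightarrow> (\<exists>i j k l. i + j + k + l = c \<and> b = {p i, q j, r k, s l})"
proof -
  have "(\<exists>i j k. b = {p i, q j, r k, s (c - i - j - k)}) \<longleftrightarrow>
        (\<exists>i j k l. i + j + k + l = c \<and> b = {p i, q j, r k, s l})" (is "?L \<longleftrightarrow> ?R")
  proof
    assume ?L
    then obtain i j k where "b = {p i, q j, r k, s (c - i - j - k)}" by blast
    moreover have "i + j + k + (c - i - j - k) = c" by simp
    ultimately show ?R by blast
  next
    assume ?R
    then obtain i j k l where "i + j + k + l = c" "b = {p i, q j, r k, s l}" by blast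
    moreover from this have "l = c - i - j - k" by simp
    ultimately have "b = {p i, q j, r k, s (c - i - j - k)}" by simp
    then show ?L by blast
  qed
  then show ?thesis by (simp add: trade_blocks_def)
qed

lemma trade_iff_blocks:
  "trade B p q r s \<longleftrightarrow> trade_blocks 0 p q r s \<subseteq> B \<and>
     (\<forall>i. p (i + 12) = p i \<and> q (i + 12) = q i \<and> r (i + 12) = r i \<and> s (i + 12) = s i)"
  unfolding trade_def trade_blocks_def by auto

lemma periodic_mod:
  fixes p :: "int \<Rightarrow> 'a"
  assumes per: "\<And>i. p (i + 12) = p i"
  shows "p (i mod 12) = p i"
proof -
  have up: "p (i + 12 * int n) = p i" for i n
  proof (induction n)
    case (Suc n)
    have "p (i + 12 * int (Suc n)) = p ((i + 12 * int n) + 12)" by (simp add: algebra_simps)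
    then show ?case using per Suc by simp
  qed simp
  show ?thesis
  proof (cases "i div 12 \<ge> 0")
    case True
    have "i = i mod 12 + 12 * int (nat (i div 12))" using True by simp
    then show ?thesis using up[of "i mod 12" "nat (i div 12)"] by simp
  next
    case False
    then have "i mod 12 = i + 12 * int (nat (- (i div 12)))"
      by (simp add: minus_mult_div_eq_mod[symmetric])
    then show ?thesis using up[of i "nat (- (i div 12))"] by simp
  qed
qed

lemma trade_periodic:
  assumes "trade B p q r s"
  shows "p (i mod 12) = p i" "q (i mod 12) = q i" "r (i mod 12) = r i" "s (i mod 12) = s i"
  using assms by (auto simp: trade_def intro!: periodic_mod)

text \<open>Any block of a trade can play the role of the block at index zero. This is needed when
  trades through a given block are counted.\<close>

lemma trade_shift:
  assumes "trade B p q r s"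
  shows "trade B (\<lambda>t. p (t + i)) (\<lambda>t. q (t + j)) (\<lambda>t. r (t + k)) (\<lambda>t. s (t - i - j - k))"
  unfolding trade_def
proof (intro conjI allI)
  fix a b c
  show "{p (a + i), q (b + j), r (c + k), s (- a - b - c - i - j - k)} \<in> B"
    by (rule trade_block[OF assms]) simp
next
  fix a
  show "p (a + 12 + i) = p (a + i)" "q (a + 12 + j) = q (a + j)" "r (a + 12 + k) = r (a + k)"
    "s (a + 12 - i - j - k) = s (a - i - j - k)"
    using assms[unfolded trade_def, THEN conjunct2, rule_format, of "a + i"]
      assms[unfolded trade_def, THEN conjunct2, rule_format, of "a + j"]
      assms[unfolded trade_def, THEN conjunct2, rule_format, of "a + k"]
      assms[unfolded trade_def, THEN conjunct2, rule_format, of "a - i - j - k"]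
    by (simp_all add: algebra_simps)
qed

context
  fixes X :: "'a set" and B :: "'a set set"
  assumes S: "is_SQS X B"
begin

text \<open>Each block gives its fourth point from the other three. This yields \<open>s 0\<close>
  and \<open>q (- 1)\<close>, and then alternately \<open>r (- n)\<close> from the block with
  \<open>p n\<close>, \<open>q 0\<close>, \<open>s 0\<close> and \<open>p (n + 1)\<close> from the
  block with \<open>q (- 1)\<close>, \<open>r (- n)\<close>, \<open>s 0\<close>. So there are at
  most \<open>card X ^ 4\<close> trades.\<close>

lemma trade_determined:
  assumes t: "trade B p q r s" and t': "trade B p' q' r' s'"
    and eq: "p 0 = p' 0" "q 0 = q' 0" "r 0 = r' 0" "p 1 = p' 1"
  shows "p = p' \<and> q = q' \<and> r = r' \<and> s = s'"
proof -
  note U = is_SQS_unique[OF S]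
  note b = trade_block[OF t] trade_block_rotations[OF t]
  note b' = trade_block[OF t'] trade_block_rotations[OF t']
  have s0: "s 0 = s' 0" by (rule U[of "p 0" "q 0" "r 0"]) (use b(1)[of 0 0 0 0] b'(1)[of 0 0 0 0] eq in simp_all)
  have qm: "q (- 1) = q' (- 1)"
    by (rule U[of "p 1" "r 0" "s 0"]) (use b(3)[of 1 "- 1" 0 0] b'(3)[of 1 "- 1" 0 0] eq s0 in simp_all)
  have pn: "p (int n) = p' (int n)" for n
  proof (induction n)
    case 0
    then show ?case using eq by simp
  next
    case (Suc n)
    have rm: "r (- int n) = r' (- int n)"
      by (rule U[of "p (int n)" "q 0" "s 0"])
        (use b(4)[of "int n" 0 "- int n" 0] b'(4)[of "int n" 0 "- int n" 0] eq s0 Suc in simp_all)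
    show ?case
      by (rule U[of "q (- 1)" "r (- int n)" "s 0"])
        (use b(2)[of "int (Suc n)" "- 1" "- int n" 0] b'(2)[of "int (Suc n)" "- 1" "- int n" 0] qm rm s0 in simp_all)
  qed
  have p: "p i = p' i" for i
  proof -
    have "p (i mod 12) = p' (i mod 12)" using pn[of "nat (i mod 12)"] by simp
    then show ?thesis using trade_periodic(1)[OF t, of i] trade_periodic(1)[OF t', of i] by simp
  qed
  have q: "q i = q' i" for i
    by (rule U[of "p (- i)" "r 0" "s 0"]) (use b(3)[of "- i" i 0 0] b'(3)[of "- i" i 0 0] eq s0 p in simp_all)
  have r: "r i = r' i" for i
    by (rule U[of "p (- i)" "q 0" "s 0"]) (use b(4)[of "- i" 0 i 0] b'(4)[of "- i" 0 i 0] eq s0 p in simp_all)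
  have s: "s i = s' i" for i
    by (rule U[of "p (- i)" "q 0" "r 0"]) (use b(1)[of "- i" 0 0 i] b'(1)[of "- i" 0 0 i] eq p in simp_all)
  from p q r s show ?thesis by auto
qed

lemma trade_points:
  assumes t: "trade B p q r s"
  shows "p i \<in> X" "q i \<in> X" "r i \<in> X" "s i \<in> X"
    "p i \<noteq> q j" "p i \<noteq> r j" "p i \<noteq> s j" "q i \<noteq> r j" "q i \<noteq> s j" "r i \<noteq> s j"
proof -
  note d = is_SQS_distinct[OF S trade_block[OF t]]
  show "p i \<in> X" by (rule d(7)[of i "- i" 0 0]) simp
  show "q i \<in> X" by (rule d(8)[of "- i" i 0 0]) simp
  show "r i \<in> X" by (rule d(9)[of "- i" 0 i 0]) simp
  show "s i \<in> X" by (rule d(10)[of "- i" 0 0 i]) simp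
  show "p i \<noteq> q j" by (rule d(1)[of i j "- i - j" 0]) simp
  show "p i \<noteq> r j" by (rule d(2)[of i "- i - j" j 0]) simp
  show "p i \<noteq> s j" by (rule d(3)[of i "- i - j" 0 j]) simp
  show "q i \<noteq> r j" by (rule d(4)[of "- i - j" i j 0]) simp
  show "q i \<noteq> s j" by (rule d(5)[of "- i - j" i 0 j]) simp
  show "r i \<noteq> s j" by (rule d(6)[of "- i - j" 0 i j]) simp
qed

text \<open>A coincidence \<open>s a = s b\<close> makes corresponding blocks share three points,
  first for \<open>p\<close> and from there back for \<open>s\<close>; hence a repetition in one
  sequence is a period.\<close>

lemma trade_period:
  assumes t: "trade B p q r s" and eq: "s a = s b"
  shows "p (i - a) = p (i - b)" "s (i + a) = s (i + b)"
proof -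
  have p: "p (i - a) = p (i - b)" for i
    by (rule is_SQS_unique[OF S, of "q (- i)" "r 0" "s a"])
      (use trade_block_rotations(1)[OF t, of "i - a" "- i" 0 a]
        trade_block_rotations(1)[OF t, of "i - b" "- i" 0 b] eq in simp_all)
  then show "p (i - a) = p (i - b)" .
  show "s (i + a) = s (i + b)"
    by (rule is_SQS_unique[OF S, of "p (- a)" "q (- i)" "r 0"])
      (use trade_block[OF t, of "- a" "- i" 0 "i + a"]
        trade_block[OF t, of "- b" "- i" 0 "i + b"] p[of 0] in simp_all)
qed

text \<open>This is the purpose of properness: a new block in \<open>B\<close> would agree in three
  points with an old one, giving \<open>s l = s (l - 1)\<close> and, as a period,
  \<open>p 0 = p 1\<close>.\<close>

lemma trade_blocks_1_disjoint:
  assumes t: "trade B p q r s" and ne: "p 0 \<noteq> p 1"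
  shows "trade_blocks 1 p q r s \<inter> B = {}"
proof (rule ccontr)
  assume "trade_blocks 1 p q r s \<inter> B \<noteq> {}"
  then obtain i j k l where l: "i + j + k + l = 1" "{p i, q j, r k, s l} \<in> B"
    by (auto simp: trade_blocks_iff)
  have "s l = s (l - 1)"
    by (rule is_SQS_unique[OF S l(2)], rule trade_block[OF t]) (use l in simp)
  from trade_period(1)[OF t this, of l] ne show False by simp
qed

text \<open>By periodicity three indices modulo 12 describe a block, and
  \<open>1728 = 12 ^ 3\<close>.\<close>

lemma finite_trade_blocks:
  assumes t: "trade B p q r s"
  shows "finite (trade_blocks c p q r s)" "card (trade_blocks c p q r s) \<le> 1728"
proof -
  let ?f = "\<lambda>(i, j, k). {p i, q j, r k, s (c - i - j - k)}"
  let ?I = "{0..<12} \<times> {0..<12} \<times> {0..<12} :: (int \<times> int \<times> int) set"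
  have sub: "trade_blocks c p q r s \<subseteq> ?f ` ?I"
  proof
    fix b assume "b \<in> trade_blocks c p q r s"
    then obtain i j k where b: "b = {p i, q j, r k, s (c - i - j - k)}"
      by (auto simp: trade_blocks_def)
    have "s (c - i mod 12 - j mod 12 - k mod 12) = s ((c - i mod 12 - j mod 12 - k mod 12) mod 12)"
      using trade_periodic(4)[OF t] by simp
    also have "(c - i mod 12 - j mod 12 - k mod 12) mod 12 = (c - i - j - k) mod 12"
      by (intro mod_diff_cong) simp_all
    also have "s \<dots> = s (c - i - j - k)" using trade_periodic(4)[OF t] by simp
    finally have "b = ?f (i mod 12, j mod 12, k mod 12)"
      using b trade_periodic[OF t] by simp
    then show "b \<in> ?f ` ?I" by (rule image_eqI) simp
  qed
  then show "finite (trade_blocks c p q r s)" by (rule finite_subset) simp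
  have "card (trade_blocks c p q r s) \<le> card (?f ` ?I)" by (rule card_mono[OF _ sub]) simp
  also have "\<dots> \<le> card ?I" by (rule card_image_le) simp
  finally show "card (trade_blocks c p q r s) \<le> 1728" by simp
qed

lemma card_trade_blocks_le:
  assumes t: "trade B p q r s"
  shows "card (trade_blocks 1 p q r s) \<le> card (trade_blocks 0 p q r s)"
proof -
  \<comment> \<open>Advances \<open>s\<close> by one index and fixes all other points; by
    \<open>trade_period\<close> the value does not depend on the chosen index. This map carries the
    old blocks onto the new ones.\<close>
  define \<sigma> where "\<sigma> x = (if \<exists>a. x = s a then s ((SOME a. x = s a) + 1) else x)" for x
  have s: "\<sigma> (s a) = s (a + 1)" for a
  proof -
    have "s a = s (SOME b. s a = s b)" by (rule someI[of _ a]) simp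
    from trade_period(2)[OF t this, of 1] show ?thesis
      unfolding \<sigma>_def by (auto simp: add.commute)
  qed
  have pqr: "\<sigma> (p i) = p i" "\<sigma> (q i) = q i" "\<sigma> (r i) = r i" for i
    using trade_points[OF t] by (auto simp: \<sigma>_def)
  have "trade_blocks 1 p q r s \<subseteq> (`) \<sigma> ` trade_blocks 0 p q r s"
  proof
    fix b assume "b \<in> trade_blocks 1 p q r s"
    then obtain i j k l where b: "i + j + k + l = 1" "b = {p i, q j, r k, s l}"
      by (auto simp: trade_blocks_iff)
    then have "b = \<sigma> ` {p i, q j, r k, s (l - 1)}" using s[of "l - 1"] pqr by simp
    moreover have "{p i, q j, r k, s (l - 1)} \<in> trade_blocks 0 p q r s"
      using b unfolding trade_blocks_iff by (intro exI[of _ i] exI[of _ j] exI[of _ k] exI[of _ "l - 1"]) simp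
    ultimately show "b \<in> (`) \<sigma> ` trade_blocks 0 p q r s" by blast
  qed
  then have "card (trade_blocks 1 p q r s) \<le> card ((`) \<sigma> ` trade_blocks 0 p q r s)"
    by (intro card_mono) (simp_all add: finite_trade_blocks[OF t])
  also have "\<dots> \<le> card (trade_blocks 0 p q r s)" by (rule card_image_le) (rule finite_trade_blocks[OF t])
  finally show ?thesis .
qed

text \<open>Both block families cover the same triples: three of the indices determine the fourth.\<close>

lemma is_SQS_switch:
  assumes fin: "finite X" and t: "trade B p q r s"
  shows "is_SQS X (B - trade_blocks 0 p q r s \<union> trade_blocks 1 p q r s)"
proof (rule is_SQS_I[OF fin])
  let ?T = "trade_blocks 0 p q r s" and ?T' = "trade_blocks 1 p q r s"
  have TB: "?T \<subseteq> B" using t by (simp add: trade_iff_blocks)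
  fix b assume "b \<in> B - ?T \<union> ?T'"
  then show "b \<subseteq> X \<and> card b = 4"
  proof
    assume "b \<in> ?T'"
    then obtain i j k l where "b = {p i, q j, r k, s l}" by (auto simp: trade_blocks_iff)
    then show ?thesis using trade_points[OF t] by simp
  qed (use is_SQS_blockD[OF S] in blast)
next
  let ?T = "trade_blocks 0 p q r s" and ?T' = "trade_blocks 1 p q r s"
  fix x y z assume d: "x \<in> X" "y \<in> X" "z \<in> X" "x \<noteq> y" "x \<noteq> z" "y \<noteq> z"
  obtain w where w: "{x, y, z, w} \<in> B" using is_SQS_ex[OF S d] .
  show "\<exists>b\<in>B - ?T \<union> ?T'. x \<in> b \<and> y \<in> b \<and> z \<in> b"
  proof (cases "{x, y, z, w} \<in> ?T")
    case False
    with w show ?thesis by (intro bexI[of _ "{x, y, z, w}"]) auto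
  next
    case True
    then obtain i j k l where b: "i + j + k + l = 0" "{x, y, z, w} = {p i, q j, r k, s l}"
      by (auto simp: trade_blocks_iff)
    have nw: "x \<noteq> w" "y \<noteq> w" "z \<noteq> w" using is_SQS_distinct[OF S w] by auto
    have xyz: "x \<in> {p i, q j, r k, s l}" "y \<in> {p i, q j, r k, s l}" "z \<in> {p i, q j, r k, s l}"
      "w \<in> {p i, q j, r k, s l}"
      using b(2) by (auto simp: set_eq_iff)
    \<comment> \<open>The point \<open>w\<close> occupies one of the four places. Raising the index
      at that place gives a new block which keeps the other three points.\<close>
    have "{p (i + 1), q j, r k, s l} \<in> ?T'" "{p i, q (j + 1), r k, s l} \<in> ?T'"
      "{p i, q j, r (k + 1), s l} \<in> ?T'" "{p i, q j, r k, s (l + 1)} \<in> ?T'"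
      using b(1) unfolding trade_blocks_iff
      by (metis (no_types, opaque_lifting) add.assoc add.commute add.right_neutral)+
    then show ?thesis using xyz nw by (smt (verit) UnI2 insert_iff singletonD)
  qed
next
  let ?T = "trade_blocks 0 p q r s" and ?T' = "trade_blocks 1 p q r s"
  have TB: "?T \<subseteq> B" using t by (simp add: trade_iff_blocks)
  have fB: "finite B" using finite_blocks[OF fin is_SQS_blockD[OF S]] .
  have "card (B - ?T \<union> ?T') \<le> card (B - ?T) + card ?T'" by (rule card_Un_le)
  also have "\<dots> \<le> card (B - ?T) + card ?T" using card_trade_blocks_le[OF t] by simp
  also have "\<dots> = card B" using TB fB card_mono[OF fB TB] by (simp add: card_Diff_subset finite_subset)
  finally show "24 * card (B - ?T \<union> ?T') \<le> card X * (card X - 1) * (card X - 2)"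
    using is_SQS_card[OF fin S] by simp
qed

end

section \<open>Greedy selection of disjoint trades\<close>

type_synonym 'a quad_fun = "(int \<Rightarrow> 'a) \<times> (int \<Rightarrow> 'a) \<times> (int \<Rightarrow> 'a) \<times> (int \<Rightarrow> 'a)"

definition trades :: "'a set set \<Rightarrow> 'a quad_fun set" where
  "trades B = {(p, q, r, s). trade B p q r s}"

definition proper_trades :: "'a set set \<Rightarrow> 'a quad_fun set" where
  "proper_trades B = {(p, q, r, s). trade B p q r s \<and> p 0 \<noteq> p 1}"

definition tblocks :: "int \<Rightarrow> 'a quad_fun \<Rightarrow> 'a set set" where
  "tblocks c t = (case t of (p, q, r, s) \<Rightarrow> trade_blocks c p q r s)"

definition tbase :: "'a quad_fun \<Rightarrow> 'a \<times> 'a \<times> 'a" where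
  "tbase t = (case t of (p, q, r, s) \<Rightarrow> (p 0, q 0, r 0))"

fun independent :: "'a set set \<Rightarrow> 'a quad_fun list \<Rightarrow> bool" where
  "independent B [] = True"
| "independent B (t # ts) = (t \<in> proper_trades B \<and> independent B ts \<and>
     (\<forall>u\<in>set ts. tblocks 0 t \<inter> tblocks 0 u = {}))"

fun switch :: "'a set set \<Rightarrow> 'a quad_fun list \<Rightarrow> 'a set set" where
  "switch B [] = B"
| "switch B (t # ts) = switch B ts - tblocks 0 t \<union> tblocks 1 t"

lemma independent_set: "independent B ts \<Longrightarrow> set ts \<subseteq> proper_trades B"
  by (induction ts) auto

context
  fixes X :: "'a set" and B :: "'a set set"
  assumes S: "is_SQS X B" and fin: "finite X"
begin

lemma finite_trades: "finite (trades B)"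
proof (rule inj_on_finite[of "\<lambda>(p, q, r, s). (p 0, q 0, r 0, p 1)" _ "X \<times> X \<times> X \<times> X"])
  show "inj_on (\<lambda>(p, q, r, s). (p 0, q 0, r 0, p 1)) (trades B)"
    using trade_determined[OF S] by (intro inj_onI) (auto simp: trades_def)
  show "(\<lambda>(p, q, r, s). (p 0, q 0, r 0, p 1)) ` trades B \<subseteq> X \<times> X \<times> X \<times> X"
    using trade_points[OF S] by (auto simp: trades_def)
qed (use fin in auto)

lemma proper_trades_subset: "proper_trades B \<subseteq> trades B"
  by (auto simp: trades_def proper_trades_def)

lemma finite_proper_trades: "finite (proper_trades B)"
  using finite_trades proper_trades_subset by (rule finite_subset[rotated])

text \<open>For an improper trade \<open>p 1 = p 0\<close>, so by \<open>trade_determined\<close>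
  its base triple determines it.\<close>

lemma card_proper_trades: "card (trades B) \<le> card (proper_trades B) + card X ^ 3"
proof -
  let ?C = "{(p, q, r, s). trade B p q r s \<and> p 0 = p 1}"
  have "card ?C \<le> card (X \<times> X \<times> X)"
  proof (rule card_inj_on_le[of "\<lambda>(p, q, r, s). (p 0, q 0, r 0)"])
    show "inj_on (\<lambda>(p, q, r, s). (p 0, q 0, r 0)) ?C"
    proof (rule inj_onI)
      fix t u assume t: "t \<in> ?C" and u: "u \<in> ?C"
        and e: "(\<lambda>(p, q, r, s). (p 0, q 0, r 0)) t = (\<lambda>(p, q, r, s). (p 0, q 0, r 0)) u"
      obtain p q r s p' q' r' s' where tu: "t = (p, q, r, s)" "u = (p', q', r', s')"
        by (cases t, cases u)
      have *: "trade B p q r s" "p 0 = p 1" "trade B p' q' r' s'" "p' 0 = p' 1"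
        using t u by (simp_all add: tu)
      have e': "p 0 = p' 0" "q 0 = q' 0" "r 0 = r' 0" using e by (simp_all add: tu)
      then have "p 1 = p' 1" using * by simp
      from trade_determined[OF S *(1,3) e' this] show "t = u" by (simp add: tu)
    qed
  qed (use trade_points[OF S] fin in auto)
  also have "\<dots> = card X ^ 3" by (simp add: card_cartesian_product power3_eq_cube)
  finally have C: "card ?C \<le> card X ^ 3" .
  have "trades B = proper_trades B \<union> ?C" by (auto simp: trades_def proper_trades_def)
  then have "card (trades B) \<le> card (proper_trades B) + card ?C" by (simp add: card_Un_le)
  with C show ?thesis by simp
qed

text \<open>The trades can be switched one after another: by independence the old blocks of the next
  trade are still present, and removing them destroys no new block, because these are old blocks in
  \<open>B\<close> while the new blocks of all proper trades lie outside \<open>B\<close>.\<close>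

lemma switch_properties:
  assumes "independent B ts"
  shows "is_SQS X (switch B ts)"
    and "b \<in> B \<Longrightarrow> (\<And>u. u \<in> set ts \<Longrightarrow> b \<notin> tblocks 0 u) \<Longrightarrow> b \<in> switch B ts"
    and "u \<in> set ts \<Longrightarrow> tblocks 1 u \<subseteq> switch B ts"
proof -
  have "is_SQS X (switch B ts) \<and>
    (\<forall>b\<in>B. (\<forall>u\<in>set ts. b \<notin> tblocks 0 u) \<longrightarrow> b \<in> switch B ts) \<and>
    (\<forall>u\<in>set ts. tblocks 1 u \<subseteq> switch B ts)"
    using assms
  proof (induction ts)
    case Nil
    then show ?case using S by simp
  next
    case (Cons t ts)
    obtain p q r s where t: "t = (p, q, r, s)" by (cases t)
    with Cons.prems have tr: "trade B p q r s" "p 0 \<noteq> p 1" and ind: "independent B ts"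
      by (auto simp: proper_trades_def)
    have IH: "is_SQS X (switch B ts)"
      "\<And>b. b \<in> B \<Longrightarrow> (\<forall>u\<in>set ts. b \<notin> tblocks 0 u) \<Longrightarrow> b \<in> switch B ts"
      "\<And>u. u \<in> set ts \<Longrightarrow> tblocks 1 u \<subseteq> switch B ts"
      using Cons.IH[OF ind] by auto
    have TB: "tblocks 0 t \<subseteq> B" using tr by (simp add: t tblocks_def trade_iff_blocks)
    have "tblocks 0 t \<subseteq> switch B ts" using TB IH(2) Cons.prems by auto
    then have "trade (switch B ts) p q r s" using tr by (simp add: t tblocks_def trade_iff_blocks)
    from is_SQS_switch[OF IH(1) fin this]
    have 1: "is_SQS X (switch B (t # ts))" by (simp add: t tblocks_def)
    have 3: "tblocks 1 u \<subseteq> switch B (t # ts)" if "u \<in> set (t # ts)" for u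
    proof (cases "u = t")
      case False
      with that have u: "u \<in> set ts" by simp
      obtain p' q' r' s' where u': "u = (p', q', r', s')" by (cases u)
      with u independent_set[OF ind] have "trade B p' q' r' s'" "p' 0 \<noteq> p' 1"
        by (auto simp: proper_trades_def)
      from trade_blocks_1_disjoint[OF S this] have "tblocks 1 u \<inter> B = {}"
        by (simp add: u' tblocks_def)
      with TB IH(3)[OF u] show ?thesis by auto
    qed simp
    show ?case using 1 3 IH(2) by auto
  qed
  then show "is_SQS X (switch B ts)"
    and "b \<in> B \<Longrightarrow> (\<And>u. u \<in> set ts \<Longrightarrow> b \<notin> tblocks 0 u) \<Longrightarrow> b \<in> switch B ts"
    and "u \<in> set ts \<Longrightarrow> tblocks 1 u \<subseteq> switch B ts" by auto
qed

text \<open>A proper trade can be read off from the switched system and its base triple: the block of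
  the new system through \<open>q 0\<close>, \<open>r 0\<close>, \<open>s 0\<close> reveals \<open>p 1\<close>.\<close>

lemma switch_determines_trade:
  assumes S': "is_SQS X B'" and t: "t \<in> proper_trades B" and u: "u \<in> proper_trades B"
    and sub: "tblocks 1 t \<subseteq> B'" "tblocks 1 u \<subseteq> B'" and base: "tbase t = tbase u"
  shows "t = u"
proof -
  obtain p q r s p' q' r' s' where tu: "t = (p, q, r, s)" "u = (p', q', r', s')"
    by (cases t, cases u)
  with t u have tr: "trade B p q r s" "trade B p' q' r' s'" by (auto simp: proper_trades_def)
  have eq: "p 0 = p' 0" "q 0 = q' 0" "r 0 = r' 0" using base by (auto simp: tu tbase_def)
  have s0: "s 0 = s' 0"
    by (rule is_SQS_unique[OF S, of "p 0" "q 0" "r 0"])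
      (use trade_block[OF tr(1), of 0 0 0 0] trade_block[OF tr(2), of 0 0 0 0] eq in simp_all)
  have "{p 1, q 0, r 0, s 0} \<in> tblocks 1 t" "{p' 1, q' 0, r' 0, s' 0} \<in> tblocks 1 u"
    unfolding tu tblocks_def prod.case trade_blocks_iff
    by (intro exI[of _ 1] exI[of _ 0]; simp)+
  then have "{p 1, q 0, r 0, s 0} \<in> B'" "{p' 1, q 0, r 0, s 0} \<in> B'" using sub eq s0 by auto
  then have "{q 0, r 0, s 0, p 1} \<in> B'" "{q 0, r 0, s 0, p' 1} \<in> B'"
    by (simp_all add: insert_commute)
  then have "p 1 = p' 1" by (rule is_SQS_unique[OF S'])
  from trade_determined[OF S tr eq this] show ?thesis by (simp add: tu)
qed

definition indep_lists :: "nat \<Rightarrow> 'a quad_fun list set" where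
  "indep_lists m = {ts. independent B ts \<and> length ts = m}"

lemma finite_indep_lists: "finite (indep_lists m)"
  by (rule finite_subset[OF _ finite_lists_length_eq[OF finite_proper_trades, of m]])
    (auto simp: indep_lists_def dest: independent_set)

lemma finite_SQS_set: "finite {B'. is_SQS X B'}"
  by (rule finite_subset[of _ "Pow (Pow X)"]) (use fin in \<open>auto simp: is_SQS_def\<close>)

text \<open>A list is encoded by the switched system together with its base triples. All entries are
  decoded from the same final system, which contains the new blocks of each of them.\<close>

lemma card_indep_lists_le:
  "card (indep_lists m) \<le> card {B'. is_SQS X B'} * (card X ^ 3) ^ m"
proof -
  let ?F = "\<lambda>ts. (switch B ts, map tbase ts)"
  let ?L = "{xs. set xs \<subseteq> X \<times> X \<times> X \<and> length xs = m}"
  have inj: "inj_on ?F (indep_lists m)"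
  proof (rule inj_onI)
    fix ts us assume ts: "ts \<in> indep_lists m" and us: "us \<in> indep_lists m" and eq: "?F ts = ?F us"
    then have ind: "independent B ts" "independent B us" and len: "length ts = m" "length us = m"
      and sw: "switch B ts = switch B us" and mp: "map tbase ts = map tbase us"
      by (auto simp: indep_lists_def)
    show "ts = us"
    proof (rule nth_equalityI)
      fix i assume i: "i < length ts"
      then have mem: "ts ! i \<in> set ts" "us ! i \<in> set us" using len by auto
      show "ts ! i = us ! i"
      proof (rule switch_determines_trade[OF switch_properties(1)[OF ind(1)]])
        show "ts ! i \<in> proper_trades B" "us ! i \<in> proper_trades B"
          using mem independent_set ind by blast+
        show "tblocks 1 (ts ! i) \<subseteq> switch B ts" "tblocks 1 (us ! i) \<subseteq> switch B ts"
          using switch_properties(3) ind mem sw by metis+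
        show "tbase (ts ! i) = tbase (us ! i)" using mp i len by (metis nth_map)
      qed
    qed (use len in simp)
  qed
  have "card (indep_lists m) \<le> card ({B'. is_SQS X B'} \<times> ?L)"
  proof (rule card_inj_on_le[OF inj])
    show "?F ` indep_lists m \<subseteq> {B'. is_SQS X B'} \<times> ?L"
    proof clarify
      fix ts assume "ts \<in> indep_lists m"
      then have ind: "independent B ts" "length ts = m" by (auto simp: indep_lists_def)
      have "tbase t \<in> X \<times> X \<times> X" if "t \<in> proper_trades B" for t
        using that trade_points[OF S] by (auto simp: proper_trades_def tbase_def)
      then have "tbase ` set ts \<subseteq> X \<times> X \<times> X" using independent_set[OF ind(1)] by blast
      then show "switch B ts \<in> {B'. is_SQS X B'} \<and> map tbase ts \<in> ?L"
        using switch_properties(1)[OF ind(1)] ind(2) by simp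
    qed
    show "finite ({B'. is_SQS X B'} \<times> ?L)"
      using finite_SQS_set fin by (intro finite_cartesian_product finite_lists_length_eq) auto
  qed
  also have "\<dots> = card {B'. is_SQS X B'} * (card X ^ 3) ^ m"
    using fin by (simp add: card_cartesian_product card_lists_length_eq power3_eq_cube mult.assoc)
  finally show ?thesis .
qed

text \<open>Fix the indices at which the trade uses a block of \<open>U\<close>, at most
  \<open>12 ^ 3\<close> possibilities by periodicity. After a shift the trade is determined by an
  ordered triple of points of that block, at most \<open>4 ^ 3 = 64\<close>, and one further value
  of \<open>p\<close>. Only linearly many trades meet a block.\<close>

lemma card_trades_hitting:
  assumes finU: "finite U" and U: "U \<subseteq> B"
  shows "card {t \<in> proper_trades B. tblocks 0 t \<inter> U \<noteq> {}} \<le> 1728 * (card U * (64 * card X))"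
proof -
  let ?I = "{0..<12} \<times> {0..<12} \<times> {0..<12} :: (int \<times> int \<times> int) set"
  define H where "H = (\<lambda>(i, j, k). {(p, q, r, s). trade B p q r s \<and> {p i, q j, r k, s (- i - j - k)} \<in> U})"
  let ?W = "\<Union>b\<in>U. b \<times> b \<times> b \<times> X"
  have finb: "finite b \<and> card b = 4" if "b \<in> U" for b
    using that U is_SQS_blockD[OF S] fin finite_subset by blast
  have finW: "finite ?W" using finU finb fin by auto
  have cW: "card ?W \<le> card U * (64 * card X)"
  proof -
    have "card ?W \<le> (\<Sum>b\<in>U. card (b \<times> b \<times> b \<times> X))" by (rule card_UN_le[OF finU])
    also have "\<dots> = (\<Sum>b\<in>U. 64 * card X)"
      by (rule sum.cong) (use finb in \<open>auto simp: card_cartesian_product\<close>)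
    finally show ?thesis by simp
  qed
  have cH: "card (H (i, j, k)) \<le> card U * (64 * card X)" for i j k
  proof -
    have "card (H (i, j, k)) \<le> card ?W"
    proof (rule card_inj_on_le[of "\<lambda>(p, q, r, s). (p i, q j, r k, p (1 + i))"])
      show "inj_on (\<lambda>(p, q, r, s). (p i, q j, r k, p (1 + i))) (H (i, j, k))"
      proof (rule inj_onI, clarsimp simp: H_def)
        fix p q r s p' q' r' s'
        assume t: "trade B p q r s" "trade B p' q' r' s'"
          and eq: "p i = p' i" "q j = q' j" "r k = r' k" "p (1 + i) = p' (1 + i)"
        have "(\<lambda>t. p (t + i)) = (\<lambda>t. p' (t + i)) \<and> (\<lambda>t. q (t + j)) = (\<lambda>t. q' (t + j)) \<and>
          (\<lambda>t. r (t + k)) = (\<lambda>t. r' (t + k)) \<and> (\<lambda>t. s (t - i - j - k)) = (\<lambda>t. s' (t - i - j - k))"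
          by (rule trade_determined[OF S trade_shift[OF t(1)] trade_shift[OF t(2)]]) (use eq in simp_all)
        then have *: "\<And>t. p (t + i) = p' (t + i)" "\<And>t. q (t + j) = q' (t + j)"
          "\<And>t. r (t + k) = r' (t + k)" "\<And>t. s (t - i - j - k) = s' (t - i - j - k)"
          by (metis)+
        have "p x = p' x" "q x = q' x" "r x = r' x" "s x = s' x" for x
          using *(1)[of "x - i"] *(2)[of "x - j"] *(3)[of "x - k"] *(4)[of "x + i + j + k"] by simp_all
        then show "p = p' \<and> q = q' \<and> r = r' \<and> s = s'" by auto
      qed
      show "(\<lambda>(p, q, r, s). (p i, q j, r k, p (1 + i))) ` H (i, j, k) \<subseteq> ?W"
        using trade_points(1)[OF S] by (auto simp: H_def)
    qed (rule finW)
    with cW show ?thesis by simp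
  qed
  have finH: "finite (H x)" for x
    by (rule finite_subset[OF _ finite_trades]) (auto simp: H_def trades_def split: prod.splits)
  have sub: "{t \<in> proper_trades B. tblocks 0 t \<inter> U \<noteq> {}} \<subseteq> (\<Union>x\<in>?I. H x)"
  proof
    fix t assume "t \<in> {t \<in> proper_trades B. tblocks 0 t \<inter> U \<noteq> {}}"
    then obtain p q r s where t: "t = (p, q, r, s)" "trade B p q r s" "trade_blocks 0 p q r s \<inter> U \<noteq> {}"
      by (cases t) (auto simp: proper_trades_def tblocks_def)
    then obtain i j k where b: "{p i, q j, r k, s (- i - j - k)} \<in> U" by (auto simp: trade_blocks_def)
    have "s (- (i mod 12) - j mod 12 - k mod 12) = s ((- (i mod 12) - j mod 12 - k mod 12) mod 12)"
      using trade_periodic(4)[OF t(2)] by simp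
    also have "(- (i mod 12) - j mod 12 - k mod 12) mod 12 = (- i - j - k) mod 12"
      by (intro mod_diff_cong mod_minus_cong) simp_all
    also have "s \<dots> = s (- i - j - k)" using trade_periodic(4)[OF t(2)] by simp
    finally have "t \<in> H (i mod 12, j mod 12, k mod 12)"
      using b t trade_periodic[OF t(2)] by (simp add: H_def)
    then show "t \<in> (\<Union>x\<in>?I. H x)" by (rule UN_I[rotated]) simp
  qed
  have "card {t \<in> proper_trades B. tblocks 0 t \<inter> U \<noteq> {}} \<le> card (\<Union>x\<in>?I. H x)"
    by (rule card_mono[OF _ sub]) (use finH in simp)
  also have "\<dots> \<le> (\<Sum>x\<in>?I. card (H x))" by (rule card_UN_le) simp
  also have "\<dots> \<le> (\<Sum>x\<in>?I. card U * (64 * card X))" by (rule sum_mono) (use cH in auto)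
  also have "\<dots> = 1728 * (card U * (64 * card X))" by (simp add: card_cartesian_product)
  finally show ?thesis .
qed

text \<open>The constant is \<open>1728 * 1728 * 64\<close>: each chosen trade has at most 1728
  blocks, and each of these is met by at most \<open>1728 * 64 * card X\<close> trades.\<close>

lemma card_extensions_ge:
  assumes ts: "ts \<in> indep_lists m"
  shows "card (trades B) \<le> card {t \<in> proper_trades B. \<forall>u\<in>set ts. tblocks 0 t \<inter> tblocks 0 u = {}}
    + card X ^ 3 + 191102976 * m * card X"
proof -
  define U where "U = (\<Union>u\<in>set ts. tblocks 0 u)"
  let ?E = "{t \<in> proper_trades B. \<forall>u\<in>set ts. tblocks 0 t \<inter> tblocks 0 u = {}}"
  let ?H = "{t \<in> proper_trades B. tblocks 0 t \<inter> U \<noteq> {}}"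
  have ind: "independent B ts" "length ts = m" using ts by (auto simp: indep_lists_def)
  have one: "finite (tblocks 0 u) \<and> card (tblocks 0 u) \<le> 1728 \<and> tblocks 0 u \<subseteq> B" if "u \<in> set ts" for u
  proof -
    obtain p q r s where u: "u = (p, q, r, s)" by (cases u)
    with that independent_set[OF ind(1)] have "trade B p q r s" by (auto simp: proper_trades_def)
    then show ?thesis using finite_trade_blocks[OF S] by (simp add: u tblocks_def trade_iff_blocks)
  qed
  have "card U \<le> (\<Sum>u\<in>set ts. card (tblocks 0 u))" unfolding U_def by (rule card_UN_le) simp
  also have "\<dots> \<le> (\<Sum>u\<in>set ts. 1728)" by (rule sum_mono) (use one in auto)
  also have "\<dots> \<le> 1728 * m" using card_length[of ts] ind(2) by simp
  finally have cU: "card U \<le> 1728 * m" .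
  have "card ?H \<le> 1728 * (card U * (64 * card X))"
  proof (rule card_trades_hitting)
    show "finite U" unfolding U_def by (rule finite_UN_I) (use one in blast)+
    show "U \<subseteq> B" unfolding U_def by (rule UN_least) (use one in blast)
  qed
  also have "\<dots> \<le> 1728 * (1728 * m * (64 * card X))" using cU by (intro mult_le_mono) auto
  finally have cH: "card ?H \<le> 191102976 * m * card X" by simp
  have "proper_trades B = ?E \<union> ?H" by (auto simp: U_def)
  then have "card (proper_trades B) = card (?E \<union> ?H)" by (rule arg_cong)
  also have "\<dots> \<le> card ?E + card ?H" by (rule card_Un_le)
  finally have "card (proper_trades B) \<le> card ?E + card ?H" .
  with cH card_proper_trades show ?thesis by simp
qed

lemma card_indep_lists_Suc:
  assumes c: "\<And>ts. ts \<in> indep_lists m \<Longrightarrow> c \<le> card {t \<in> proper_trades B. \<forall>u\<in>set ts. tblocks 0 t \<inter> tblocks 0 u = {}}"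
  shows "c * card (indep_lists m) \<le> card (indep_lists (Suc m))"
proof -
  define E where "E ts = {t \<in> proper_trades B. \<forall>u\<in>set ts. tblocks 0 t \<inter> tblocks 0 u = {}}" for ts
  have finE: "finite (E ts)" for ts using finite_proper_trades by (simp add: E_def)
  have "c * card (indep_lists m) = (\<Sum>ts\<in>indep_lists m. c)" by simp
  also have "\<dots> \<le> (\<Sum>ts\<in>indep_lists m. card (E ts))" by (rule sum_mono) (use c in \<open>simp add: E_def\<close>)
  also have "\<dots> = card (Sigma (indep_lists m) E)"
    using finite_indep_lists finE by (simp add: card_SigmaI)
  also have "\<dots> \<le> card (indep_lists (Suc m))"
  proof (rule card_inj_on_le[of "\<lambda>(ts, t). t # ts"])
    show "inj_on (\<lambda>(ts, t). t # ts) (Sigma (indep_lists m) E)" by (auto intro: inj_onI)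
    show "(\<lambda>(ts, t). t # ts) ` Sigma (indep_lists m) E \<subseteq> indep_lists (Suc m)"
      by (auto simp: indep_lists_def E_def)
  qed (rule finite_indep_lists)
  finally show ?thesis .
qed

text \<open>While at most \<open>K\<close> trades have been chosen, at least \<open>c\<close>
  extensions remain, so there are \<open>c ^ K\<close> lists; the encoding bounds how many of them
  give the same system.\<close>

lemma card_SQS_lower_bound:
  assumes c: "c + card X ^ 3 + 191102976 * K * card X \<le> card (trades B)"
  shows "c ^ K \<le> card {B'. is_SQS X B'} * (card X ^ 3) ^ K"
proof -
  have "m \<le> K \<Longrightarrow> c ^ m \<le> card (indep_lists m)" for m
  proof (induction m)
    case 0
    have "indep_lists 0 = {[]}" by (auto simp: indep_lists_def)
    then show ?case by simp
  next
    case (Suc m)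
    have "c \<le> card {t \<in> proper_trades B. \<forall>u\<in>set ts. tblocks 0 t \<inter> tblocks 0 u = {}}"
      if "ts \<in> indep_lists m" for ts
    proof -
      have "191102976 * m * card X \<le> 191102976 * K * card X" using Suc.prems by simp
      with card_extensions_ge[OF that] c show ?thesis by linarith
    qed
    from card_indep_lists_Suc[OF this]
    have "c * card (indep_lists m) \<le> card (indep_lists (Suc m))" .
    moreover have "c * c ^ m \<le> c * card (indep_lists m)" using Suc by (intro mult_le_mono2) simp
    ultimately have "c * c ^ m \<le> card (indep_lists (Suc m))" by linarith
    then show ?case by simp
  qed
  from this[of K] card_indep_lists_le[of K] show ?thesis by simp
qed

end

text \<open>Trades that avoid a point survive when this point is split off in an inflation.\<close>

definition rich :: "nat \<Rightarrow> nat \<Rightarrow> bool" where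
  "rich n \<tau> \<longleftrightarrow> (\<exists>B o'. is_SQS {0..<n} B \<and> o' < n \<and>
     \<tau> \<le> card {(p, q, r, s). trade B p q r s \<and> (\<forall>i. o' \<notin> {p i, q i, r i, s i})})"

section \<open>Upper and lower bounds for the number of systems\<close>

text \<open>A system is determined by the function that completes an ordered triple to a
  block.\<close>

lemma num_SQS_upper:
  assumes "n > 0"
  shows "num_SQS n \<le> n ^ (n ^ 3)"
proof -
  let ?X = "{0..<n}"
  let ?D = "?X \<times> ?X \<times> ?X"
  \<comment> \<open>Triples with repeated entries lie in no set of the form
    \<open>{x, y, z, w}\<close> of size 4 and get the default value 0, a point because
    \<open>n > 0\<close>.\<close>
  define F where "F B = restrict (\<lambda>(x, y, z). if \<exists>w. {x, y, z, w} \<in> B then (SOME w. {x, y, z, w} \<in> B) else 0) ?D" for B :: "nat set set"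
  have fin: "finite (?D \<rightarrow>\<^sub>E ?X)" by (intro finite_PiE) auto
  have "num_SQS n \<le> card (?D \<rightarrow>\<^sub>E ?X)"
    unfolding num_SQS_def
  proof (rule card_inj_on_le[of F, OF _ _ fin])
    show "inj_on F {B. is_SQS ?X B}"
    proof (rule inj_onI)
      have sub: "B \<subseteq> C" if B: "is_SQS ?X B" and C: "is_SQS ?X C" and eq: "F B = F C" for B C
      proof
        fix b assume b: "b \<in> B"
        with is_SQS_blockD[OF B] have "card b = 4" "b \<subseteq> ?X" by auto
        then obtain x y z w where bx: "b = {x, y, z, w}" and d: "x \<noteq> y" "x \<noteq> z" "y \<noteq> z"
          by (auto simp: card_Suc_eq numeral_eq_Suc)
        have X: "x \<in> ?X" "y \<in> ?X" "z \<in> ?X" using \<open>b \<subseteq> ?X\<close> bx by auto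
        obtain v where v: "{x, y, z, v} \<in> C" using is_SQS_ex[OF C X d] .
        have ex: "\<exists>w. {x, y, z, w} \<in> B" "\<exists>w. {x, y, z, w} \<in> C" using b bx v by auto
        have "F B (x, y, z) = (SOME w. {x, y, z, w} \<in> B)" "F C (x, y, z) = (SOME w. {x, y, z, w} \<in> C)"
          using X ex by (simp_all add: F_def)
        with someI_ex[OF ex(1)] someI_ex[OF ex(2)] eq
        have c: "{x, y, z, F B (x, y, z)} \<in> B" "{x, y, z, F B (x, y, z)} \<in> C" by simp_all
        have "F B (x, y, z) = w" using is_SQS_unique[OF B c(1)] b bx by simp
        with c bx show "b \<in> C" by simp
      qed
      fix B C assume "B \<in> {B. is_SQS ?X B}" "C \<in> {B. is_SQS ?X B}" "F B = F C"
      then show "B = C" using sub[of B C] sub[of C B] by auto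
    qed
    show "F ` {B. is_SQS ?X B} \<subseteq> ?D \<rightarrow>\<^sub>E ?X"
    proof (clarify, rule PiE_I)
      fix B t assume B: "is_SQS ?X B" and t: "t \<in> ?D"
      obtain x y z where txyz: "t = (x, y, z)" by (cases t)
      show "F B t \<in> ?X"
      proof (cases "\<exists>w. {x, y, z, w} \<in> B")
        case True
        from someI_ex[OF this] have "(SOME w. {x, y, z, w} \<in> B) \<in> ?X"
          using is_SQS_distinct(10)[OF B] by blast
        then show ?thesis using True t by (simp add: F_def txyz)
      qed (use assms t in \<open>simp add: F_def txyz\<close>)
    qed (simp add: F_def)
  qed
  also have "\<dots> = n ^ (n ^ 3)"
    by (simp add: card_PiE card_cartesian_product power3_eq_cube mult.assoc)
  finally show ?thesis .
qed

lemma rich_lower_bound: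
  assumes r: "rich n \<tau>" and c: "c + n ^ 3 + 191102976 * K * n \<le> \<tau>"
  shows "c ^ K \<le> num_SQS n * (n ^ 3) ^ K"
proof -
  obtain B o' where B: "is_SQS {0..<n} B"
    "\<tau> \<le> card {(p, q, r, s). trade B p q r s \<and> (\<forall>i. o' \<notin> {p i, q i, r i, s i})}"
    using r by (auto simp: rich_def)
  have "card {(p, q, r, s). trade B p q r s \<and> (\<forall>i. o' \<notin> {p i, q i, r i, s i})} \<le> card (trades B)"
    by (rule card_mono[OF finite_trades[OF B(1)]]) (auto simp: trades_def)
  with c B(2) card_SQS_lower_bound[OF B(1), of c K] show ?thesis by (simp add: num_SQS_def)
qed

text \<open>Of the \<open>n ^ 4 / D\<close> trades, half are reserved for \<open>c\<close>, the
  options at each choice; one quarter pays for improper trades and one quarter for trades spoilt by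
  earlier choices. After division by \<open>n ^ 3\<close> every choice still contributes a factor of
  at least \<open>n / (4 * D)\<close>, which is at least the square root of
  \<open>n\<close>.\<close>

lemma ln_num_SQS_lower:
  assumes r: "rich n \<tau>" and D: "n ^ 4 \<le> D * \<tau>" "D > 0"
    and n: "n \<ge> 4 * D * 1000000000" and n': "n \<ge> 16 * D ^ 2"
  shows "real n ^ 3 * ln (real n) / (16 * real D * 1000000000) \<le> ln (real (num_SQS n))"
proof -
  \<comment> \<open>\<open>10 ^ 9\<close> is a round upper bound for 191102976, and the factor
    \<open>4 * D\<close> keeps the spoilt trades within a quarter of
    \<open>n ^ 4 / D\<close>.\<close>
  define M where "M = 4 * D * 1000000000"
  define K where "K = n ^ 3 div M"
  have M: "M > 0" "n \<ge> M" using D n by (auto simp: M_def)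
  have n0: "n > 0" using M by linarith
  define c where "c = real n ^ 4 / (2 * real D)"
  have KM: "K * M \<le> n ^ 3" by (simp add: K_def)
  have "real (K * M) * real n \<le> real (n ^ 3) * real n"
    using KM by (intro mult_right_mono) (simp_all only: of_nat_le_iff of_nat_0_le_iff)
  then have "4 * real D * (1000000000 * real K * real n) \<le> real n ^ 4"
    by (simp add: M_def algebra_simps power4_eq_xxxx power3_eq_cube)
  then have 1: "1000000000 * real K * real n \<le> real n ^ 4 / (4 * real D)"
    using D by (simp add: field_simps)
  have "4 * real D \<le> real n" using n D by simp
  then have "4 * real D * real n ^ 3 \<le> real n * real n ^ 3" by (intro mult_right_mono) auto
  then have 2: "real n ^ 3 \<le> real n ^ 4 / (4 * real D)"
    using D by (simp add: field_simps power4_eq_xxxx power3_eq_cube)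
  have "real (n ^ 4) \<le> real (D * \<tau>)" using D(1) by (simp only: of_nat_le_iff)
  then have 3: "real n ^ 4 / real D \<le> real \<tau>" using D by (simp add: field_simps)
  have "real (nat \<lfloor>c\<rfloor>) + real n ^ 3 + 191102976 * real K * real n \<le> real \<tau>"
  proof -
    have "c \<ge> 0" by (simp add: c_def)
    then have "real (nat \<lfloor>c\<rfloor>) \<le> c" by simp
    moreover have "191102976 * real K * real n \<le> 1000000000 * real K * real n"
      by (intro mult_right_mono) auto
    moreover have "c + real n ^ 4 / (4 * real D) + real n ^ 4 / (4 * real D) = real n ^ 4 / real D"
      using D by (simp add: c_def field_simps)
    ultimately show ?thesis using 1 2 3 by linarith
  qed
  then have "real (nat \<lfloor>c\<rfloor> + n ^ 3 + 191102976 * K * n) \<le> real \<tau>" by simp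
  then have "nat \<lfloor>c\<rfloor> + n ^ 3 + 191102976 * K * n \<le> \<tau>" by (simp only: of_nat_le_iff)
  from rich_lower_bound[OF r this]
  have "real (nat \<lfloor>c\<rfloor> ^ K) \<le> real (num_SQS n * (n ^ 3) ^ K)" by (simp only: of_nat_le_iff)
  then have N: "real (nat \<lfloor>c\<rfloor>) ^ K \<le> real (num_SQS n) * (real n ^ 3) ^ K" by simp
  \<comment> \<open>The net gain per choice. Rounding \<open>c\<close> down costs at most a factor
    2, since \<open>c \<ge> 2\<close>; this turns \<open>2 * D\<close> into
    \<open>4 * D\<close>.\<close>
  define e where "e = real n / (4 * real D)"
  have e1: "e \<ge> 1000000000" using n D by (simp add: e_def field_simps)
  have "real n ^ 4 / (4 * real D) \<le> real (nat \<lfloor>c\<rfloor>)"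
  proof -
    have "c \<ge> 2"
    proof -
      have "1 \<le> real n ^ 3" using n0 by simp
      then have "e * 1 \<le> e * real n ^ 3" using e1 by (intro mult_left_mono) auto
      then have "2 \<le> 2 * e * real n ^ 3" using e1 by linarith
      also have "\<dots> = c" using D by (simp add: e_def c_def field_simps power4_eq_xxxx power3_eq_cube)
      finally show ?thesis .
    qed
    then have "c / 2 \<le> of_int \<lfloor>c\<rfloor>" by linarith
    moreover have "real (nat \<lfloor>c\<rfloor>) = of_int \<lfloor>c\<rfloor>" using \<open>c \<ge> 2\<close> by simp
    moreover have "c / 2 = real n ^ 4 / (4 * real D)" by (simp add: c_def)
    ultimately show ?thesis by linarith
  qed
  moreover have "real n ^ 4 / (4 * real D) = e * real n ^ 3"
    by (simp add: e_def power4_eq_xxxx power3_eq_cube)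
  ultimately have "e * real n ^ 3 \<le> real (nat \<lfloor>c\<rfloor>)" by simp
  then have "(e * real n ^ 3) ^ K \<le> real (nat \<lfloor>c\<rfloor>) ^ K" using e1 by (intro power_mono) auto
  with N have "e ^ K * (real n ^ 3) ^ K \<le> real (num_SQS n) * (real n ^ 3) ^ K"
    by (simp add: power_mult_distrib)
  then have eK: "e ^ K \<le> real (num_SQS n)" using n0 by (simp add: mult_le_cancel_right)
  moreover have "e ^ K > 0" using e1 by simp
  ultimately have lnN: "ln (e ^ K) \<le> ln (real (num_SQS n))" by (subst ln_le_cancel_iff) auto
  have half: "ln (real n) / 2 \<le> ln e"
  proof -
    have "real n * (16 * real D ^ 2) \<le> real n * real n"
      using n' by (intro mult_left_mono) (simp_all flip: of_nat_power of_nat_mult add: of_nat_le_iff)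
    then have "real n \<le> e ^ 2" using D by (simp add: e_def field_simps power2_eq_square)
    then have "ln (real n) \<le> ln (e ^ 2)" using n0 e1 by (subst ln_le_cancel_iff) auto
    then show ?thesis using e1 by (simp add: ln_realpow)
  qed
  have KR: "real n ^ 3 / (2 * real M) \<le> real K"
  proof -
    have "1 * 1 \<le> n * n" using n0 by (intro mult_le_mono) auto
    have "2 \<le> n" using n D by linarith
    then have "M * 2 \<le> n * (n * n)" using M \<open>1 * 1 \<le> n * n\<close> by (intro mult_le_mono) (auto intro: order_trans[of 2 n])
    then have "real (2 * M) \<le> real (n ^ 3)" unfolding of_nat_le_iff by (simp add: power3_eq_cube mult.assoc)
    then have "1 \<le> real n ^ 3 / (2 * real M)" using M by (simp add: field_simps)
    moreover have "real n ^ 3 / real M - 1 \<le> real K"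
    proof -
      have "n ^ 3 < (K + 1) * M" using M by (simp add: K_def dividend_less_div_times)
      then have "real (n ^ 3) < real ((K + 1) * M)" unfolding of_nat_less_iff .
      then show ?thesis using M by (simp add: field_simps)
    qed
    moreover have "real n ^ 3 / real M = 2 * (real n ^ 3 / (2 * real M))" by simp
    ultimately show ?thesis by linarith
  qed
  have lnn: "ln (real n) \<ge> 0" using n0 by simp
  have "real n ^ 3 * ln (real n) / (16 * real D * 1000000000) = real n ^ 3 / (2 * real M) * (ln (real n) / 2)"
    by (simp add: M_def)
  also have "\<dots> \<le> real K * ln e" using KR half lnn by (intro mult_mono) auto
  also have "\<dots> = ln (e ^ K)" using e1 by (simp add: ln_realpow)
  also note lnN
  finally show ?thesis .
qed

section \<open>Transport of trades between point sets\<close>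

abbreviation avoiding_trades :: "'a set set \<Rightarrow> 'a \<Rightarrow> 'a quad_fun set" where
  "avoiding_trades B o' \<equiv> {(p, q, r, s). trade B p q r s \<and> (\<forall>i. o' \<notin> {p i, q i, r i, s i})}"

lemma finite_avoiding_trades:
  assumes "is_SQS X B" "finite X"
  shows "finite (avoiding_trades B o')"
  by (rule finite_subset[OF _ finite_trades[OF assms]]) (auto simp: trades_def)

lemma trade_image:
  assumes "trade B p q r s"
  shows "trade ((`) f ` B) (f \<circ> p) (f \<circ> q) (f \<circ> r) (f \<circ> s)"
proof -
  have "{f (p i), f (q j), f (r k), f (s (- i - j - k))} \<in> (`) f ` B" for i j k
    using trade_block[OF assms, of i j k "- i - j - k"]
    by (intro image_eqI[of _ _ "{p i, q j, r k, s (- i - j - k)}"]) auto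
  then show ?thesis using assms by (auto simp: trade_def)
qed

lemma inj_on_comp_trades:
  assumes S: "is_SQS X B" and f: "inj_on f X"
  shows "inj_on (\<lambda>(p, q, r, s). (f \<circ> p, f \<circ> q, f \<circ> r, f \<circ> s)) (avoiding_trades B o')"
proof (rule inj_onI)
  fix t u assume t: "t \<in> avoiding_trades B o'" and u: "u \<in> avoiding_trades B o'"
    and e: "(\<lambda>(p, q, r, s). (f \<circ> p, f \<circ> q, f \<circ> r, f \<circ> s)) t = (\<lambda>(p, q, r, s). (f \<circ> p, f \<circ> q, f \<circ> r, f \<circ> s)) u"
  obtain p q r s p' q' r' s' where tu: "t = (p, q, r, s)" "u = (p', q', r', s')"
    by (cases t, cases u)
  have tr: "trade B p q r s" "trade B p' q' r' s'" using t u by (auto simp: tu)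
  have e': "f (p i) = f (p' i)" "f (q i) = f (q' i)" "f (r i) = f (r' i)" "f (s i) = f (s' i)" for i
    using e by (auto simp: tu fun_eq_iff)
  note pts = trade_points[OF S tr(1)] trade_points[OF S tr(2)]
  have "p i = p' i" "q i = q' i" "r i = r' i" "s i = s' i" for i
    by (rule inj_onD[OF f e'(1)] inj_onD[OF f e'(2)] inj_onD[OF f e'(3)] inj_onD[OF f e'(4)]; rule pts)+
  then show "t = u" by (auto simp: tu)
qed

text \<open>The constructions below use structured point sets. This moves a system to
  \<open>{0..<n}\<close> and accepts the trades as an injective image of any convenient set
  \<open>A\<close>.\<close>

lemma richI:
  assumes fin: "finite X" "card X = n" and S: "is_SQS X B" and o: "o' \<in> X"
    and A: "inj_on F A" "F ` A \<subseteq> avoiding_trades B o'" "\<tau> \<le> card A"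
  shows "rich n \<tau>"
proof -
  obtain f where f: "bij_betw f X {0..<n}" using ex_bij_betw_finite_nat[OF fin(1)] fin(2) by auto
  then have inj: "inj_on f X" by (simp add: bij_betw_def)
  let ?B = "(`) f ` B"
  have S': "is_SQS {0..<n} ?B" by (rule is_SQS_image[OF f S])
  let ?G = "\<lambda>(p, q, r, s). (f \<circ> p, f \<circ> q, f \<circ> r, f \<circ> s)"
  have "\<tau> \<le> card (avoiding_trades B o')"
    using card_inj_on_le[OF A(1,2) finite_avoiding_trades[OF S fin(1)]] A(3) by simp
  also have "\<dots> \<le> card (avoiding_trades ?B (f o'))"
  proof (rule card_inj_on_le[OF inj_on_comp_trades[OF S inj]])
    show "?G ` avoiding_trades B o' \<subseteq> avoiding_trades ?B (f o')"
    proof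
      fix t assume "t \<in> ?G ` avoiding_trades B o'"
      then obtain p q r s where t: "t = (f \<circ> p, f \<circ> q, f \<circ> r, f \<circ> s)" "trade B p q r s"
        "\<forall>i. o' \<notin> {p i, q i, r i, s i}" by auto
      have "f o' \<notin> {f (p i), f (q i), f (r i), f (s i)}" for i
        using t(3) inj_onD[OF inj _ o] trade_points[OF S t(2)] by blast
      then show "t \<in> avoiding_trades ?B (f o')" using trade_image[OF t(2)] t(1) by auto
    qed
    show "finite (avoiding_trades ?B (f o'))" by (rule finite_avoiding_trades[OF S']) simp
  qed
  finally have "\<tau> \<le> card (avoiding_trades ?B (f o'))" .
  moreover have "f o' < n" using f o by (auto simp: bij_betw_def)
  ultimately show ?thesis using S' unfolding rich_def by blast
qed

lemma rich_mono: "rich n \<tau> \<Longrightarrow> \<tau>' \<le> \<tau> \<Longrightarrow> rich n \<tau>'"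
  unfolding rich_def using le_trans by blast

subsection \<open>Inflation\<close>

text \<open>The points \<open>0, ..., 3 u - 1\<close> form three groups of size \<open>u\<close>, the points \<open>3 u, ..., 3 u + s - 1\<close> a stem.
  A candelabra system covers the triples that lie in no union of a group and the stem; a filling is a
  quadruple system on such a union.\<close>

definition cls :: "int \<Rightarrow> int \<Rightarrow> int option" where
  "cls u c = (if c < 3 * u then Some (c div u) else None)"

text \<open>Coordinates of the point with number \<open>c\<close>: the name of its group,
  \<open>None\<close> for the stem, and the position inside. The naming \<open>e\<close> of the
  groups by points of the original system places one model on different blocks.\<close>

definition blow :: "int \<Rightarrow> (int \<Rightarrow> 'a) \<Rightarrow> int \<Rightarrow> 'a option \<times> int" where
  "blow u e c = (map_option e (cls u c), if c < 3 * u then c mod u else c - 3 * u)"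

definition in_hole :: "int \<Rightarrow> int set \<Rightarrow> bool" where
  "in_hole u T \<longleftrightarrow> (\<exists>i. \<forall>c\<in>T. cls u c = Some i \<or> cls u c = None)"

definition candelabra :: "int \<Rightarrow> int \<Rightarrow> int set set \<Rightarrow> bool" where
  "candelabra u s K \<longleftrightarrow> (\<forall>b\<in>K. b \<subseteq> {0..<3 * u + s} \<and> card b = 4) \<and>
     (\<forall>x y z. x \<in> {0..<3 * u + s} \<longrightarrow> y \<in> {0..<3 * u + s} \<longrightarrow> z \<in> {0..<3 * u + s} \<longrightarrow>
        x \<noteq> y \<longrightarrow> x \<noteq> z \<longrightarrow> y \<noteq> z \<longrightarrow> \<not> in_hole u {x, y, z} \<longrightarrow> (\<exists>b\<in>K. {x, y, z} \<subseteq> b))"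

definition filling :: "int \<Rightarrow> int \<Rightarrow> int set set \<Rightarrow> bool" where
  "filling u s F \<longleftrightarrow> (\<forall>b\<in>F. b \<subseteq> {0..<u} \<union> {3 * u..<3 * u + s} \<and> card b = 4) \<and>
     (\<forall>x y z. x \<in> {0..<u} \<union> {3 * u..<3 * u + s} \<longrightarrow> y \<in> {0..<u} \<union> {3 * u..<3 * u + s} \<longrightarrow>
        z \<in> {0..<u} \<union> {3 * u..<3 * u + s} \<longrightarrow>
        x \<noteq> y \<longrightarrow> x \<noteq> z \<longrightarrow> y \<noteq> z \<longrightarrow> (\<exists>b\<in>F. {x, y, z} \<subseteq> b))"

definition blow_points :: "int \<Rightarrow> int \<Rightarrow> 'a set \<Rightarrow> ('a option \<times> int) set" where
  "blow_points u s X = (Some ` X \<times> {0..<u}) \<union> ({None} \<times> {0..<s})"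

text \<open>A Latin cube: any three of the levels determine the fourth. The condition on the sum is
  symmetric, so the points of \<open>b\<close> need not be ordered.\<close>

definition transversals :: "int \<Rightarrow> 'a set \<Rightarrow> ('a option \<times> int) set set" where
  "transversals u b = (\<lambda>f. (\<lambda>p. (Some p, f p)) ` b) ` {f \<in> b \<rightarrow>\<^sub>E {0..<u}. u dvd (\<Sum>p\<in>b. f p)}"

lemma card_blow_points:
  assumes "finite X"
  shows "finite (blow_points u s X)" "card (blow_points u s X) = card X * nat u + nat s"
proof -
  show "finite (blow_points u s X)" using assms by (simp add: blow_points_def)
  have "card (blow_points u s X) = card (Some ` X \<times> {0..<u}) + card ({None :: 'a option} \<times> {0..<s})"
    unfolding blow_points_def using assms by (intro card_Un_disjoint) auto
  then show "card (blow_points u s X) = card X * nat u + nat s"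
    by (simp add: card_cartesian_product card_image)
qed

lemma card_transversals:
  assumes b: "card b = 4" and u: "u > 0"
  shows "card (transversals u b) \<le> nat u ^ 3"
proof -
  have fb: "finite b" using b by (auto intro: card_ge_0_finite)
  have "b \<noteq> {}" using b by auto
  then obtain d where "d \<in> b" by blast
  then obtain c where bd: "b = insert d c" "d \<notin> c" by (rule mk_disjoint_insert[THEN exE]) blast
  then have fc: "finite c" and cc: "card c = 3" using b fb by auto
  let ?P = "{f \<in> b \<rightarrow>\<^sub>E {0..<u}. u dvd (\<Sum>p\<in>b. f p)}"
  have "card ?P \<le> card (c \<rightarrow>\<^sub>E {0..<u})"
  proof (rule card_inj_on_le[of "\<lambda>f. restrict f c"])
    show "inj_on (\<lambda>f. restrict f c) ?P"
    proof (rule inj_onI)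
      fix f g assume f: "f \<in> ?P" and g: "g \<in> ?P" and e: "restrict f c = restrict g c"
      have c: "f p = g p" if "p \<in> c" for p using fun_cong[OF e, of p] that by simp
      then have s: "(\<Sum>p\<in>c. f p) = (\<Sum>p\<in>c. g p)" by (intro sum.cong) auto
      have "u dvd f d + (\<Sum>p\<in>c. f p)" "u dvd g d + (\<Sum>p\<in>c. f p)"
        using f g s fc bd by auto
      then have "u dvd f d - g d" by (metis add_diff_cancel_right dvd_diff)
      moreover have "0 \<le> f d" "f d < u" "0 \<le> g d" "g d < u" using f g bd by (auto simp: PiE_def Pi_def)
      ultimately have "f d = g d" using zdvd_imp_le[of u "f d - g d"] zdvd_imp_le[of u "g d - f d"]
        by (smt (verit) dvd_minus_iff minus_diff_eq)
      then have "f p = g p" if "p \<in> b" for p using c that bd by auto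
      then show "f = g" using f g by (intro PiE_ext[of f b _ g]) auto
    qed
    show "(\<lambda>f. restrict f c) ` ?P \<subseteq> c \<rightarrow>\<^sub>E {0..<u}"
    proof
      fix h assume "h \<in> (\<lambda>f. restrict f c) ` ?P"
      then obtain f where "h = restrict f c" "f \<in> b \<rightarrow>\<^sub>E {0..<u}" by blast
      then show "h \<in> c \<rightarrow>\<^sub>E {0..<u}" using bd by (auto simp: PiE_def Pi_def extensional_def)
    qed
    show "finite (c \<rightarrow>\<^sub>E {0..<u})" using fc by (intro finite_PiE) auto
  qed
  also have "\<dots> = nat u ^ 3" using fc cc by (simp add: card_PiE)
  finally have P: "card ?P \<le> nat u ^ 3" .
  have "finite ?P" by (rule finite_subset[of _ "b \<rightarrow>\<^sub>E {0..<u}"]) (use fb in \<open>auto intro: finite_PiE\<close>)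
  then have "card (transversals u b) \<le> card ?P" unfolding transversals_def by (rule card_image_le)
  with P show ?thesis by simp
qed

lemma transversalsI:
  assumes "card {p, q, r, s} = 4" "{x, y, z, w} \<subseteq> {0..<u}" "u dvd x + y + z + w"
  shows "{(Some p, x), (Some q, y), (Some r, z), (Some s, w)} \<in> transversals u {p, q, r, s}"
proof -
  note d = card_four_distinct[OF assms(1)]
  define f where "f = restrict (\<lambda>t. if t = p then x else if t = q then y else if t = r then z else w) {p, q, r, s}"
  have f: "f p = x" "f q = y" "f r = z" "f s = w" using d by (auto simp: f_def)
  have "f \<in> {p, q, r, s} \<rightarrow>\<^sub>E {0..<u}" using assms(2) by (auto simp: f_def)
  moreover have "(\<Sum>t\<in>{p, q, r, s}. f t) = x + y + z + w" using d f by simp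
  ultimately show ?thesis
    unfolding transversals_def
    by (intro image_eqI[of _ _ f]) (use assms(3) f in auto)
qed

lemma transversals_blockD:
  assumes "t \<in> transversals u b" "card b = 4" "b \<subseteq> X"
  shows "t \<subseteq> blow_points u s X" "card t = 4"
proof -
  obtain f where f: "t = (\<lambda>p. (Some p, f p)) ` b" "f \<in> b \<rightarrow>\<^sub>E {0..<u}"
    using assms(1) by (auto simp: transversals_def)
  have "f p \<in> {0..<u}" if "p \<in> b" for p using f(2) that by (rule PiE_mem)
  then show "t \<subseteq> blow_points u s X" using f assms(3) by (auto simp: blow_points_def)
  have "inj_on (\<lambda>p. (Some p, f p)) b" by (auto intro: inj_onI)
  then show "card t = 4" using f assms(2) by (simp add: card_image)
qed

lemma blow_inj:
  assumes "inj_on e I" "u > 0" "\<And>c i. c \<in> C \<Longrightarrow> cls u c = Some i \<Longrightarrow> i \<in> I"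
  shows "inj_on (blow u e) C"
proof (rule inj_onI)
  fix c d assume c: "c \<in> C" and d: "d \<in> C" and eq: "blow u e c = blow u e d"
  show "c = d"
  proof (cases "c < 3 * u")
    case True
    then have "d < 3 * u" using eq by (auto simp: blow_def cls_def split: if_splits)
    with True eq have "e (c div u) = e (d div u)" "c mod u = d mod u" by (auto simp: blow_def cls_def)
    moreover have "c div u \<in> I" "d div u \<in> I"
      using assms(3)[OF c] assms(3)[OF d] True \<open>d < 3 * u\<close> by (auto simp: cls_def)
    ultimately show ?thesis using assms(1) by (metis inj_onD mult_div_mod_eq)
  next
    case False
    then show ?thesis using eq by (auto simp: blow_def cls_def split: if_splits)
  qed
qed

lemma cls_range:
  assumes "u > 0" "c \<in> {0..<3 * u + s}" "cls u c = Some i"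
  shows "i \<in> {0..<3}"
proof -
  have i: "i = c div u" "c < 3 * u" using assms(3) by (auto simp: cls_def split: if_splits)
  have "i \<ge> 0" using assms i by (simp add: pos_imp_zdiv_nonneg_iff)
  moreover have "i < 3"
  proof (rule ccontr)
    assume "\<not> i < 3"
    then have "3 * u \<le> i * u" using assms(1) by (intro mult_right_mono) auto
    also have "i * u \<le> c"
      unfolding i(1) using div_mult_mod_eq[of c u] pos_mod_sign[OF assms(1), of c] by linarith
    finally show False using i by simp
  qed
  ultimately show ?thesis by simp
qed

text \<open>Remove \<open>o'\<close> and replace every other point by a group of size \<open>u\<close>. A block avoiding \<open>o'\<close> becomes
  its transversals of sum zero modulo \<open>u\<close>, a block through \<open>o'\<close> a candelabra system on its three groups and
  the stem, and every group together with the stem is filled.\<close>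

lemma inflate:
  fixes X :: "'a set"
  assumes fin: "finite X" and S: "is_SQS X B" and v: "card X = v" "v \<ge> 2" "v \<noteq> 3" and o: "o' \<in> X"
    and u: "u > 0" and s: "s \<ge> 0"
    and K: "candelabra u s K" "card K \<le> k0"
    and F: "filling u s (F1 \<union> F0)" "\<And>b. b \<in> F0 \<Longrightarrow> b \<subseteq> {3 * u..<3 * u + s}"
      "card F1 \<le> f1" "card F0 \<le> f0"
    and n: "n = (v - 1) * nat u + nat s"
    and num: "nat u ^ 3 * ((v - 1) * (v - 2) * (v - 4)) + 4 * k0 * ((v - 1) * (v - 2)) + 24 * f1 * (v - 1) + 24 * f0
      \<le> n * (n - 1) * (n - 2)"
  shows "\<exists>B'. is_SQS (blow_points u s (X - {o'})) B' \<and> (\<forall>b\<in>B. o' \<notin> b \<longrightarrow> transversals u b \<subseteq> B')"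
proof -
  \<comment> \<open>Numbers the points of a block through \<open>o'\<close> other than
    \<open>o'\<close>, in order to name the three groups of the candelabra system placed
    there.\<close>
  define e where "e b = (SOME e. bij_betw e {0..<3::int} (b - {o'}))" for b
  define Bo where "Bo = {b \<in> B. o' \<in> b}"
  define Bn where "Bn = {b \<in> B. o' \<notin> b}"
  have finB: "finite B" using finite_blocks[OF fin is_SQS_blockD[OF S]] .
  have e: "bij_betw (e b) {0..<3} (b - {o'})" if "b \<in> Bo" for b
  proof -
    have "card b = 4" "o' \<in> b" using that is_SQS_blockD[OF S] by (auto simp: Bo_def)
    then have "finite (b - {o'})" "card (b - {o'}) = 3" by (auto intro: card_ge_0_finite simp: card_Diff_singleton)
    then have "\<exists>e. bij_betw e {0..<3::int} (b - {o'})" by (intro finite_same_card_bij) auto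
    then show ?thesis unfolding e_def by (rule someI_ex)
  qed
  define B1 where "B1 = (\<Union>b\<in>Bn. transversals u b)"
  define B2 where "B2 = (\<Union>b\<in>Bo. (`) (blow u (e b)) ` K)"
  define B3 where "B3 = (\<Union>a\<in>X - {o'}. (`) (blow u (\<lambda>_. a)) ` F1)"
  \<comment> \<open>Filling blocks inside the stem are the same for every group and are inserted
    once, which is why fillings are split into \<open>F1\<close> and \<open>F0\<close>.\<close>
  define B4 where "B4 = (`) (blow u (\<lambda>_. o')) ` F0"
  define B' where "B' = B1 \<union> B2 \<union> B3 \<union> B4"
  let ?Y = "blow_points u s (X - {o'})"
  have finK: "finite K" by (rule finite_subset[of _ "Pow {0..<3 * u + s}"]) (use K in \<open>auto simp: candelabra_def\<close>)
  have finF: "finite (F1 \<union> F0)"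
    by (rule finite_subset[of _ "Pow ({0..<u} \<union> {3 * u..<3 * u + s})"]) (use F in \<open>auto simp: filling_def\<close>)
  have n': "card ?Y = n" using card_blow_points[of "X - {o'}" u s] fin o v n by simp
  have "is_SQS ?Y B'"
  proof (rule is_SQS_I)
    show "finite ?Y" using card_blow_points fin by blast
  next
    fix b assume "b \<in> B'"
    then consider (1) "b \<in> B1" | (2) "b \<in> B2" | (3) "b \<in> B3" | (4) "b \<in> B4" by (auto simp: B'_def)
    then show "b \<subseteq> ?Y \<and> card b = 4"
    proof cases
      case 1
      then obtain c where c: "c \<in> B" "o' \<notin> c" "b \<in> transversals u c" by (auto simp: B1_def Bn_def)
      with is_SQS_blockD[OF S] have "c \<subseteq> X - {o'}" "card c = 4" by auto
      then show ?thesis using transversals_blockD[OF c(3)] by blast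
    next
      case 2
      then obtain c k where c: "c \<in> Bo" "k \<in> K" "b = blow u (e c) ` k" by (auto simp: B2_def)
      have k: "k \<subseteq> {0..<3 * u + s}" "card k = 4" using K c by (auto simp: candelabra_def)
      have inj: "inj_on (blow u (e c)) k"
        by (rule blow_inj[of _ "{0..<3}"]) (use e[OF c(1)] u k cls_range[OF u] in \<open>auto simp: bij_betw_def\<close>)
      have cX: "c - {o'} \<subseteq> X - {o'}" using c is_SQS_blockD[OF S] by (auto simp: Bo_def)
      have "blow u (e c) x \<in> ?Y" if x: "x \<in> k" for x
      proof (cases "x < 3 * u")
        case True
        have "x div u \<in> {0..<3}" using cls_range[OF u, of x s "x div u"] x k True by (auto simp: cls_def)
        then have "e c (x div u) \<in> X - {o'}" using bij_betwE[OF e[OF c(1)]] cX by blast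
        then show ?thesis using True u by (auto simp: blow_def cls_def blow_points_def)
      next
        case False
        then show ?thesis using x k by (auto simp: blow_def cls_def blow_points_def)
      qed
      then show ?thesis using c inj k by (auto simp: card_image)
    next
      case 3
      then obtain a k where c: "a \<in> X - {o'}" "k \<in> F1" "b = blow u (\<lambda>_. a) ` k" by (auto simp: B3_def)
      have k: "k \<subseteq> {0..<u} \<union> {3 * u..<3 * u + s}" "card k = 4" using F c by (auto simp: filling_def)
      have inj: "inj_on (blow u (\<lambda>_. a)) k"
        by (rule blow_inj[of _ "{0}"]) (use u k in \<open>auto simp: cls_def split: if_splits\<close>)
      have "blow u (\<lambda>_. a) x \<in> ?Y" if x: "x \<in> k" for x
        using x k c u by (auto simp: blow_def cls_def blow_points_def)
      then show ?thesis using c inj k by (auto simp: card_image)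
    next
      case 4
      then obtain k where c: "k \<in> F0" "b = blow u (\<lambda>_. o') ` k" by (auto simp: B4_def)
      have k: "k \<subseteq> {3 * u..<3 * u + s}" "card k = 4" using F c by (auto simp: filling_def)
      have inj: "inj_on (blow u (\<lambda>_. o')) k"
        by (rule blow_inj[of _ "{0}"]) (use u k in \<open>auto simp: cls_def split: if_splits\<close>)
      have "blow u (\<lambda>_. o') x \<in> ?Y" if x: "x \<in> k" for x
        using x k c u by (auto simp: blow_def cls_def blow_points_def)
      then show ?thesis using c inj k by (auto simp: card_image)
    qed
  next
    fix P Q R assume PQR: "P \<in> ?Y" "Q \<in> ?Y" "R \<in> ?Y" "P \<noteq> Q" "P \<noteq> R" "Q \<noteq> R"
    \<comment> \<open>Here and in \<open>candcase\<close> the function \<open>g\<close> reads a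
      point back as its number in the model, where the covering property is known.\<close>
    have fillcase: "\<exists>b\<in>B'. P \<in> b \<and> Q \<in> b \<and> R \<in> b"
      if a: "a \<in> X - {o'}" and D: "\<And>T. T \<in> {P, Q, R} \<Longrightarrow> fst T = None \<or> fst T = Some a" for a
    proof -
      define g where "g T = (case fst T of None \<Rightarrow> 3 * u + snd T | Some _ \<Rightarrow> snd T)" for T :: "'a option \<times> int"
      have g: "blow u (\<lambda>_. a) (g T) = T" "g T \<in> {0..<u} \<union> {3 * u..<3 * u + s}" if "T \<in> {P, Q, R}" for T
      proof -
        have "T \<in> ?Y" "fst T = None \<or> fst T = Some a" using that D PQR by auto
        then have "blow u (\<lambda>_. a) (g T) = T \<and> g T \<in> {0..<u} \<union> {3 * u..<3 * u + s}"
          using u by (auto simp: g_def blow_def cls_def blow_points_def)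
        then show "blow u (\<lambda>_. a) (g T) = T" "g T \<in> {0..<u} \<union> {3 * u..<3 * u + s}" by auto
      qed
      have "g P \<noteq> g Q" "g P \<noteq> g R" "g Q \<noteq> g R" using g(1)[of P] g(1)[of Q] g(1)[of R] PQR by auto
      then obtain k where k: "k \<in> F1 \<union> F0" "{g P, g Q, g R} \<subseteq> k"
        using F(1) g(2)[of P] g(2)[of Q] g(2)[of R] unfolding filling_def by blast
      have mem: "P \<in> blow u (\<lambda>_. a) ` k" "Q \<in> blow u (\<lambda>_. a) ` k" "R \<in> blow u (\<lambda>_. a) ` k"
        using g(1)[of P] g(1)[of Q] g(1)[of R] k(2) by (metis image_eqI insert_subset insertCI)+
      have "blow u (\<lambda>_. a) ` k \<in> B'"
      proof (cases "k \<in> F1")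
        case True
        then show ?thesis using a by (auto simp: B'_def B3_def)
      next
        case False
        then have "k \<in> F0" using k by blast
        then have "blow u (\<lambda>_. a) ` k = blow u (\<lambda>_. o') ` k"
          using F(2)[OF \<open>k \<in> F0\<close>] by (intro image_cong) (auto simp: blow_def cls_def)
        then show ?thesis using \<open>k \<in> F0\<close> by (auto simp: B'_def B4_def)
      qed
      then show ?thesis by (rule bexI[rotated]) (intro conjI mem)
    qed
    have candcase: "\<exists>b\<in>B'. P \<in> b \<and> Q \<in> b \<and> R \<in> b"
      if b: "b \<in> B" "o' \<in> b" and D: "\<And>T a. T \<in> {P, Q, R} \<Longrightarrow> fst T = Some a \<Longrightarrow> a \<in> b"
        and nofill: "\<And>a. a \<in> X - {o'} \<Longrightarrow> \<exists>T\<in>{P, Q, R}. fst T \<noteq> None \<and> fst T \<noteq> Some a" for b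
    proof -
      have bo: "b \<in> Bo" using b by (simp add: Bo_def)
      define g where "g T = (case fst T of None \<Rightarrow> 3 * u + snd T | Some a \<Rightarrow> inv_into {0..<3} (e b) a * u + snd T)"
        for T :: "'a option \<times> int"
      have g: "blow u (e b) (g T) = T" "g T \<in> {0..<3 * u + s}" if T: "T \<in> {P, Q, R}" for T
      proof -
        have TY: "T \<in> ?Y" using T PQR by auto
        have "blow u (e b) (g T) = T \<and> g T \<in> {0..<3 * u + s}"
        proof (cases "fst T")
          case None
          then show ?thesis using TY u by (auto simp: g_def blow_def cls_def blow_points_def)
        next
          case (Some a)
          obtain x where Tx: "T = (Some a, x)" using Some by (cases T) simp
          with TY have x: "T = (Some a, x)" "0 \<le> x" "x < u" "a \<in> X - {o'}"
            by (simp_all add: blow_points_def image_iff)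
          define i where "i = inv_into {0..<3} (e b) a"
          have "a \<in> e b ` {0..<3}" using D[OF T Some] x e[OF bo] by (auto simp: bij_betw_def)
          then have i: "e b i = a" "i \<in> {0..<3}" unfolding i_def by (rule f_inv_into_f, rule inv_into_into)
          have gT: "g T = i * u + x" by (simp add: g_def x i_def)
          have "i * u \<le> 2 * u" using i(2) u by (intro mult_right_mono) auto
          moreover have "0 \<le> i * u" using i(2) u by auto
          ultimately have r: "0 \<le> g T" "g T < 3 * u" using x(2,3) gT by linarith+
          have "g T div u = i" "g T mod u = x" using gT x by simp_all
          then show ?thesis using r i x s by (simp add: blow_def cls_def)
        qed
        then show "blow u (e b) (g T) = T" "g T \<in> {0..<3 * u + s}" by auto
      qed
      have d: "g P \<noteq> g Q" "g P \<noteq> g R" "g Q \<noteq> g R" using g(1)[of P] g(1)[of Q] g(1)[of R] PQR by auto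
      have nh: "\<not> in_hole u {g P, g Q, g R}"
      proof
        assume "in_hole u {g P, g Q, g R}"
        then obtain i where i: "\<forall>c\<in>{g P, g Q, g R}. cls u c = Some i \<or> cls u c = None"
          unfolding in_hole_def by (rule exE)
        have f: "fst T = None \<or> fst T = Some (e b i) \<and> i \<in> {0..<3}" if T: "T \<in> {P, Q, R}" for T
        proof -
          have "g T \<in> {g P, g Q, g R}" using T by auto
          then have *: "cls u (g T) = Some i \<or> cls u (g T) = None" by (rule bspec[OF i])
          have "fst T = map_option (e b) (cls u (g T))" using g(1)[OF T] by (metis blow_def fst_conv)
          then show ?thesis using * cls_range[OF u g(2)[OF T]] by auto
        qed
        have "i \<notin> {0..<3}"
        proof
          assume "i \<in> {0..<3}"
          then have "e b i \<in> b - {o'}" using bij_betwE[OF e[OF bo]] by simp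
          then have "e b i \<in> X - {o'}" using is_SQS_blockD[OF S b(1)] by auto
          from nofill[OF this] obtain T where T: "T \<in> {P, Q, R}" "fst T \<noteq> None" "fst T \<noteq> Some (e b i)" by (elim bexE conjE)
          show False using f[OF T(1)] T(2,3) by simp
        qed
        have "card (X - {o'}) \<ge> 1" using v fin o by simp
        then obtain a where "a \<in> X - {o'}" by (metis card.empty ex_in_conv not_one_le_zero)
        from nofill[OF this] obtain T where T: "T \<in> {P, Q, R}" "fst T \<noteq> None" by (elim bexE conjE)
        show False using f[OF T(1)] T(2) \<open>i \<notin> {0..<3}\<close> by simp
      qed
      obtain k where k: "k \<in> K" "{g P, g Q, g R} \<subseteq> k"
        using K(1) g(2)[of P] g(2)[of Q] g(2)[of R] d nh unfolding candelabra_def by blast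
      have mem: "P \<in> blow u (e b) ` k" "Q \<in> blow u (e b) ` k" "R \<in> blow u (e b) ` k"
        using g(1)[of P] g(1)[of Q] g(1)[of R] k(2) by (metis image_eqI insert_subset insertCI)+
      have "blow u (e b) ` k \<in> B'" using k bo by (auto simp: B'_def B2_def)
      then show ?thesis by (rule bexI[rotated]) (intro conjI mem)
    qed
    show "\<exists>b\<in>B'. P \<in> b \<and> Q \<in> b \<and> R \<in> b"
    proof (cases "\<exists>a\<in>X - {o'}. \<forall>T\<in>{P, Q, R}. fst T = None \<or> fst T = Some a")
      case True
      then obtain a where a: "a \<in> X - {o'}" "\<forall>T\<in>{P, Q, R}. fst T = None \<or> fst T = Some a" by (rule bexE)
      show ?thesis by (rule fillcase[OF a(1) bspec[OF a(2)]])
    next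
      case nofill: False
      then have nofill': "\<exists>T\<in>{P, Q, R}. fst T \<noteq> None \<and> fst T \<noteq> Some a" if "a \<in> X - {o'}" for a
        using that by simp
      show ?thesis
      proof (cases "\<exists>b\<in>B. o' \<in> b \<and> (\<forall>T\<in>{P, Q, R}. \<forall>a. fst T = Some a \<longrightarrow> a \<in> b)")
        case True
        then obtain b where b: "b \<in> B" "o' \<in> b" "\<forall>T\<in>{P, Q, R}. \<forall>a. fst T = Some a \<longrightarrow> a \<in> b"
          by (elim bexE conjE)
        show ?thesis
        proof (rule candcase[OF b(1,2) _ nofill'])
          fix T a assume "T \<in> {P, Q, R}" "fst T = Some a"
          then show "a \<in> b" using bspec[OF b(3), of T] by simp
        qed
      next
        case nocand: False
        have inX: "a \<in> X - {o'}" if "T \<in> {P, Q, R}" "fst T = Some a" for T a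
          using that PQR by (auto simp: blow_points_def)
        \<comment> \<open>Any two group names lie in a block together with \<open>o'\<close>. So a
          triple that belongs to no filling and no candelabra system misses the stem and has three
          distinct group names, and the block through these names avoids \<open>o'\<close>.\<close>
        have three: False
          if ac: "a \<in> X - {o'}" "c \<in> X - {o'}" and h: "fst P \<in> {None, Some a, Some c}"
            "fst Q \<in> {None, Some a, Some c}" "fst R \<in> {None, Some a, Some c}" for a c
        proof (cases "a = c")
          case True
          then show False using h nofill'[OF ac(1)] by auto
        next
          case False
          obtain w where w: "{o', a, c, w} \<in> B" by (rule is_SQS_ex[OF S, of o' a c]) (use ac False o in auto)
          have "\<forall>T\<in>{P, Q, R}. \<forall>t. fst T = Some t \<longrightarrow> t \<in> {o', a, c, w}" using h by auto
          then have "\<exists>b\<in>B. o' \<in> b \<and> (\<forall>T\<in>{P, Q, R}. \<forall>a. fst T = Some a \<longrightarrow> a \<in> b)"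
            using w by (intro bexI[of _ "{o', a, c, w}"] conjI) simp_all
          then show False using nocand by (rule notE[rotated])
        qed
        have "card (X - {o'}) \<ge> 1" using v fin o by simp
        then obtain a0 where a0: "a0 \<in> X - {o'}" by (metis card.empty ex_in_conv not_one_le_zero)
        have opt: "\<exists>a\<in>X - {o'}. fst T \<in> {None, Some a}" if "T \<in> {P, Q, R}" for T
          using inX[OF that] a0 by (cases "fst T") auto
        obtain a1 a2 a3 where a123: "a1 \<in> X - {o'}" "fst P \<in> {None, Some a1}" "a2 \<in> X - {o'}" "fst Q \<in> {None, Some a2}"
          "a3 \<in> X - {o'}" "fst R \<in> {None, Some a3}"
          using opt[of P] opt[of Q] opt[of R] by auto
        have "fst P \<noteq> None" using three[of a2 a3] a123 by auto
        moreover have "fst Q \<noteq> None" using three[of a1 a3] a123 by auto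
        moreover have "fst R \<noteq> None" using three[of a1 a2] a123 by auto
        ultimately obtain a b c where abc: "fst P = Some a" "fst Q = Some b" "fst R = Some c" by auto
        have X3: "a \<in> X - {o'}" "b \<in> X - {o'}" "c \<in> X - {o'}" using inX[of P a] inX[of Q b] inX[of R c] abc by simp_all
        have ne: "a \<noteq> b" "a \<noteq> c" "b \<noteq> c"
          using three[of a c] three[of a b] three[of b a] X3 abc by auto
        obtain d where d: "{a, b, c, d} \<in> B" by (rule is_SQS_ex[OF S, of a b c]) (use X3 ne in auto)
        have od: "o' \<notin> {a, b, c, d}"
        proof
          assume "o' \<in> {a, b, c, d}"
          moreover have "\<forall>T\<in>{P, Q, R}. \<forall>t. fst T = Some t \<longrightarrow> t \<in> {a, b, c, d}" using abc by auto
          ultimately have "\<exists>b\<in>B. o' \<in> b \<and> (\<forall>T\<in>{P, Q, R}. \<forall>a. fst T = Some a \<longrightarrow> a \<in> b)"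
            using d by (intro bexI[of _ "{a, b, c, d}"] conjI)
          then show False using nocand by (rule notE[rotated])
        qed
        define x y z where "x = snd P" and "y = snd Q" and "z = snd R"
        have P: "P = (Some a, x)" "Q = (Some b, y)" "R = (Some c, z)"
          using abc by (auto simp: x_def y_def z_def prod_eq_iff)
        have xyz: "x \<in> {0..<u}" "y \<in> {0..<u}" "z \<in> {0..<u}" using PQR P by (auto simp: blow_points_def)
        define w where "w = (- (x + y + z)) mod u"
        have w: "w \<in> {0..<u}" using u by (simp add: w_def)
        have "u dvd x + y + z + w" unfolding w_def by (simp add: dvd_eq_mod_eq_0 mod_simps)
        then have "{(Some a, x), (Some b, y), (Some c, z), (Some d, w)} \<in> transversals u {a, b, c, d}"
          by (intro transversalsI) (use xyz w is_SQS_blockD[OF S d] in auto)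
        then have "{(Some a, x), (Some b, y), (Some c, z), (Some d, w)} \<in> B'"
          using d od by (auto simp: B'_def B1_def Bn_def)
        then show ?thesis by (rule bexI[rotated]) (simp add: P)
      qed
    qed
  next
    have cBo: "6 * card Bo = (v - 1) * (v - 2)" using is_SQS_card_point[OF fin S o] v by (simp add: Bo_def)
    have "card B = card Bo + card Bn"
      using finB by (subst card_Un_disjoint[symmetric]) (auto simp: Bo_def Bn_def intro: arg_cong[of _ _ card])
    then have cB: "24 * card Bo + 24 * card Bn = v * (v - 1) * (v - 2)"
      using is_SQS_card[OF fin S] v by simp
    \<comment> \<open>\<open>v * (v - 1) * (v - 2) - 4 * (v - 1) * (v - 2)\<close> factors in this
      way; \<open>v = 2\<close> is separate because subtraction is truncated.\<close>
    have cBn: "24 * card Bn \<le> (v - 1) * (v - 2) * (v - 4)"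
    proof (cases "v = 2")
      case True
      then show ?thesis using cB by simp
    next
      case False
      then have "4 \<le> v" using v by simp
      then obtain w where w: "v = w + 4" by (metis le_add_diff_inverse2)
      then show ?thesis using cB cBo by (simp add: algebra_simps)
    qed
    have c1: "card B1 \<le> card Bn * nat u ^ 3"
    proof -
      have "card B1 \<le> (\<Sum>b\<in>Bn. card (transversals u b))"
        unfolding B1_def by (rule card_UN_le) (use finB in \<open>simp add: Bn_def\<close>)
      also have "\<dots> \<le> (\<Sum>b\<in>Bn. nat u ^ 3)"
        by (rule sum_mono, rule card_transversals) (use u is_SQS_blockD[OF S] in \<open>auto simp: Bn_def\<close>)
      finally show ?thesis by simp
    qed
    have c2: "card B2 \<le> card Bo * k0"
    proof -
      have "card B2 \<le> (\<Sum>b\<in>Bo. card ((`) (blow u (e b)) ` K))"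
        unfolding B2_def by (rule card_UN_le) (use finB in \<open>simp add: Bo_def\<close>)
      also have "\<dots> \<le> (\<Sum>b\<in>Bo. k0)"
        by (rule sum_mono) (use K(2) card_image_le[OF finK] le_trans in blast)
      finally show ?thesis by simp
    qed
    have c3: "card B3 \<le> (v - 1) * f1"
    proof -
      have "card B3 \<le> (\<Sum>a\<in>X - {o'}. card ((`) (blow u (\<lambda>_. a)) ` F1))"
        unfolding B3_def by (rule card_UN_le) (use fin in simp)
      also have "\<dots> \<le> (\<Sum>a\<in>X - {o'}. f1)"
        by (rule sum_mono) (use F(3) card_image_le[of F1] finF le_trans in blast)
      finally show ?thesis using fin o v by simp
    qed
    have c4: "card B4 \<le> f0"
      unfolding B4_def using card_image_le[of F0] finF F(4) le_trans by blast
    have "card B' \<le> card B1 + card B2 + card B3 + card B4"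
      unfolding B'_def using card_Un_le[of "B1 \<union> B2 \<union> B3" B4] card_Un_le[of "B1 \<union> B2" B3] card_Un_le[of B1 B2]
      by linarith
    then have "24 * card B' \<le> 24 * (card Bn * nat u ^ 3) + 24 * (card Bo * k0) + 24 * ((v - 1) * f1) + 24 * f0"
      using c1 c2 c3 c4 by linarith
    also have "\<dots> = nat u ^ 3 * (24 * card Bn) + 4 * k0 * (6 * card Bo) + 24 * f1 * (v - 1) + 24 * f0"
      by (simp add: algebra_simps)
    also have "\<dots> \<le> nat u ^ 3 * ((v - 1) * (v - 2) * (v - 4)) + 4 * k0 * ((v - 1) * (v - 2)) + 24 * f1 * (v - 1) + 24 * f0"
      using cBn cBo by (simp only: add_le_mono mult_le_mono le_refl)
    also note num
    finally show "24 * card B' \<le> card ?Y * (card ?Y - 1) * (card ?Y - 2)" by (simp only: n')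
  qed
  moreover have "\<forall>b\<in>B. o' \<notin> b \<longrightarrow> transversals u b \<subseteq> B'" by (auto simp: B'_def B1_def Bn_def)
  ultimately show ?thesis by blast
qed

section \<open>Edge colourings and their trades\<close>

text \<open>The colours below \<open>m\<close> are perfect matchings of the complete graph on
  \<open>{..<g}\<close>. A larger value marks an uncoloured edge; tripling uses this to leave out
  short odd distances.\<close>

definition colouring :: "nat \<Rightarrow> nat \<Rightarrow> (nat \<Rightarrow> nat \<Rightarrow> nat) \<Rightarrow> bool" where
  "colouring g m \<phi> \<longleftrightarrow> (\<forall>x<g. \<forall>y<g. \<phi> x y = \<phi> y x) \<and>
     (\<forall>x<g. \<forall>c<m. \<exists>!y. y < g \<and> y \<noteq> x \<and> \<phi> x y = c)"

definition one_factorization :: "nat \<Rightarrow> (nat \<Rightarrow> nat \<Rightarrow> nat) \<Rightarrow> bool" where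
  "one_factorization g \<phi> \<longleftrightarrow> colouring g (g - 1) \<phi> \<and> (\<forall>x<g. \<forall>y<g. x \<noteq> y \<longrightarrow> \<phi> x y < g - 1)"

text \<open>The shadow of a trade in a colouring: with \<open>p\<close>, \<open>q\<close> in one
  copy of the vertices and \<open>r\<close>, \<open>s\<close> in another it becomes a trade of the
  blocks \<open>quads22\<close>.\<close>

definition colour_trades :: "nat \<Rightarrow> nat \<Rightarrow> (nat \<Rightarrow> nat \<Rightarrow> nat) \<Rightarrow> nat quad_fun set" where
  "colour_trades g m \<phi> = {(p, q, r, s).
     (\<forall>i. p i < g \<and> q i < g \<and> r i < g \<and> s i < g) \<and>
     (\<forall>i j k l. i + j + k + l = 0 \<longrightarrow> p i \<noteq> q j \<and> r k \<noteq> s l \<and> \<phi> (p i) (q j) < m \<and> \<phi> (p i) (q j) = \<phi> (r k) (s l)) \<and>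
     (\<forall>i. p (i + 12) = p i \<and> q (i + 12) = q i \<and> r (i + 12) = r i \<and> s (i + 12) = s i)}"

definition many :: "nat \<Rightarrow> 'a set \<Rightarrow> bool" where
  "many \<tau> C \<longleftrightarrow> (\<exists>F. inj_on F {..<\<tau>} \<and> F ` {..<\<tau>} \<subseteq> C)"

lemma manyI:
  assumes "finite A" "inj_on F A" "F ` A \<subseteq> C"
  shows "many (card A) C"
proof -
  obtain h where h: "bij_betw h {0..<card A} A" using ex_bij_betw_nat_finite[OF assms(1)] by blast
  then have "inj_on (F \<circ> h) {..<card A}"
    using assms(2) by (auto simp: bij_betw_def lessThan_atLeast0 intro: comp_inj_on)
  moreover have "(F \<circ> h) ` {..<card A} \<subseteq> C"
    using h assms(3) by (auto simp: bij_betw_def lessThan_atLeast0)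
  ultimately show ?thesis unfolding many_def by blast
qed

lemma inj_lessThan_ex1:
  assumes "inj_on f {..<k}" "\<And>y. y < k \<Longrightarrow> f y < k" "c < (k::nat)"
  shows "\<exists>!y. y < k \<and> f y = c"
proof -
  have "f ` {..<k} = {..<k}" using assms(1,2) by (intro endo_inj_surj) auto
  then have "c \<in> f ` {..<k}" using assms(3) by simp
  then obtain y where "y < k" "f y = c" by auto
  then show ?thesis using assms(1) by (auto simp: inj_on_def)
qed

subsection \<open>Latin squares with a large subsquare over an elementary abelian 2-group\<close>

text \<open>Addition and, below, subtraction modulo \<open>q\<close> on representatives below
  \<open>q\<close>. Cases instead of \<open>mod\<close> leave goals of linear arithmetic.\<close>

definition am :: "nat \<Rightarrow> nat \<Rightarrow> nat \<Rightarrow> nat" where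
  "am q x y = (if x + y < q then x + y else x + y - q)"

definition dm :: "nat \<Rightarrow> nat \<Rightarrow> nat \<Rightarrow> nat" where
  "dm q x y = (if y \<le> x then x - y else x + q - y)"

lemma am_dm:
  assumes "x < q" "y < q"
  shows "am q x y < q" "dm q x y < q" "dm q (am q y x) y = x" "dm q x (dm q x y) = y"
    "am q y (dm q x y) = x"
  using assms by (auto simp: am_def dm_def)

lemma am_cancel:
  assumes "x < q" "y < q" "y' < q"
  shows "am q x y = am q x y' \<Longrightarrow> y = y'" "am q y x = am q y' x \<Longrightarrow> y = y'"
  using assms by (auto simp: am_def split: if_splits)

text \<open>Doubling is injective modulo an odd number; \<open>e\<close> counts how often
  \<open>q\<close> was subtracted. This is why the diagonals \<open>x - y = c\<close> of the cyclic
  square are transversals.\<close>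

lemma am_double_cancel:
  assumes "odd q" "a < q" "y < q" "y' < q" "am q (am q y a) y = am q (am q y' a) y'"
  shows "y = y'"
proof -
  have ex: "\<exists>e\<in>{0, 1, 2}. am q (am q z a) z + e * q = 2 * z + a" if "z < q" for z
    using that assms(2) by (auto simp: am_def)
  obtain e where e: "e \<in> {0, 1, 2}" "am q (am q y a) y + e * q = 2 * y + a" using ex[OF assms(3)] ..
  obtain e' where e': "e' \<in> {0, 1, 2}" "am q (am q y' a) y' + e' * q = 2 * y' + a" using ex[OF assms(4)] ..
  obtain t where t: "q = 2 * t + 1" using assms(1) by (rule oddE)
  have "2 * y + e' * q = 2 * y' + e * q" using e(2) e'(2) assms(5) by linarith
  with e(1) e'(1) assms(3,4) show ?thesis unfolding t by (elim insertE emptyE) (simp_all, presburger+)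
qed

text \<open>The cyclic square \<open>x + y\<close> of odd order \<open>q\<close>, prolonged along the transversals \<open>x - y = c\<close>,
  \<open>c < m\<close>; the corner is filled with the bitwise exclusive or.\<close>

definition prolonged :: "nat \<Rightarrow> nat \<Rightarrow> nat \<Rightarrow> nat \<Rightarrow> nat" where
  "prolonged q m x y =
     (if x < q then
        if y < q then (if dm q x y < m then q + dm q x y else am q x y)
        else am q x (dm q x (y - q))
      else if y < q then am q (am q y (x - q)) y
      else q + Bit_Operations.xor (x - q) (y - q))"

lemma xor_less: "a < 2 ^ j \<Longrightarrow> b < 2 ^ j \<Longrightarrow> Bit_Operations.xor a b < (2::nat) ^ j"
  by (metis take_bit_nat_eq_self_iff take_bit_xor)

lemma xor_cancel: "Bit_Operations.xor a b = Bit_Operations.xor a c \<longleftrightarrow> b = (c::nat)"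
  by (metis xor.assoc xor.left_neutral xor_self_eq)

lemma prolonged_less:
  assumes "m = 2 ^ j" "m \<le> q" "x < q + m" "y < q + m"
  shows "prolonged q m x y < q + m"
proof -
  have 1: "Bit_Operations.xor (x - q) (y - q) < m" if "\<not> x < q" "\<not> y < q"
    using xor_less[of "x - q" j "y - q"] assms that by auto
  have "y - q < q" "x - q < q" if "\<not> y < q" "\<not> x < q" using assms that by auto
  show ?thesis
    using assms 1 am_dm[of x q y] am_dm(1)[of x q "dm q x (y - q)"] am_dm(2)[of x q "y - q"]
      am_dm(1)[of "am q y (x - q)" q y] am_dm(1)[of y q "x - q"]
    unfolding prolonged_def by (auto split: if_splits)
qed

text \<open>In a row \<open>x < q\<close> the symbol displaced by \<open>q + c\<close> reappears
  exactly in column \<open>q + c\<close>, so the old and the new columns share no symbol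
  (\<open>mixed\<close>). In a row of the border the part left of the corner has symbols below
  \<open>q\<close>, distinct by odd order, and the corner has symbols from \<open>q\<close> on,
  distinct by cancellation of exclusive or.\<close>

lemma prolonged_row_inj:
  assumes m: "m = 2 ^ j" "m \<le> q" "odd q" and x: "x < q + m" and y: "y < q + m" "y' < q + m"
    and eq: "prolonged q m x y = prolonged q m x y'"
  shows "y = y'"
proof -
  have mixed: False if "x < q" "y < q" "y' < q + m" "\<not> y' < q" "prolonged q m x y = prolonged q m x y'" for y y'
  proof -
    let ?c = "y' - q"
    have c: "?c < m" "?c < q" using that m by auto
    have d: "dm q x ?c < q" using am_dm(2) that c by blast
    have R: "prolonged q m x y' = am q x (dm q x ?c)" "am q x (dm q x ?c) < q"
      using that am_dm(1)[OF that(1) d] by (auto simp: prolonged_def)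
    then have "\<not> dm q x y < m" using that by (auto simp: prolonged_def split: if_splits)
    then have "am q x y = am q x (dm q x ?c)" using that R by (simp add: prolonged_def)
    then have "y = dm q x ?c" using am_cancel(1) that d by blast
    then have "dm q x y = ?c" using am_dm(4) that c by simp
    then show False using \<open>\<not> dm q x y < m\<close> c by simp
  qed
  have low: "prolonged q m x y < q" if "\<not> x < q" "y < q" for y
    using that x m am_dm(1) by (auto simp: prolonged_def)
  have high: "prolonged q m x y \<ge> q" if "\<not> x < q" "\<not> y < q" for y
    using that by (auto simp: prolonged_def)
  show ?thesis
  proof (cases "x < q")
    case xq: True
    consider "y < q" "y' < q" | "y < q" "\<not> y' < q" | "\<not> y < q" "y' < q" | "\<not> y < q" "\<not> y' < q" by blast
    then show ?thesis
    proof cases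
      case 1
      have lt: "am q x y < q" "am q x y' < q" using am_dm(1) xq 1 by blast+
      show ?thesis
      proof (cases "dm q x y < m")
        case True
        then have "dm q x y = dm q x y'" using eq xq 1 lt by (auto simp: prolonged_def split: if_splits)
        then show ?thesis using am_dm(4) xq 1 by metis
      next
        case False
        then have "am q x y = am q x y'" using eq xq 1 lt by (auto simp: prolonged_def split: if_splits)
        then show ?thesis using am_cancel(1) xq 1 by blast
      qed
    next
      case 2
      then show ?thesis using mixed[of y y'] xq y eq by simp
    next
      case 3
      then show ?thesis using mixed[of y' y] xq y eq by simp
    next
      case 4
      have c: "y - q < q" "y' - q < q" using y m by auto
      have "dm q x (y - q) = dm q x (y' - q)"
        using am_cancel(1)[OF xq am_dm(2)[OF xq c(1)] am_dm(2)[OF xq c(2)]] eq xq 4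
        by (simp add: prolonged_def)
      then have "y - q = y' - q" using am_dm(4)[OF xq] c by metis
      then show ?thesis using 4 by simp
    qed
  next
    case xq: False
    have a: "x - q < q" using x m by simp
    consider "y < q" "y' < q" | "y < q" "\<not> y' < q" | "\<not> y < q" "y' < q" | "\<not> y < q" "\<not> y' < q" by blast
    then show ?thesis
    proof cases
      case 1
      then show ?thesis using am_double_cancel[OF m(3) a] eq xq by (simp add: prolonged_def)
    next
      case 2
      then show ?thesis using low[OF xq, of y] high[OF xq, of y'] eq by simp
    next
      case 3
      then show ?thesis using low[OF xq, of y'] high[OF xq, of y] eq by simp
    next
      case 4
      then have "y - q = y' - q" using eq xq by (simp add: prolonged_def xor_cancel)
      then show ?thesis using 4 by simp
    qed
  qed
qed

text \<open>The same argument with rows and columns exchanged; the displaced symbol now reappears in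
  row \<open>q + c\<close>.\<close>

lemma prolonged_column_inj:
  assumes m: "m = 2 ^ j" "m \<le> q" "odd q" and y: "y < q + m" and x: "x < q + m" "x' < q + m"
    and eq: "prolonged q m x y = prolonged q m x' y"
  shows "x = x'"
proof -
  have dinj: "x = x'" if "x < q" "x' < q" "y < q" "dm q x y = dm q x' y" for x x'
  proof -
    have "am q y (dm q x y) = x" "am q y (dm q x' y) = x'" using am_dm(5) that by blast+
    then show ?thesis using that(4) by metis
  qed
  have mixed: False if "y < q" "x < q" "x' < q + m" "\<not> x' < q" "prolonged q m x y = prolonged q m x' y" for x x'
  proof -
    let ?c = "x' - q"
    have c: "?c < m" "?c < q" using that m by auto
    have d: "am q y ?c < q" using am_dm(1) that c by blast
    have R: "prolonged q m x' y = am q (am q y ?c) y" "am q (am q y ?c) y < q"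
      using that am_dm(1)[OF d that(1)] by (auto simp: prolonged_def)
    then have "\<not> dm q x y < m" using that by (auto simp: prolonged_def split: if_splits)
    then have "am q x y = am q (am q y ?c) y" using that R by (simp add: prolonged_def)
    then have "x = am q y ?c" using am_cancel(2) that d by blast
    then have "dm q x y = ?c" using am_dm(3) that c by simp
    then show False using \<open>\<not> dm q x y < m\<close> c by simp
  qed
  show ?thesis
  proof (cases "y < q")
    case yq: True
    consider "x < q" "x' < q" | "x < q" "\<not> x' < q" | "\<not> x < q" "x' < q" | "\<not> x < q" "\<not> x' < q" by blast
    then show ?thesis
    proof cases
      case 1
      have lt: "am q x y < q" "am q x' y < q" using am_dm(1) yq 1 by blast+
      show ?thesis
      proof (cases "dm q x y < m")
        case True
        then have "dm q x y = dm q x' y" using eq yq 1 lt by (auto simp: prolonged_def split: if_splits)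
        then show ?thesis using dinj yq 1 by blast
      next
        case False
        then have "am q x y = am q x' y" using eq yq 1 lt by (auto simp: prolonged_def split: if_splits)
        then show ?thesis using am_cancel(2) yq 1 by blast
      qed
    next
      case 2
      then show ?thesis using mixed[of x x'] yq x eq by simp
    next
      case 3
      then show ?thesis using mixed[of x' x] yq x eq by simp
    next
      case 4
      have c: "x - q < q" "x' - q < q" using x m by auto
      have "am q y (x - q) = am q y (x' - q)"
        using am_cancel(2)[OF yq am_dm(1)[OF yq c(1)] am_dm(1)[OF yq c(2)]] eq yq 4
        by (simp add: prolonged_def)
      then have "x - q = x' - q" using am_cancel(1)[OF yq] c by blast
      then show ?thesis using 4 by simp
    qed
  next
    case yq: False
    have a: "y - q < q" using y m by simp
    have low: "prolonged q m x y < q" if "x < q" for x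
      using that yq am_dm(1)[OF that am_dm(2)[OF that a]] by (simp add: prolonged_def)
    have high: "prolonged q m x y \<ge> q" if "\<not> x < q" for x
      using that yq by (auto simp: prolonged_def)
    consider "x < q" "x' < q" | "x < q" "\<not> x' < q" | "\<not> x < q" "x' < q" | "\<not> x < q" "\<not> x' < q" by blast
    then show ?thesis
    proof cases
      case 1
      let ?d = "dm q x (y - q)" and ?d' = "dm q x' (y - q)"
      have d: "?d < q" "?d' < q" using am_dm(2) 1 a by blast+
      \<comment> \<open>With \<open>c = y - q\<close> and \<open>d = x - c\<close> the entry
        \<open>x + (x - c)\<close> is \<open>d + c + d\<close>, a doubling in
        \<open>d\<close>.\<close>
      have xe: "am q ?d (y - q) = x" "am q ?d' (y - q) = x'"
        using 1 a by (auto simp: am_def dm_def)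
      have "am q (am q ?d (y - q)) ?d = am q (am q ?d' (y - q)) ?d'"
        unfolding xe using eq yq 1 by (simp add: prolonged_def)
      then have "?d = ?d'" by (rule am_double_cancel[OF m(3) a d])
      then show ?thesis using xe by metis
    next
      case 2
      then show ?thesis using low[of x] high[of x'] eq by simp
    next
      case 3
      then show ?thesis using low[of x'] high[of x] eq by simp
    next
      case 4
      then have "Bit_Operations.xor (y - q) (x - q) = Bit_Operations.xor (y - q) (x' - q)"
        using eq yq by (simp add: prolonged_def xor.commute)
      then have "x - q = x' - q" by (simp add: xor_cancel)
      then show ?thesis using 4 by simp
    qed
  qed
qed

section \<open>One-factorizations with many trades\<close>

text \<open>The standard one-factorization of a complete graph of even order: the edge
  \<open>x y\<close> gets colour \<open>x + y\<close> modulo the odd number \<open>N\<close>, and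
  the edge from \<open>x\<close> to the extra vertex \<open>N\<close> gets the colour
  \<open>2 x\<close> that is missing at \<open>x\<close>.\<close>

definition cyc :: "nat \<Rightarrow> nat \<Rightarrow> nat \<Rightarrow> nat" where
  "cyc N x y = (if x = N then am N y y else if y = N then am N x x else am N x y)"

lemma cyc_one_factorization:
  assumes "odd N"
  shows "one_factorization (N + 1) (cyc N)"
proof -
  have N: "N > 0" using assms by (cases N) auto
  have sym: "am N x y = am N y x" for x y by (simp add: am_def add.commute)
  have ex1: "\<exists>!y. y < N + 1 \<and> y \<noteq> x \<and> cyc N x y = c" if x: "x < N + 1" and c: "c < N" for x c
  proof (cases "x = N")
    case True
    have "\<exists>!y. y < N \<and> am N y y = c"
    proof (rule inj_lessThan_ex1[OF _ _ c])
      show "inj_on (\<lambda>y. am N y y) {..<N}"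
      proof (rule inj_onI)
        fix y y' assume "y \<in> {..<N}" "y' \<in> {..<N}" "am N y y = am N y' y'"
        moreover from this have "am N y 0 = y" "am N y' 0 = y'" by (auto simp: am_def)
        ultimately show "y = y'" using am_double_cancel[OF assms N, of y y'] by simp
      qed
    qed (use am_dm(1) in blast)
    then show ?thesis using True by (auto simp: cyc_def less_Suc_eq)
  next
    case False
    then have xN: "x < N" using x by simp
    let ?y = "dm N c x"
    have y: "?y < N" "am N x ?y = c" using am_dm(2,5) xN c by auto
    have u: "y = ?y" if "y < N" "am N x y = c" for y using am_cancel(1) xN that y by metis
    show ?thesis
    proof (cases "?y = x")
      case True
      show ?thesis
      proof (rule ex1I[of _ N])
        show "N < N + 1 \<and> N \<noteq> x \<and> cyc N x N = c" using xN y True by (auto simp: cyc_def)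
        fix y assume "y < N + 1 \<and> y \<noteq> x \<and> cyc N x y = c"
        then show "y = N" using u[of y] True xN by (auto simp: cyc_def split: if_splits)
      qed
    next
      case nx: False
      show ?thesis
      proof (rule ex1I[of _ ?y])
        show "?y < N + 1 \<and> ?y \<noteq> x \<and> cyc N x ?y = c" using xN y nx by (auto simp: cyc_def)
        fix y assume "y < N + 1 \<and> y \<noteq> x \<and> cyc N x y = c"
        then show "y = ?y" using u[of y] u[of x] nx xN by (auto simp: cyc_def split: if_splits)
      qed
    qed
  qed
  have lt: "cyc N x y < N" if "x < N + 1" "y < N + 1" "x \<noteq> y" for x y
    using that by (auto simp: cyc_def less_Suc_eq intro!: am_dm(1))
  show ?thesis unfolding one_factorization_def colouring_def
    using ex1 lt sym by (auto simp: cyc_def)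
qed

text \<open>Two halves of size \<open>k\<close>. Edges between the halves are coloured by a Latin
  square with zero diagonal, whose nonzero symbols give the colours below \<open>k - 1\<close>. For
  odd \<open>k\<close> the halves have no perfect matchings, so they use a factorization
  \<open>d\<close> of order \<open>k + 1\<close> in which the diagonal edge from \<open>v\<close> to
  \<open>v + k\<close> replaces the edge to the extra vertex.\<close>

definition join :: "nat \<Rightarrow> (nat \<Rightarrow> nat \<Rightarrow> nat) \<Rightarrow> (nat \<Rightarrow> nat \<Rightarrow> nat) \<Rightarrow> nat \<Rightarrow> nat \<Rightarrow> nat" where
  "join k L d v w =
     (if v < k then
        if w < k then k - 1 + d v w else if v = w - k then k - 1 + d v k else L v (w - k) - 1
      else if w < k then if w = v - k then k - 1 + d w k else L w (v - k) - 1
      else k - 1 + d (v - k) (w - k))"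

text \<open>It suffices to find every colour at every vertex: \<open>2 * k - 1\<close> neighbours
  then map onto \<open>2 * k - 1\<close> colours, so the map is injective.\<close>

lemma join_one_factorization:
  assumes k: "k > 0"
    and L: "\<And>x y. x < k \<Longrightarrow> y < k \<Longrightarrow> L x y < k" "\<And>x. x < k \<Longrightarrow> L x x = 0"
      "\<And>x y y'. \<lbrakk>x < k; y < k; y' < k; L x y = L x y'\<rbrakk> \<Longrightarrow> y = y'"
      "\<And>x x' y. \<lbrakk>x < k; x' < k; y < k; L x y = L x' y\<rbrakk> \<Longrightarrow> x = x'"
    and d: "one_factorization (k + 1) d"
  shows "one_factorization (2 * k) (join k L d)"
proof -
  have dsym: "d x y = d y x" if "x \<le> k" "y \<le> k" for x y
    using d that by (simp add: one_factorization_def colouring_def)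
  have dlt: "d x y < k" if "x \<le> k" "y \<le> k" "x \<noteq> y" for x y
    using d that by (simp add: one_factorization_def)
  have dex: "\<exists>!y. y < k + 1 \<and> y \<noteq> x \<and> d x y = c" if "x \<le> k" "c < k" for x c
    using d that by (simp add: one_factorization_def colouring_def)
  have Lpos: "L x y > 0" if "x < k" "y < k" "x \<noteq> y" for x y
    using L(2)[OF that(1)] L(3)[OF that(1,1,2)] that by (metis gr0I)
  have rowex: "\<exists>y<k. y \<noteq> x \<and> L x y = Suc c" if "x < k" "c < k - 1" for x c
  proof -
    have "\<exists>!y. y < k \<and> L x y = Suc c"
    proof (rule inj_lessThan_ex1)
      show "inj_on (L x) {..<k}" by (rule inj_onI) (rule L(3)[OF that(1)], simp_all)
      show "L x y < k" if "y < k" for y by (rule L(1)[OF \<open>x < k\<close> that])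
      show "Suc c < k" using that by simp
    qed
    then obtain y where "y < k" "L x y = Suc c" by (elim ex1E conjE)
    then show ?thesis using L(2)[OF that(1)] by (intro exI[of _ y]) auto
  qed
  have colex: "\<exists>x<k. x \<noteq> y \<and> L x y = Suc c" if "y < k" "c < k - 1" for y c
  proof -
    have "\<exists>!x. x < k \<and> L x y = Suc c"
    proof (rule inj_lessThan_ex1)
      show "inj_on (\<lambda>x. L x y) {..<k}" by (rule inj_onI) (rule L(4)[OF _ _ that(1)], simp_all)
      show "L x y < k" if "x < k" for x by (rule L(1)[OF that \<open>y < k\<close>])
      show "Suc c < k" using that by simp
    qed
    then obtain x where "x < k" "L x y = Suc c" by (elim ex1E conjE)
    then show ?thesis using L(2)[OF that(1)] by (intro exI[of _ x]) auto
  qed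
  have sym: "join k L d v w = join k L d w v" if "v < 2 * k" "w < 2 * k" for v w
    using that dsym by (auto simp: join_def)
  have lt: "join k L d v w < 2 * k - 1" if "v < 2 * k" "w < 2 * k" "v \<noteq> w" for v w
  proof -
    have "v - k < k" "w - k < k" using that k by auto
    moreover have "v - k \<noteq> w - k" if "\<not> v < k" "\<not> w < k" using that \<open>v \<noteq> w\<close> by simp
    ultimately show ?thesis using that dlt[of v w] dlt[of v k] dlt[of w k] dlt[of "v - k" "w - k"]
        L(1)[of v "w - k"] L(1)[of w "v - k"] k
      by (auto simp: join_def) linarith
  qed
  have ex: "\<exists>w. w < 2 * k \<and> w \<noteq> v \<and> join k L d v w = c" if v: "v < 2 * k" and c: "c < 2 * k - 1" for v c
  proof (cases "c < k - 1")
    case True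
    show ?thesis
    proof (cases "v < k")
      case vk: True
      obtain y where "y < k" "y \<noteq> v" "L v y = Suc c" using rowex[OF vk True] by blast
      then show ?thesis using vk by (intro exI[of _ "k + y"]) (auto simp: join_def)
    next
      case vk: False
      then have "v - k < k" using v by simp
      then obtain x where "x < k" "x \<noteq> v - k" "L x (v - k) = Suc c" using colex True by blast
      then show ?thesis using vk by (intro exI[of _ x]) (auto simp: join_def)
    qed
  next
    case False
    define e where "e = c - (k - 1)"
    have e: "c = k - 1 + e" "e < k" using False c by (auto simp: e_def)
    define x where "x = (if v < k then v else v - k)"
    have x: "x < k" using v by (auto simp: x_def)
    obtain y where y: "y < k + 1" "y \<noteq> x" "d x y = e" using dex[of x e] x e by (auto elim: ex1E)
    show ?thesis
    proof (cases "y = k")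
      case True
      then show ?thesis using x y e v
        by (intro exI[of _ "if v < k then v + k else v - k"]) (auto simp: join_def x_def)
    next
      case False
      then have "y < k" using y by simp
      then show ?thesis using x y e v
        by (intro exI[of _ "if v < k then y else y + k"]) (auto simp: join_def x_def)
    qed
  qed
  have "\<exists>!w. w < 2 * k \<and> w \<noteq> v \<and> join k L d v w = c" if v: "v < 2 * k" and c: "c < 2 * k - 1" for v c
  proof -
    let ?A = "{..<2 * k} - {v}"
    have fin: "finite ?A" by simp
    have "join k L d v ` ?A = {..<2 * k - 1}"
    proof (intro equalityI subsetI)
      fix c assume "c \<in> join k L d v ` ?A"
      then show "c \<in> {..<2 * k - 1}" using lt[OF v] by auto
    next
      fix c assume "c \<in> {..<2 * k - 1}"
      then show "c \<in> join k L d v ` ?A" using ex[OF v, of c] by (auto simp: image_iff)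
    qed
    then have "card (join k L d v ` ?A) = card ?A" using v by simp
    then have "inj_on (join k L d v) ?A" by (rule eq_card_imp_inj_on[OF fin])
    then show ?thesis using ex[OF v c] by (auto simp: inj_on_def)
  qed
  then show ?thesis unfolding one_factorization_def colouring_def using sym lt by auto
qed

lemma many_one_colour_trades:
  assumes "g \<ge> 2" "one_factorization g \<phi>"
  shows "many 1 (colour_trades g (g - 1) \<phi>)"
proof -
  have "((\<lambda>_. 0), (\<lambda>_. 1), (\<lambda>_. 0), (\<lambda>_. 1)) \<in> colour_trades g (g - 1) \<phi>"
    using assms by (auto simp: colour_trades_def one_factorization_def)
  then show ?thesis unfolding many_def
    by (intro exI[of _ "\<lambda>_. ((\<lambda>_. 0), (\<lambda>_. 1), (\<lambda>_. 0), (\<lambda>_. 1))"]) (auto simp: inj_on_def)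
qed

definition flip :: "int \<Rightarrow> nat \<Rightarrow> nat" where
  "flip i h = (if even i then 0 else h)"

text \<open>Between the halves, a subsquare over the group of order \<open>m = 2 ^ j\<close> makes
  equality of colours the equation \<open>a xor b = c xor d\<close>. With \<open>m\<close> the
  largest power of 2 up to \<open>k div 2\<close> one has \<open>2 * k < 8 * m\<close>, and
  \<open>8 ^ 4 = 4096\<close>.\<close>

lemma rich_one_factorization_odd:
  assumes k: "odd k"
  shows "\<exists>\<phi> \<tau>. one_factorization (2 * k) \<phi> \<and> many \<tau> (colour_trades (2 * k) (2 * k - 1) \<phi>) \<and> (2 * k) ^ 4 \<le> 4096 * \<tau>"
proof (cases "k \<le> 3")
  case True
  have k0: "k > 0" using k by (cases k) auto
  have "odd (2 * k - 1)" using k0 by simp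
  from cyc_one_factorization[OF this] have c: "one_factorization (2 * k) (cyc (2 * k - 1))" using k0 by simp
  \<comment> \<open>For \<open>k \<le> 3\<close> a single constant trade is enough, as
    \<open>6 ^ 4 < 4096\<close>.\<close>
  have "(2 * k) ^ 4 \<le> (6::nat) ^ 4" using True by (intro power_mono) auto
  then have "(2 * k) ^ 4 \<le> 4096 * (1::nat)" by simp
  moreover have "many 1 (colour_trades (2 * k) (2 * k - 1) (cyc (2 * k - 1)))"
    by (rule many_one_colour_trades[OF _ c]) (use k0 in simp)
  ultimately show ?thesis using c by blast
next
  case False
  have "\<exists>j. 2 ^ j \<le> k div 2 \<and> k div 2 < 2 ^ Suc j"
  proof -
    have "1 \<le> k div 2" using False by simp
    from ex_power_ivl1[OF order_refl this] show ?thesis unfolding Suc_eq_plus1 .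
  qed
  then obtain j where j: "2 ^ j \<le> k div 2" "k div 2 < 2 ^ Suc j" by blast
  define m :: nat where "m = 2 ^ j"
  define q where "q = k - m"
  have "j \<noteq> 0"
  proof
    assume "j = 0"
    then have "k div 2 < 2" using j by simp
    then show False using False k by presburger
  qed
  \<comment> \<open>Since \<open>k\<close> is odd, this makes the order \<open>q = k - m\<close> of
    the cyclic square odd, as the prolongation requires.\<close>
  then have me: "even m" by (simp add: m_def)
  have m: "2 * m \<le> k" "k < 4 * m" "m > 0" using j k by (auto simp: m_def)
  have q: "odd q" "m \<le> q" "q + m = k" "q > 0" using m me k by (auto simp: q_def)
  let ?L = "prolonged q m"
  have Llt: "?L x y < k" if "x < k" "y < k" for x y
    using prolonged_less[of m j q x y] that q m_def by simp
  have Lrow: "y = y'" if "x < k" "y < k" "y' < k" "?L x y = ?L x y'" for x y y'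
    using prolonged_row_inj[of m j q x y y'] that q m_def by simp
  have Lcol: "x = x'" if "x < k" "x' < k" "y < k" "?L x y = ?L x' y" for x x' y
    using prolonged_column_inj[of m j q y x x'] that q m_def by simp
  \<comment> \<open>A permutation of the rows that moves the symbol 0 to the diagonal, as
    \<open>join\<close> demands; \<open>\<rho>'\<close> is its inverse.\<close>
  define \<rho> where "\<rho> y = (THE x. x < k \<and> ?L x y = 0)" for y
  have \<rho>: "\<rho> y < k" "?L (\<rho> y) y = 0" if "y < k" for y
  proof -
    have "\<exists>!x. x < k \<and> ?L x y = 0"
    proof (rule inj_lessThan_ex1)
      show "inj_on (\<lambda>x. ?L x y) {..<k}" by (rule inj_onI) (rule Lcol[OF _ _ that], simp_all)
      show "?L x y < k" if "x < k" for x by (rule Llt[OF that \<open>y < k\<close>])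
      show "0 < k" using that by simp
    qed
    from theI'[OF this] show "\<rho> y < k" "?L (\<rho> y) y = 0" unfolding \<rho>_def by auto
  qed
  have \<rho>inj: "y = y'" if "y < k" "y' < k" "\<rho> y = \<rho> y'" for y y'
    using Lrow[of "\<rho> y" y y'] \<rho>[OF that(1)] \<rho>[OF that(2)] that by simp
  define \<rho>' where "\<rho>' z = (THE y. y < k \<and> \<rho> y = z)" for z
  have \<rho>': "\<rho>' z < k" "\<rho> (\<rho>' z) = z" if "z < k" for z
  proof -
    have "\<exists>!y. y < k \<and> \<rho> y = z"
    proof (rule inj_lessThan_ex1)
      show "inj_on \<rho> {..<k}" by (rule inj_onI) (rule \<rho>inj, simp_all)
    qed (use \<rho>(1) that in simp_all)
    from theI'[OF this] show "\<rho>' z < k" "\<rho> (\<rho>' z) = z" unfolding \<rho>'_def by auto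
  qed
  define M where "M x y = ?L (\<rho> x) y" for x y
  have one: "one_factorization (2 * k) (join k M (cyc k))"
  proof (rule join_one_factorization)
    show "k > 0" using m by simp
    show "one_factorization (k + 1) (cyc k)" by (rule cyc_one_factorization[OF k])
    show "M x y < k" if "x < k" "y < k" for x y using Llt \<rho> that by (simp add: M_def)
    show "M x x = 0" if "x < k" for x using \<rho> that by (simp add: M_def)
    show "y = y'" if "x < k" "y < k" "y' < k" "M x y = M x y'" for x y y'
      using Lrow[of "\<rho> x" y y'] \<rho>(1)[OF that(1)] that by (simp add: M_def)
    show "x = x'" if "x < k" "x' < k" "y < k" "M x y = M x' y" for x x' y
      using Lcol[of "\<rho> x" "\<rho> x'" y] \<rho>(1)[OF that(1)] \<rho>(1)[OF that(2)] \<rho>inj[OF that(1,2)] that by (simp add: M_def)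
  qed
  \<comment> \<open>Three free group elements and a displacement \<open>h\<close> that is applied at
    odd indices. For indices of sum zero the number of odd ones is even, so the displacements cancel
    and the equation between the colours persists.\<close>
  define F where "F = (\<lambda>(a, b, c, h). ((\<lambda>i. \<rho>' (q + Bit_Operations.xor a (flip i h))),
      (\<lambda>i. k + (q + Bit_Operations.xor b (flip i h))),
      (\<lambda>i. \<rho>' (q + Bit_Operations.xor c (flip i h))),
      (\<lambda>i. k + (q + Bit_Operations.xor (Bit_Operations.xor (Bit_Operations.xor a b) c) (flip i h)))))"
  let ?A = "{..<m} \<times> {..<m} \<times> {..<m} \<times> {..<m}"
  have flip: "flip i h < m" if "h < m" for i h using that m by (simp add: flip_def)
  have xl: "Bit_Operations.xor a b < m" if "a < m" "b < m" for a b
    using xor_less that by (simp add: m_def)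
  have col: "join k M (cyc k) (\<rho>' (q + a)) (k + (q + b)) = q + Bit_Operations.xor a b - 1"
    "\<rho>' (q + a) < k" "q + b < k"
    if "a < m" "b < m" for a b
  proof -
    have lt: "q + a < k" "q + b < k" using that q by auto
    have v: "M (\<rho>' (q + a)) (q + b) = q + Bit_Operations.xor a b"
      using \<rho>'(2)[OF lt(1)] by (simp add: M_def prolonged_def)
    have "M (q + b) (q + b) = 0" using \<rho>(2)[OF lt(2)] by (simp add: M_def)
    then have "\<rho>' (q + a) \<noteq> q + b" using v q by auto
    then show "join k M (cyc k) (\<rho>' (q + a)) (k + (q + b)) = q + Bit_Operations.xor a b - 1"
      using \<rho>'(1)[OF lt(1)] v by (simp add: join_def)
    show "\<rho>' (q + a) < k" "q + b < k" using \<rho>'(1)[OF lt(1)] lt by auto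
  qed
  have "many (card ?A) (colour_trades (2 * k) (2 * k - 1) (join k M (cyc k)))"
  proof (rule manyI)
    show "finite ?A" by simp
    have rinj: "a = a'" if "a < m" "a' < m" "\<rho>' (q + a) = \<rho>' (q + a')" for a a'
    proof -
      have "q + a < k" "q + a' < k" using that q by auto
      then have "\<rho> (\<rho>' (q + a)) = q + a" "\<rho> (\<rho>' (q + a')) = q + a'" by (simp_all only: \<rho>'(2))
      then show ?thesis using that(3) by (metis add_left_cancel)
    qed
    show "inj_on F ?A"
    proof (rule inj_onI)
      fix t t' assume t: "t \<in> ?A" "t' \<in> ?A" and eqt: "F t = F t'"
      obtain a b c h a' b' c' h' where tt: "t = (a, b, c, h)" "t' = (a', b', c', h')"
        by (cases t rule: prod_cases4, cases t' rule: prod_cases4)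
      have lt: "a < m" "b < m" "c < m" "h < m" "a' < m" "b' < m" "c' < m" "h' < m" using t tt by auto
      have eq: "F (a, b, c, h) = F (a', b', c', h')" using eqt tt by simp
      have p: "\<rho>' (q + Bit_Operations.xor a (flip i h)) = \<rho>' (q + Bit_Operations.xor a' (flip i h'))" for i
        using eq unfolding F_def by (auto dest: fun_cong)
      have q': "Bit_Operations.xor b (flip i h) = Bit_Operations.xor b' (flip i h')" for i
        using eq unfolding F_def by (auto dest: fun_cong)
      have r: "\<rho>' (q + Bit_Operations.xor c (flip i h)) = \<rho>' (q + Bit_Operations.xor c' (flip i h'))" for i
        using eq unfolding F_def by (auto dest: fun_cong)
      have a: "a = a'" using rinj p[of 0] lt by (simp add: flip_def)
      moreover have "b = b'" using q'[of 0] by (simp add: flip_def)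
      moreover have "c = c'" using rinj r[of 0] lt by (simp add: flip_def)
      moreover have "Bit_Operations.xor a h = Bit_Operations.xor a' h'"
        using rinj[OF _ _ p[of 1, unfolded flip_def, simplified]] lt xl by simp
      then have "h = h'" using a by (simp add: xor_cancel)
      ultimately show "t = t'" by (simp add: tt)
    qed
    show "F ` ?A \<subseteq> colour_trades (2 * k) (2 * k - 1) (join k M (cyc k))"
    proof
      fix t assume "t \<in> F ` ?A"
      then obtain a b c h where t: "t = F (a, b, c, h)" and lt: "a < m" "b < m" "c < m" "h < m" by auto
      let ?d = "Bit_Operations.xor (Bit_Operations.xor a b) c"
      have x: "Bit_Operations.xor a (flip i h) < m" "Bit_Operations.xor b (flip i h) < m"
        "Bit_Operations.xor c (flip i h) < m" "Bit_Operations.xor ?d (flip i h) < m" for i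
        using lt xl flip by auto
      have sum: "Bit_Operations.xor (Bit_Operations.xor a (flip i h)) (Bit_Operations.xor b (flip j h)) =
        Bit_Operations.xor (Bit_Operations.xor c (flip k h)) (Bit_Operations.xor ?d (flip l h))"
        if "i + j + k + l = 0" for i j k l
      proof -
        have "even (i + j) \<longleftrightarrow> even (k + l)" using that by presburger
        then have "Bit_Operations.xor (flip i h) (flip j h) = Bit_Operations.xor (flip k h) (flip l h)"
          by (auto simp: flip_def)
        then have "Bit_Operations.xor (Bit_Operations.xor a b) (Bit_Operations.xor (flip i h) (flip j h)) =
          Bit_Operations.xor (Bit_Operations.xor a b) (Bit_Operations.xor (flip k h) (flip l h))" by simp
        moreover have cc: "Bit_Operations.xor c (Bit_Operations.xor c z) = z" for z
          by (simp flip: xor.assoc)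
        ultimately show ?thesis by (simp add: xor.assoc xor.commute xor.left_commute cc)
      qed
      have per: "flip (i + 12) h = flip i h" for i by (simp add: flip_def)
      have lk: "\<rho>' (q + Bit_Operations.xor a (flip i h)) < k" "q + Bit_Operations.xor b (flip i h) < k"
        "\<rho>' (q + Bit_Operations.xor c (flip i h)) < k" "q + Bit_Operations.xor ?d (flip i h) < k" for i
        using col(2)[OF x(1) x(1)] col(3)[OF x(2) x(2)] col(2)[OF x(3) x(3)] col(3)[OF x(4) x(4)] by auto
      have v: "join k M (cyc k) (\<rho>' (q + Bit_Operations.xor a (flip i h))) (k + (q + Bit_Operations.xor b (flip j h))) < 2 * k - 1" for i j
        using col(1)[OF x(1) x(2), of i j] xl[OF x(1) x(2), of i j] q m by simp
      show "t \<in> colour_trades (2 * k) (2 * k - 1) (join k M (cyc k))"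
        unfolding t F_def colour_trades_def mem_Collect_eq prod.case
      proof (intro conjI allI impI)
        fix i j ka l :: int assume z: "i + j + ka + l = 0"
        show "\<rho>' (q + Bit_Operations.xor a (flip i h)) \<noteq> k + (q + Bit_Operations.xor b (flip j h))"
          using lk(1)[of i] by simp
        show "\<rho>' (q + Bit_Operations.xor c (flip ka h)) \<noteq> k + (q + Bit_Operations.xor ?d (flip l h))"
          using lk(3)[of ka] by simp
        show "join k M (cyc k) (\<rho>' (q + Bit_Operations.xor a (flip i h))) (k + (q + Bit_Operations.xor b (flip j h))) < 2 * k - 1"
          by (rule v)
        show "join k M (cyc k) (\<rho>' (q + Bit_Operations.xor a (flip i h))) (k + (q + Bit_Operations.xor b (flip j h))) =
          join k M (cyc k) (\<rho>' (q + Bit_Operations.xor c (flip ka h))) (k + (q + Bit_Operations.xor ?d (flip l h)))"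
          unfolding col(1)[OF x(1) x(2)] col(1)[OF x(3) x(4)] sum[OF z] ..
      next
        fix i
        show "\<rho>' (q + Bit_Operations.xor a (flip i h)) < 2 * k" "\<rho>' (q + Bit_Operations.xor c (flip i h)) < 2 * k"
          "k + (q + Bit_Operations.xor b (flip i h)) < 2 * k" "k + (q + Bit_Operations.xor ?d (flip i h)) < 2 * k"
          using lk[of i] by simp_all
      qed (simp_all only: per)
    qed
  qed
  moreover have "card ?A = m ^ 4" by (simp add: card_cartesian_product power4_eq_xxxx)
  moreover have "(2 * k) ^ 4 \<le> 4096 * m ^ 4"
  proof -
    have "(2 * k) ^ 4 \<le> (8 * m) ^ 4" using m by (intro power_mono) auto
    then show ?thesis by (simp add: power_mult_distrib)
  qed
  ultimately show ?thesis using one by metis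
qed

text \<open>The vertex \<open>v\<close> is the pair of \<open>v mod k\<close> and its level
  \<open>v div k\<close>. Each colour splits into two according to the parity of the levels, and the
  last colour joins the two levels of a vertex.\<close>

definition double :: "nat \<Rightarrow> (nat \<Rightarrow> nat \<Rightarrow> nat) \<Rightarrow> nat \<Rightarrow> nat \<Rightarrow> nat" where
  "double k \<phi> v w = (if v mod k = w mod k then 2 * k - 2
     else 2 * \<phi> (v mod k) (w mod k) + (v div k + w div k) mod 2)"

lemma double_one_factorization:
  assumes \<phi>: "one_factorization k \<phi>" and k: "k \<ge> 2"
  shows "one_factorization (2 * k) (double k \<phi>)"
proof -
  have sym: "\<phi> x y = \<phi> y x" if "x < k" "y < k" for x y
    using \<phi> that by (simp add: one_factorization_def colouring_def)
  have lt: "\<phi> x y < k - 1" if "x < k" "y < k" "x \<noteq> y" for x y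
    using \<phi> that by (simp add: one_factorization_def)
  have ex: "\<exists>y. y < k \<and> y \<noteq> x \<and> \<phi> x y = c" if "x < k" "c < k - 1" for x c
    using \<phi> that unfolding one_factorization_def colouring_def by blast
  have md: "v mod k < k" for v using k by simp
  have dsym: "double k \<phi> v w = double k \<phi> w v" for v w
    using sym[OF md md] by (auto simp: double_def add.commute)
  have dlt: "double k \<phi> v w < 2 * k - 1" for v w
    using lt[OF md md, of v w] k by (auto simp: double_def)
  have dex: "\<exists>w. w < 2 * k \<and> w \<noteq> v \<and> double k \<phi> v w = c" if v: "v < 2 * k" and c: "c < 2 * k - 1" for v c
  proof (cases "c = 2 * k - 2")
    case True
    then show ?thesis using v k by (intro exI[of _ "if v < k then v + k else v - k"]) (auto simp: double_def le_mod_geq)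
  next
    case False
    then have "c div 2 < k - 1" using c by linarith
    then obtain y where y: "y < k" "y \<noteq> v mod k" "\<phi> (v mod k) y = c div 2" using ex[OF md] by blast
    define e where "e = (v div k + c) mod 2"
    have ed: "e < 2" by (simp add: e_def)
    define w where "w = e * k + y"
    have w: "w mod k = y" "w div k = e" using y by (auto simp: w_def)
    have "w < 2 * k" using ed y by (cases e) (auto simp: w_def less_Suc_eq numeral_2_eq_2)
    moreover have "w \<noteq> v" using w y by auto
    moreover have "(x + (x + c) mod 2) mod 2 = c mod 2" for x :: nat by presburger
    then have "(v div k + e) mod 2 = c mod 2" unfolding e_def .
    then have "double k \<phi> v w = c" using w y by (simp add: double_def)
    ultimately show ?thesis by blast
  qed
  have "\<exists>!w. w < 2 * k \<and> w \<noteq> v \<and> double k \<phi> v w = c" if v: "v < 2 * k" and c: "c < 2 * k - 1" for v c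
  proof -
    let ?A = "{..<2 * k} - {v}"
    have "double k \<phi> v ` ?A = {..<2 * k - 1}"
    proof (intro equalityI subsetI)
      fix c assume "c \<in> {..<2 * k - 1}"
      then show "c \<in> double k \<phi> v ` ?A" using dex[OF v, of c] by (auto simp: image_iff)
    qed (use dlt in auto)
    then have "card (double k \<phi> v ` ?A) = card ?A" using v by simp
    then have "inj_on (double k \<phi> v) ?A" by (intro eq_card_imp_inj_on) auto
    then show ?thesis using dex[OF v c] by (auto simp: inj_on_def)
  qed
  then show ?thesis unfolding one_factorization_def colouring_def using dsym dlt by auto
qed

text \<open>A trade lifts by giving its points levels that are affine in the index modulo 2: three
  free starting levels and a common slope \<open>h\<close>, the fourth starting level being forced.
  The 16 lifts match the growth of \<open>g ^ 4\<close>.\<close>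

lemma double_trades:
  assumes \<phi>: "one_factorization k \<phi>" and k: "k \<ge> 2" and t: "many \<tau> (colour_trades k (k - 1) \<phi>)"
  shows "many (16 * \<tau>) (colour_trades (2 * k) (2 * k - 1) (double k \<phi>))"
proof -
  obtain F where F: "inj_on F {..<\<tau>}" "F ` {..<\<tau>} \<subseteq> colour_trades k (k - 1) \<phi>" using t by (auto simp: many_def)
  define sh where "sh p e h = (\<lambda>i::int. p i + k * nat ((e + i * h) mod 2))" for p :: "int \<Rightarrow> nat" and e h :: int
  define G where "G = (\<lambda>(n, e1, e2, e3, h). case F n of (p, q, r, s) \<Rightarrow>
     (sh p e1 h, sh q e2 h, sh r e3 h, sh s (- e1 - e2 - e3) h))"
  let ?A = "{..<\<tau>} \<times> {0, 1::int} \<times> {0, 1::int} \<times> {0, 1::int} \<times> {0, 1::int}"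
  have shm: "sh p e h i mod k = p i" "sh p e h i div k = nat ((e + i * h) mod 2)" "sh p e h i < 2 * k"
    if "p i < k" for p e h i
  proof -
    have "nat ((e + i * h) mod 2) < 2" by simp
    then have "k * nat ((e + i * h) mod 2) \<le> k * 1" by (intro mult_le_mono) auto
    then show "sh p e h i < 2 * k" unfolding sh_def using that by linarith
    show "sh p e h i mod k = p i" "sh p e h i div k = nat ((e + i * h) mod 2)" using that k by (auto simp: sh_def)
  qed
  have Fn: "\<exists>p q r s. F n = (p, q, r, s) \<and> (p, q, r, s) \<in> colour_trades k (k - 1) \<phi>" if "n < \<tau>" for n
    using that F(2) by (cases "F n") (metis image_subset_iff lessThan_iff)
  have "many (card ?A) (colour_trades (2 * k) (2 * k - 1) (double k \<phi>))"
  proof (rule manyI)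
    show "finite ?A" by simp
    show "inj_on G ?A"
    proof (rule inj_onI)
      fix a b assume a: "a \<in> ?A" and b: "b \<in> ?A" and eq: "G a = G b"
      obtain n e1 e2 e3 h n' e1' e2' e3' h' where ab: "a = (n, e1, e2, e3, h)" "b = (n', e1', e2', e3', h')"
        by (cases a rule: prod_cases5, cases b rule: prod_cases5)
      have lt: "n < \<tau>" "n' < \<tau>" and e: "{e1, e2, e3, h, e1', e2', e3', h'} \<subseteq> {0, 1}" using a b ab by auto
      obtain p q r s where P: "F n = (p, q, r, s)" "(p, q, r, s) \<in> colour_trades k (k - 1) \<phi>" using Fn[OF lt(1)] by blast
      obtain p' q' r' s' where P': "F n' = (p', q', r', s')" "(p', q', r', s') \<in> colour_trades k (k - 1) \<phi>" using Fn[OF lt(2)] by blast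
      have l: "p i < k" "q i < k" "r i < k" "s i < k" "p' i < k" "q' i < k" "r' i < k" "s' i < k" for i
        using P(2) P'(2) by (auto simp: colour_trades_def)
      have eqs: "sh p e1 h = sh p' e1' h'" "sh q e2 h = sh q' e2' h'" "sh r e3 h = sh r' e3' h'"
        "sh s (- e1 - e2 - e3) h = sh s' (- e1' - e2' - e3') h'"
        using eq unfolding ab G_def by (auto simp: P(1) P'(1))
      have pq: "p = p'" "q = q'" "r = r'" "s = s'"
        using shm(1) l eqs by (metis ext)+
      have dv: "nat ((e1 + i * h) mod 2) = nat ((e1' + i * h') mod 2)" "nat ((e2 + i * h) mod 2) = nat ((e2' + i * h') mod 2)"
        "nat ((e3 + i * h) mod 2) = nat ((e3' + i * h') mod 2)" for i
        using shm(2) l eqs by metis+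
      have id: "x = y" if "nat (x mod 2) = nat (y mod 2)" "x \<in> {0, 1}" "y \<in> {0, 1}" for x y :: int
        using that by auto
      have m: "e1 \<in> {0, 1}" "e2 \<in> {0, 1}" "e3 \<in> {0, 1}" "h \<in> {0, 1}" "e1' \<in> {0, 1}" "e2' \<in> {0, 1}" "e3' \<in> {0, 1}" "h' \<in> {0, 1}"
        using e by simp_all
      have "e1 = e1'" by (rule id[OF _ m(1,5)]) (use dv(1)[of 0] in simp)
      moreover have "e2 = e2'" by (rule id[OF _ m(2,6)]) (use dv(2)[of 0] in simp)
      moreover have "e3 = e3'" by (rule id[OF _ m(3,7)]) (use dv(3)[of 0] in simp)
      moreover have "nat ((e1 + h) mod 2) = nat ((e1 + h') mod 2)" using dv(1)[of 1] \<open>e1 = e1'\<close> by simp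
      then have "h = h'" using m(1,4,8) by (elim insertE emptyE) simp_all
      moreover have "n = n'" using F(1) P(1) P'(1) pq lt by (auto simp: inj_on_def)
      ultimately show "a = b" by (simp add: ab)
    qed
    show "G ` ?A \<subseteq> colour_trades (2 * k) (2 * k - 1) (double k \<phi>)"
    proof
      fix t assume "t \<in> G ` ?A"
      then obtain n e1 e2 e3 h where n: "n < \<tau>" and t: "t = G (n, e1, e2, e3, h)" by auto
      obtain p q r s where P: "F n = (p, q, r, s)" "(p, q, r, s) \<in> colour_trades k (k - 1) \<phi>" using Fn[OF n] by blast
      let ?e4 = "- e1 - e2 - e3"
      have l: "p i < k" "q i < k" "r i < k" "s i < k" for i using P(2) by (auto simp: colour_trades_def)
      have per: "sh f e h (i + 12) = sh f e h i" if "f (i + 12) = f i" for f e i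
      proof -
        have "(e + (i + 12) * h) mod 2 = (e + i * h) mod 2"
          using mod_mult_self1[of "e + i * h" "6 * h" 2] by (simp add: algebra_simps)
        then show ?thesis using that by (simp add: sh_def)
      qed
      have main: "sh p e1 h i \<noteq> sh q e2 h j \<and> sh r e3 h k' \<noteq> sh s ?e4 h l' \<and>
        double k \<phi> (sh p e1 h i) (sh q e2 h j) = double k \<phi> (sh r e3 h k') (sh s ?e4 h l')"
        if z: "i + j + k' + l' = 0" for i j k' l'
      proof -
        have c: "p i \<noteq> q j" "r k' \<noteq> s l'" "\<phi> (p i) (q j) = \<phi> (r k') (s l')"
          using P(2) z by (auto simp: colour_trades_def)
        have par: "(nat ((x) mod 2) + nat ((y) mod 2)) mod 2 = nat ((x + y) mod 2)" for x y :: int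
        proof -
          have "x mod 2 \<in> {0, 1}" "y mod 2 \<in> {0, 1}" by auto
          moreover have "(x + y) mod 2 = (x mod 2 + y mod 2) mod 2" by (simp add: mod_simps)
          ultimately show ?thesis by auto
        qed
        have "(e1 + i * h) + (e2 + j * h) = (e3 + k' * h) + (?e4 + l' * h) + 2 * (e1 + e2 + (i + j) * h)"
          using z by algebra
        then have "((e1 + i * h) + (e2 + j * h)) mod 2 = ((e3 + k' * h) + (?e4 + l' * h)) mod 2"
          by (simp only: mod_mult_self2)
        then have "(nat ((e1 + i * h) mod 2) + nat ((e2 + j * h) mod 2)) mod 2 =
          (nat ((e3 + k' * h) mod 2) + nat ((?e4 + l' * h) mod 2)) mod 2" by (simp only: par)
        then have "double k \<phi> (sh p e1 h i) (sh q e2 h j) = double k \<phi> (sh r e3 h k') (sh s ?e4 h l')"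
          unfolding double_def shm(1)[of p, OF l(1)] shm(1)[of q, OF l(2)] shm(1)[of r, OF l(3)] shm(1)[of s, OF l(4)]
            shm(2)[of p, OF l(1)] shm(2)[of q, OF l(2)] shm(2)[of r, OF l(3)] shm(2)[of s, OF l(4)]
          using c by simp
        moreover have "sh p e1 h i \<noteq> sh q e2 h j"
          using c(1) shm(1)[of p i e1 h, OF l(1)] shm(1)[of q j e2 h, OF l(2)] by metis
        moreover have "sh r e3 h k' \<noteq> sh s ?e4 h l'"
          using c(2) shm(1)[of r k' e3 h, OF l(3)] shm(1)[of s l' ?e4 h, OF l(4)] by metis
        ultimately show ?thesis by blast
      qed
      have dl: "double k \<phi> (sh p e1 h i) (sh q e2 h j) < 2 * k - 1" for i j
      proof -
        have "sh p e1 h i \<noteq> sh q e2 h j" using main[of i j "- i - j" 0] by simp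
        then show ?thesis using double_one_factorization[OF \<phi> k] shm(3)[OF l(1)] shm(3)[OF l(2)]
          by (simp add: one_factorization_def)
      qed
      have p12: "p (i + 12) = p i" "q (i + 12) = q i" "r (i + 12) = r i" "s (i + 12) = s i" for i
        using P(2) by (auto simp: colour_trades_def)
      show "t \<in> colour_trades (2 * k) (2 * k - 1) (double k \<phi>)"
        unfolding t G_def prod.case P(1) colour_trades_def mem_Collect_eq
      proof (intro conjI allI impI)
        fix i j k' l' :: int assume "i + j + k' + l' = 0"
        from main[OF this] show "sh p e1 h i \<noteq> sh q e2 h j" "sh r e3 h k' \<noteq> sh s ?e4 h l'"
          "double k \<phi> (sh p e1 h i) (sh q e2 h j) = double k \<phi> (sh r e3 h k') (sh s ?e4 h l')" by blast+
        show "double k \<phi> (sh p e1 h i) (sh q e2 h j) < 2 * k - 1" by (rule dl)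
      next
        fix i
        show "sh p e1 h i < 2 * k" by (rule shm(3)[OF l(1)])
        show "sh q e2 h i < 2 * k" by (rule shm(3)[OF l(2)])
        show "sh r e3 h i < 2 * k" by (rule shm(3)[OF l(3)])
        show "sh s ?e4 h i < 2 * k" by (rule shm(3)[OF l(4)])
      qed (rule per, rule p12)+
    qed
  qed
  moreover have "card ?A = 16 * \<tau>" by (simp add: card_cartesian_product)
  ultimately show ?thesis by metis
qed

text \<open>Halving down to an odd \<open>k\<close> and doubling back leaves the ratio 4096
  unchanged.\<close>

lemma rich_one_factorization:
  assumes "even g" "g > 0"
  shows "\<exists>\<phi> \<tau>. one_factorization g \<phi> \<and> many \<tau> (colour_trades g (g - 1) \<phi>) \<and> g ^ 4 \<le> 4096 * \<tau>"
  using assms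
proof (induction g rule: less_induct)
  case (less g)
  then obtain k where k: "g = 2 * k" "k > 0" by (auto elim: evenE)
  show ?case
  proof (cases "odd k")
    case True
    then show ?thesis using rich_one_factorization_odd k by simp
  next
    case False
    then have k2: "k \<ge> 2" using k by presburger
    obtain \<phi> \<tau> where \<phi>: "one_factorization k \<phi>" "many \<tau> (colour_trades k (k - 1) \<phi>)" "k ^ 4 \<le> 4096 * \<tau>"
      using less.IH[of k] k False by auto
    have "(2 * k) ^ 4 \<le> 4096 * (16 * \<tau>)" using \<phi>(3) by (simp add: power_mult_distrib)
    then show ?thesis using double_one_factorization[OF \<phi>(1) k2] double_trades[OF \<phi>(1) k2 \<phi>(2)] k by blast
  qed
qed

lemma card_less_pairs: "2 * card {(x, y). x < y \<and> y < (g::nat)} = g * (g - 1)" "finite {(x, y). x < y \<and> y < (g::nat)}"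
proof -
  have eq: "{(x, y). x < y \<and> y < g} = prod.swap ` (SIGMA y:{..<g}. {..<y})" by (auto simp: image_iff)
  show "finite {(x, y). x < y \<and> y < g}" unfolding eq by auto
  have "card {(x, y). x < y \<and> y < g} = card (SIGMA y:{..<g}. {..<y})"
    unfolding eq by (rule card_image) (auto simp: inj_on_def)
  also have "\<dots> = (\<Sum>y<g. y)" by simp
  finally have "card {(x, y). x < y \<and> y < g} = (\<Sum>y<g. y)" .
  moreover have "2 * (\<Sum>y<g. y) = g * (g - 1)"
  proof (induction g)
    case (Suc g)
    then show ?case by (cases g) (auto simp: algebra_simps)
  qed simp
  ultimately show "2 * card {(x, y). x < y \<and> y < g} = g * (g - 1)" by simp
qed

subsection \<open>Blocks from edge colourings\<close>

text \<open>The blocks of the classical doubling construction, restricted to validly coloured edges: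
  each edge in one copy is combined with the edges of the same colour in the other.\<close>

definition quads22 :: "nat \<Rightarrow> nat \<Rightarrow> nat \<Rightarrow> nat \<Rightarrow> (nat \<Rightarrow> nat \<Rightarrow> nat) \<Rightarrow> (nat \<times> nat) set set" where
  "quads22 i j g m \<phi> = {{(i, a), (i, a'), (j, b), (j, b')} | a a' b b'.
     a < g \<and> a' < g \<and> b < g \<and> b' < g \<and> a \<noteq> a' \<and> b \<noteq> b' \<and> \<phi> a a' < m \<and> \<phi> a a' = \<phi> b b'}"

lemma quads22I:
  assumes "a < g" "a' < g" "b < g" "b' < g" "a \<noteq> a'" "b \<noteq> b'" "\<phi> a a' < m" "\<phi> a a' = \<phi> b b'"
  shows "{(i, a), (i, a'), (j, b), (j, b')} \<in> quads22 i j g m \<phi>"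
  unfolding quads22_def using assms by blast

lemma quads22_cover:
  assumes \<phi>: "colouring g m \<phi>" and a: "a < g" "a' < g" "a \<noteq> a'" "\<phi> a a' < m" and b: "b < g"
  shows "\<exists>B\<in>quads22 i j g m \<phi>. (i, a) \<in> B \<and> (i, a') \<in> B \<and> (j, b) \<in> B"
    and "\<exists>B\<in>quads22 j i g m \<phi>. (i, a) \<in> B \<and> (i, a') \<in> B \<and> (j, b) \<in> B"
proof -
  obtain b' where b': "b' < g" "b' \<noteq> b" "\<phi> b b' = \<phi> a a'"
    using \<phi> b a(4) unfolding colouring_def by blast
  have "{(i, a), (i, a'), (j, b), (j, b')} \<in> quads22 i j g m \<phi>"
    by (rule quads22I) (use a b b' in auto)
  then show "\<exists>B\<in>quads22 i j g m \<phi>. (i, a) \<in> B \<and> (i, a') \<in> B \<and> (j, b) \<in> B" by (rule bexI[rotated]) simp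
  have "{(j, b), (j, b'), (i, a), (i, a')} \<in> quads22 j i g m \<phi>"
    by (rule quads22I) (use a b b' in auto)
  then show "\<exists>B\<in>quads22 j i g m \<phi>. (i, a) \<in> B \<and> (i, a') \<in> B \<and> (j, b) \<in> B" by (rule bexI[rotated]) simp
qed

lemma quads22_blockD:
  assumes "B \<in> quads22 i j g m \<phi>" "i \<noteq> j"
  shows "B \<subseteq> {i, j} \<times> {..<g}" "card B = 4"
  using assms by (auto simp: quads22_def)

lemma card_colour_class:
  assumes \<phi>: "colouring g m \<phi>" and c: "c < m"
  shows "2 * card {(x, y). x < y \<and> y < g \<and> \<phi> x y = c} = g" "finite {(x, y). x < y \<and> y < g \<and> \<phi> x y = c}"
proof -
  let ?E = "{(x, y). x < y \<and> y < g \<and> \<phi> x y = c}"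
  let ?O = "{(x, y). x < g \<and> y < g \<and> y \<noteq> x \<and> \<phi> x y = c}"
  show fin: "finite ?E" by (rule finite_subset[OF _ card_less_pairs(2)[of g]]) auto
  have ex1: "\<exists>!y. y < g \<and> y \<noteq> x \<and> \<phi> x y = c" if "x < g" for x
    using \<phi> that c unfolding colouring_def by blast
  have "bij_betw fst ?O {..<g}"
    unfolding bij_betw_def
  proof (intro conjI equalityI subsetI)
    show "inj_on fst ?O" using ex1 by (auto simp: inj_on_def)
    fix x assume "x \<in> {..<g}"
    then obtain y where "y < g" "y \<noteq> x" "\<phi> x y = c" using ex1[of x] by auto
    then show "x \<in> fst ` ?O" using \<open>x \<in> {..<g}\<close> by (intro image_eqI[of _ _ "(x, y)"]) auto
  qed auto
  then have "card ?O = g" by (simp add: bij_betw_same_card)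
  moreover have "?O = ?E \<union> prod.swap ` ?E"
  proof (intro equalityI subsetI)
    fix t assume "t \<in> ?O"
    then obtain x y where t: "t = (x, y)" "x < g" "y < g" "y \<noteq> x" "\<phi> x y = c" by auto
    have "\<phi> y x = c" using \<phi> t unfolding colouring_def by metis
    then show "t \<in> ?E \<union> prod.swap ` ?E" using t by (cases "x < y") (auto simp: image_iff)
  next
    fix t assume "t \<in> ?E \<union> prod.swap ` ?E"
    then show "t \<in> ?O"
    proof (elim UnE imageE)
      fix e assume "t = prod.swap e" "e \<in> ?E"
      then obtain x y where t: "t = (y, x)" "x < y" "y < g" "\<phi> x y = c" by auto
      then have "\<phi> y x = c" using \<phi> unfolding colouring_def by (metis order.strict_trans)
      then show ?thesis using t by auto
    qed auto
  qed
  moreover have "card (?E \<union> prod.swap ` ?E) = card ?E + card (prod.swap ` ?E)"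
    using fin by (intro card_Un_disjoint) auto
  moreover have "card (prod.swap ` ?E) = card ?E" by (rule card_image) (auto simp: inj_on_def)
  ultimately show "2 * card ?E = g" by simp
qed

text \<open>Each of the \<open>m\<close> perfect matchings has \<open>g / 2\<close> edges in either
  copy.\<close>

lemma card_quads22:
  assumes \<phi>: "colouring g m \<phi>"
  shows "4 * card (quads22 i j g m \<phi>) \<le> m * g ^ 2" "finite (quads22 i j g m \<phi>)"
proof -
  define E where "E c = {(x, y). x < y \<and> y < g \<and> \<phi> x y = c}" for c
  let ?f = "\<lambda>((x, y), (z, w)). {(i, x), (i, y), (j, z), (j, w)}"
  have sym: "\<phi> x y = \<phi> y x" if "x < g" "y < g" for x y using \<phi> that unfolding colouring_def by blast
  have sub: "quads22 i j g m \<phi> \<subseteq> (\<Union>c\<in>{..<m}. ?f ` (E c \<times> E c))"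
  proof
    fix B assume "B \<in> quads22 i j g m \<phi>"
    then obtain a a' b b' where B: "B = {(i, a), (i, a'), (j, b), (j, b')}" and
      l: "a < g" "a' < g" "b < g" "b' < g" "a \<noteq> a'" "b \<noteq> b'" "\<phi> a a' < m" "\<phi> a a' = \<phi> b b'"
      unfolding quads22_def by blast
    have 1: "(min a a', max a a') \<in> E (\<phi> a a')" "(min b b', max b b') \<in> E (\<phi> a a')"
      using l sym[OF l(1,2)] sym[OF l(3,4)] by (auto simp: E_def min_def max_def)
    have "B = ?f ((min a a', max a a'), (min b b', max b b'))" unfolding B by (auto simp: min_def max_def)
    then have "B \<in> ?f ` (E (\<phi> a a') \<times> E (\<phi> a a'))" by (rule image_eqI) (use 1 in simp)
    then show "B \<in> (\<Union>c\<in>{..<m}. ?f ` (E c \<times> E c))" using l(7) by blast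
  qed
  have finE: "finite (E c)" and cE: "2 * card (E c) = g" if "c < m" for c
    using card_colour_class[OF \<phi> that] by (auto simp: E_def)
  have fin: "finite (\<Union>c\<in>{..<m}. ?f ` (E c \<times> E c))" using finE by auto
  show "finite (quads22 i j g m \<phi>)" using sub fin by (rule finite_subset)
  have "card (quads22 i j g m \<phi>) \<le> card (\<Union>c\<in>{..<m}. ?f ` (E c \<times> E c))" by (rule card_mono[OF fin sub])
  also have "\<dots> \<le> (\<Sum>c<m. card (?f ` (E c \<times> E c)))" by (rule card_UN_le) simp
  also have "\<dots> \<le> (\<Sum>c<m. card (E c) * card (E c))"
    by (rule sum_mono) (use finE card_image_le[of "E c \<times> E c" ?f for c] in \<open>auto simp: card_cartesian_product\<close>)
  finally have le: "card (quads22 i j g m \<phi>) \<le> (\<Sum>c<m. card (E c) * card (E c))" .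
  have "4 * (\<Sum>c<m. card (E c) * card (E c)) = (\<Sum>c<m. (2 * card (E c)) * (2 * card (E c)))"
    by (simp add: sum_distrib_left algebra_simps)
  with le have "4 * card (quads22 i j g m \<phi>) \<le> (\<Sum>c<m. (2 * card (E c)) * (2 * card (E c)))" by linarith
  also have "\<dots> = (\<Sum>c<m. g * g)" by (rule sum.cong) (use cE in auto)
  finally show "4 * card (quads22 i j g m \<phi>) \<le> m * g ^ 2" by (simp add: power2_eq_square)
qed

lemma many_quad_trades:
  assumes t: "many \<tau> (colour_trades g m \<phi>)" and sub: "quads22 i j g m \<phi> \<subseteq> B" and o: "fst o' \<noteq> i" "fst o' \<noteq> j"
  shows "\<exists>F :: nat \<Rightarrow> (nat \<times> nat) quad_fun. inj_on F {..<\<tau>} \<and> F ` {..<\<tau>} \<subseteq> avoiding_trades B o'"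
proof -
  obtain F where F: "inj_on F {..<\<tau>}" "F ` {..<\<tau>} \<subseteq> colour_trades g m \<phi>" using t by (auto simp: many_def)
  define G :: "nat quad_fun \<Rightarrow> (nat \<times> nat) quad_fun"
    where "G = (\<lambda>(p, q, r, s). ((\<lambda>x::int. (i, p x)), (\<lambda>x::int. (i, q x)), (\<lambda>x::int. (j, r x)), (\<lambda>x::int. (j, s x))))"
  have G: "G t \<in> avoiding_trades B o'" if "t \<in> colour_trades g m \<phi>" for t
  proof -
    obtain p q r s where t: "t = (p, q, r, s)" by (cases t)
    have c: "\<forall>i. p i < g \<and> q i < g \<and> r i < g \<and> s i < g"
      "\<forall>i j k l. i + j + k + l = 0 \<longrightarrow> p i \<noteq> q j \<and> r k \<noteq> s l \<and> \<phi> (p i) (q j) < m \<and> \<phi> (p i) (q j) = \<phi> (r k) (s l)"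
      using that unfolding t colour_trades_def mem_Collect_eq prod.case by blast+
    have "{(i, p x), (i, q y), (j, r z), (j, s (- x - y - z))} \<in> B" for x y z
    proof (rule subsetD[OF sub], rule quads22I)
      have "x + y + z + (- x - y - z) = 0" by simp
      with c(2) have *: "p x \<noteq> q y \<and> r z \<noteq> s (- x - y - z) \<and> \<phi> (p x) (q y) < m \<and> \<phi> (p x) (q y) = \<phi> (r z) (s (- x - y - z))"
        by blast
      show "p x \<noteq> q y" "r z \<noteq> s (- x - y - z)" "\<phi> (p x) (q y) < m" "\<phi> (p x) (q y) = \<phi> (r z) (s (- x - y - z))"
        using * by blast+
    qed (use c(1) in blast)+
    then show ?thesis using that o by (auto simp: t G_def colour_trades_def trade_def)
  qed
  have "inj G" by (auto simp: G_def inj_def fun_eq_iff)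
  then have "inj_on (G \<circ> F) {..<\<tau>}" using F(1) by (intro comp_inj_on) (auto intro: inj_on_subset)
  moreover have "(G \<circ> F) ` {..<\<tau>} \<subseteq> avoiding_trades B o'"
  proof (rule image_subsetI)
    fix n assume "n \<in> {..<\<tau>}"
    then have "F n \<in> colour_trades g m \<phi>" using F(2) by blast
    from G[OF this] show "(G \<circ> F) n \<in> avoiding_trades B o'" by (simp only: comp_apply)
  qed
  ultimately show ?thesis by blast
qed

text \<open>Coverage is symmetric in the three points, so they may be taken in the order of their
  copies.\<close>

lemma cover_wlog:
  fixes P Q R :: "nat \<times> nat"
  assumes sorted: "\<And>P Q R. \<lbrakk>P \<in> Y; Q \<in> Y; R \<in> Y; P \<noteq> Q; P \<noteq> R; Q \<noteq> R; fst P \<le> fst Q; fst Q \<le> fst R\<rbrakk>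
     \<Longrightarrow> \<exists>b\<in>B. P \<in> b \<and> Q \<in> b \<and> R \<in> b"
    and Y: "P \<in> Y" "Q \<in> Y" "R \<in> Y" "P \<noteq> Q" "P \<noteq> R" "Q \<noteq> R"
  shows "\<exists>b\<in>B. P \<in> b \<and> Q \<in> b \<and> R \<in> b"
proof -
  have "fst P \<le> fst Q \<and> fst Q \<le> fst R \<or> fst P \<le> fst R \<and> fst R \<le> fst Q \<or> fst Q \<le> fst P \<and> fst P \<le> fst R \<or>
    fst Q \<le> fst R \<and> fst R \<le> fst P \<or> fst R \<le> fst P \<and> fst P \<le> fst Q \<or> fst R \<le> fst Q \<and> fst Q \<le> fst P" by linarith
  then show ?thesis
    using sorted[of P Q R] sorted[of P R Q] sorted[of Q P R] sorted[of Q R P] sorted[of R P Q] sorted[of R Q P] Y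
    by (elim disjE conjE) (simp_all, (metis+)?)
qed

subsection \<open>Quadrupling\<close>

lemma mod2_cancel: "(a + (b + a) mod 2) mod 2 = b mod (2::nat)"
proof -
  have "(a + (b + a) mod 2) mod 2 = (a + (b + a)) mod 2" by (rule mod_add_right_eq)
  also have "a + (b + a) = b + 2 * a" by simp
  also have "(b + 2 * a) mod 2 = b mod 2" by (rule mod_mult_self2)
  finally show ?thesis .
qed

lemma less_four_cases:
  assumes "i < l" "l < (4::nat)"
  obtains "i = 0" "l = 1" | "i = 2" "l = 3" | "i = 0" "l = 2" | "i = 0" "l = 3" | "i = 1" "l = 2" | "i = 1" "l = 3"
proof -
  have "l = 1 \<or> l = 2 \<or> l = 3" "i = 0 \<or> i = 1 \<or> i = 2" using assms by linarith+
  then show thesis using assms that by (elim disjE) auto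
qed

text \<open>The point set is four copies of \<open>{..<2 k}\<close> and two points at infinity, encoded as copy number 4.
  In a block with one point \<open>a\<close>, \<open>b\<close> in two copies and a pair \<open>c\<close>, \<open>c'\<close> in a third one, the sum of \<open>c\<close> and \<open>c'\<close>
  is prescribed by \<open>a\<close> and \<open>b\<close>; for \<open>c = c'\<close> the fourth point is one of the points at infinity.\<close>

definition tri :: "nat \<Rightarrow> nat \<Rightarrow> nat \<Rightarrow> nat \<Rightarrow> nat \<Rightarrow> nat \<Rightarrow> bool" where
  "tri k e a b c c' \<longleftrightarrow> k dvd a + b + (c + c') mod (2 * k) div 2 \<and>
     ((c + c') mod (2 * k)) mod 2 = (a div k + b div k + e) mod 2"

definition neg :: "nat \<Rightarrow> nat \<Rightarrow> nat" where
  "neg k x = (k - x mod k) mod k"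

lemma neg_props:
  assumes "k > 0"
  shows "neg k x < k" "k dvd x + neg k x" "k dvd x + y \<Longrightarrow> y mod k = neg k x"
proof -
  show "neg k x < k" using assms by (simp add: neg_def)
  have "x mod k \<le> k" using assms by (simp add: less_imp_le)
  then have "(x mod k + (k - x mod k)) mod k = 0" by simp
  then have "(x + neg k x) mod k = 0" by (simp add: neg_def mod_simps)
  then show *: "k dvd x + neg k x" by (simp add: dvd_eq_mod_eq_0)
  assume "k dvd x + y"
  then have "(x + y) mod k = (x + neg k x) mod k" using * by (simp add: dvd_eq_mod_eq_0)
  then have "y mod k = neg k x mod k" using nat_mod_eq_iff[of "x + y" k "x + neg k x"] by (metis add.assoc add_left_cancel nat_mod_eq_iff)
  then show "y mod k = neg k x" using \<open>neg k x < k\<close> by simp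
qed

text \<open>Solves \<open>tri\<close> for \<open>b\<close>: half of the sum of \<open>c\<close> and
  \<open>c'\<close> fixes \<open>b\<close> modulo \<open>k\<close>, and the parity of that sum fixes
  \<open>b div k\<close>.\<close>

definition third :: "nat \<Rightarrow> nat \<Rightarrow> nat \<Rightarrow> nat \<Rightarrow> nat \<Rightarrow> nat" where
  "third k e a c c' = k * (((c + c') mod (2 * k) + a div k + e) mod 2) + neg k (a + (c + c') mod (2 * k) div 2)"

lemma third_less:
  assumes "k > 0"
  shows "third k e a c c' < 2 * k" "third k e a c c' div k = ((c + c') mod (2 * k) + a div k + e) mod 2"
proof -
  have n: "neg k x < k" for x using neg_props[OF assms] by blast
  show "third k e a c c' div k = ((c + c') mod (2 * k) + a div k + e) mod 2" using n assms by (simp add: third_def)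
  have "k * (((c + c') mod (2 * k) + a div k + e) mod 2) \<le> k * 1" by (intro mult_le_mono) auto
  then show "third k e a c c' < 2 * k"
    unfolding third_def using n[of "a + (c + c') mod (2 * k) div 2"] by linarith
qed

lemma tri_third:
  assumes k: "k > 0"
  shows "tri k e a (third k e a c c') c c'"
proof -
  let ?s = "(c + c') mod (2 * k)"
  have n: "neg k x < k" for x using neg_props[OF k] by blast
  have "k dvd (a + ?s div 2) + neg k (a + ?s div 2)" using neg_props[OF k] by blast
  then have "k dvd k * ((?s + a div k + e) mod 2) + ((a + ?s div 2) + neg k (a + ?s div 2))" by simp
  then have 1: "k dvd a + third k e a c c' + ?s div 2" by (simp add: third_def algebra_simps)
  have "(x + (y + x + e) mod 2 + e) mod 2 = y mod 2" for x y :: nat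
    using mod2_cancel[of "x + e" y] by (simp add: ac_simps)
  then have "(a div k + third k e a c c' div k + e) mod 2 = ?s mod 2" unfolding third_less(2)[OF k] .
  with 1 show ?thesis by (simp add: tri_def)
qed

lemma tri_eq_third:
  assumes k: "k > 0" and b: "b < 2 * k" and t: "tri k e a b c c'"
  shows "b = third k e a c c'"
proof -
  let ?s = "(c + c') mod (2 * k)"
  have "k dvd (a + ?s div 2) + b" using t by (simp add: tri_def algebra_simps)
  then have 1: "b mod k = neg k (a + ?s div 2)" by (rule neg_props(3)[OF k])
  have d: "b div k < 2" using b k by (simp add: less_mult_imp_div_less)
  have "?s mod 2 = (a div k + b div k + e) mod 2" using t by (simp add: tri_def)
  moreover have "y = (z + x + e) mod 2" if "z mod 2 = (x + y + e) mod 2" "y < 2" for x y z :: nat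
  proof -
    have "(z + x + e) mod 2 = (z mod 2 + (x + e)) mod 2" by (simp add: mod_simps add.assoc)
    also have "\<dots> = y mod 2" unfolding that(1) using mod2_cancel[of "x + e" y] by (simp add: ac_simps)
    finally show ?thesis using that(2) by simp
  qed
  ultimately have 2: "b div k = (?s + a div k + e) mod 2" using d by blast
  have "b = k * (b div k) + b mod k" by simp
  then show ?thesis unfolding third_def using 1 2 by simp
qed

lemma tri_commute: "tri k e a b c c' \<longleftrightarrow> tri k e b a c c'" "tri k e a b c c' \<longleftrightarrow> tri k e a b c' c"
  by (simp_all add: tri_def add.commute)

lemma tri_fourth:
  assumes k: "k > 0" and c: "c < 2 * k"
  shows "\<exists>c'<2 * k. tri k e a b c c'"
proof -
  define s where "s = 2 * neg k (a + b) + (a div k + b div k + e) mod 2"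
  have n: "neg k (a + b) < k" "k dvd a + b + neg k (a + b)" using neg_props[OF k] by auto
  have s: "s < 2 * k" "s div 2 = neg k (a + b)" "s mod 2 = (a div k + b div k + e) mod 2"
    using n(1) by (auto simp: s_def)
  define c' where "c' = (s + (2 * k - c)) mod (2 * k)"
  have "(c + c') mod (2 * k) = (c + (s + (2 * k - c))) mod (2 * k)" by (simp add: c'_def mod_simps)
  also have "c + (s + (2 * k - c)) = s + 2 * k" using c by simp
  finally have "(c + c') mod (2 * k) = s" using s by simp
  then have "tri k e a b c c'" using s n by (simp add: tri_def)
  moreover have "c' < 2 * k" using k by (simp add: c'_def)
  ultimately show ?thesis by blast
qed

text \<open>Adding \<open>k\<close> to \<open>c\<close> leaves \<open>2 * c\<close> modulo
  \<open>2 * k\<close> unchanged but flips \<open>label\<close>; this freedom makes both points at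
  infinity reachable.\<close>

lemma tri_diag_shift:
  assumes "tri k e a b c c" "c mod k = c' mod k"
  shows "tri k e a b c' c'"
proof -
  have "(c + c) mod (2 * k) = (c' + c') mod (2 * k)" using assms(2) by (simp add: mult_2[symmetric])
  then show ?thesis using assms(1) by (simp add: tri_def)
qed

text \<open>An entry lists the copies of \<open>a\<close> and \<open>b\<close>, the copy of the
  pair, and the parity offset \<open>e\<close>. A degenerate pair \<open>c = c'\<close> has even
  sum, so with the two offsets 0 and 1 exactly one of the two target copies completes given
  \<open>a\<close>, \<open>b\<close> and a point at infinity.\<close>

definition fam :: "(nat \<times> nat \<times> nat \<times> nat) set" where
  "fam = {(0, 1, 2, 0), (0, 1, 3, 1), (2, 3, 0, 0), (2, 3, 1, 1)}"

definition blocksT :: "nat \<Rightarrow> nat \<times> nat \<times> nat \<times> nat \<Rightarrow> (nat \<times> nat) set set" where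
  "blocksT k f = (case f of (i, j, l, e) \<Rightarrow> {{(i, a), (j, b), (l, c), (l, c')} | a b c c'.
     a < 2 * k \<and> b < 2 * k \<and> c < 2 * k \<and> c' < 2 * k \<and> c \<noteq> c' \<and> tri k e a b c c'})"

text \<open>Selects the point at infinity. The term \<open>i div 2\<close> makes the labels from the
  two directions, pair in 2 or 3 and pair in 0 or 1, complementary, so that together they account
  for both points at infinity.\<close>

definition label :: "nat \<Rightarrow> nat \<Rightarrow> nat \<Rightarrow> nat \<Rightarrow> nat" where
  "label k i a c = (a div k + c div k + i div 2) mod 2"

definition blocksI :: "nat \<Rightarrow> nat \<times> nat \<times> nat \<times> nat \<Rightarrow> (nat \<times> nat) set set" where
  "blocksI k f = (case f of (i, j, l, e) \<Rightarrow> {{(i, a), (j, b), (l, c), (4, label k i a c)} | a b c.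
     a < 2 * k \<and> b < 2 * k \<and> c < 2 * k \<and> tri k e a b c c})"

lemma card_blocksT:
  assumes k: "k > 0"
  shows "card (blocksT k f) \<le> 2 * k * (k * (2 * k - 1))"
proof -
  obtain i j l e where f: "f = (i, j, l, e)" by (cases f)
  let ?P = "{(x, y). x < y \<and> y < 2 * k}"
  let ?g = "\<lambda>(a, c, c'). {(i, a), (j, third k e a c c'), (l, c), (l, c')}"
  have sub: "blocksT k f \<subseteq> ?g ` ({..<2 * k} \<times> ?P)"
  proof
    fix B assume "B \<in> blocksT k f"
    then obtain a b c c' where B: "B = {(i, a), (j, b), (l, c), (l, c')}" and
      lt: "a < 2 * k" "b < 2 * k" "c < 2 * k" "c' < 2 * k" "c \<noteq> c'" and t: "tri k e a b c c'"
      unfolding blocksT_def f by auto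
    have b: "b = third k e a c c'" "b = third k e a c' c"
      using tri_eq_third[OF k lt(2)] t tri_commute(2)[of k e a b c c'] by auto
    show "B \<in> ?g ` ({..<2 * k} \<times> ?P)"
    proof (cases "c < c'")
      case True
      show ?thesis by (rule image_eqI[of _ _ "(a, c, c')"]) (use True lt b(1) B in auto)
    next
      case False
      show ?thesis by (rule image_eqI[of _ _ "(a, c', c)"]) (use False lt b(2) B in auto)
    qed
  qed
  have fin: "finite ({..<2 * k} \<times> ?P)" using card_less_pairs(2) by blast
  have "card (blocksT k f) \<le> card (?g ` ({..<2 * k} \<times> ?P))" by (rule card_mono[OF _ sub]) (use fin in blast)
  also have "\<dots> \<le> card ({..<2 * k} \<times> ?P)" by (rule card_image_le[OF fin])
  also have "\<dots> = 2 * k * card ?P" by (simp add: card_cartesian_product)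
  also have "card ?P = k * (2 * k - 1)" using card_less_pairs(1)[of "2 * k"] by simp
  finally show ?thesis .
qed

lemma card_blocksI:
  assumes k: "k > 0"
  shows "card (blocksI k f) \<le> 4 * k * k"
proof -
  obtain i j l e where f: "f = (i, j, l, e)" by (cases f)
  let ?g = "\<lambda>(a, c). {(i, a), (j, third k e a c c), (l, c), (4, label k i a c)}"
  have sub: "blocksI k f \<subseteq> ?g ` ({..<2 * k} \<times> {..<2 * k})"
  proof
    fix B assume "B \<in> blocksI k f"
    then obtain a b c where B: "B = {(i, a), (j, b), (l, c), (4, label k i a c)}" and
      lt: "a < 2 * k" "b < 2 * k" "c < 2 * k" and t: "tri k e a b c c"
      unfolding blocksI_def f by auto
    have b: "b = third k e a c c" using tri_eq_third[OF k lt(2) t] .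
    show "B \<in> ?g ` ({..<2 * k} \<times> {..<2 * k})" by (rule image_eqI[of _ _ "(a, c)"]) (use lt b B in auto)
  qed
  have "card (blocksI k f) \<le> card (?g ` ({..<2 * k} \<times> {..<2 * k}))" by (rule card_mono[OF _ sub]) simp
  also have "\<dots> \<le> card ({..<2 * k} \<times> {..<2 * k})" by (rule card_image_le) simp
  finally show ?thesis by (simp add: card_cartesian_product)
qed

text \<open>Triples within one copy and infinity lie in a system of order \<open>2 * k + 2\<close>;
  a pair in one copy with a point of the partner copy (0 with 1, 2 with 3) lies in \<open>Q\<close>;
  everything else is completed by \<open>tri\<close>. The numbers of blocks add up exactly to that
  of a system, and the trades are those of the coloured blocks on copies 0 and 1.\<close>

lemma quadruple:
  assumes k: "k > 0" and r: "rich (2 * k + 2) 0"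
  shows "\<exists>\<tau>. rich (8 * k + 2) \<tau> \<and> (2 * k) ^ 4 \<le> 4096 * \<tau>"
proof -
  obtain B0 where B0: "is_SQS {0..<2 * k + 2} B0" using r by (auto simp: rich_def)
  obtain \<phi> \<tau> where \<phi>: "one_factorization (2 * k) \<phi>" "many \<tau> (colour_trades (2 * k) (2 * k - 1) \<phi>)"
    "(2 * k) ^ 4 \<le> 4096 * \<tau>" using rich_one_factorization[of "2 * k"] k by auto
  have col: "colouring (2 * k) (2 * k - 1) \<phi>" and \<phi>lt: "\<And>x y. x < 2 * k \<Longrightarrow> y < 2 * k \<Longrightarrow> x \<noteq> y \<Longrightarrow> \<phi> x y < 2 * k - 1"
    using \<phi>(1) by (auto simp: one_factorization_def)
  define emb where "emb i x = (if x < 2 * k then (i, x) else (4, x - 2 * k))" for i x :: nat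
  define BF where "BF i = (`) (emb i) ` B0" for i
  define Q where "Q = quads22 0 1 (2 * k) (2 * k - 1) \<phi> \<union> quads22 2 3 (2 * k) (2 * k - 1) \<phi>"
  define B where "B = (\<Union>i\<in>{..<4}. BF i) \<union> Q \<union> (\<Union>f\<in>fam. blocksT k f) \<union> (\<Union>f\<in>fam. blocksI k f)"
  define Y :: "(nat \<times> nat) set" where "Y = {..<4} \<times> {..<2 * k} \<union> {4} \<times> {..<2::nat}"
  have finY: "finite Y" by (simp add: Y_def)
  have cY: "card Y = 8 * k + 2"
    unfolding Y_def by (subst card_Un_disjoint) (auto simp: card_cartesian_product)
  have emb_inj: "inj_on (emb i) {0..<2 * k + 2}" if "i < 4" for i using that by (auto simp: inj_on_def emb_def split: if_splits)
  have emb_Y: "emb i ` {0..<2 * k + 2} \<subseteq> Y" if "i < 4" for i using that by (auto simp: emb_def Y_def)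
  have TI: "{(i, a), (j, b), (l, c), (l, c')} \<in> B"
    if "(i, j, l, e) \<in> fam" "a < 2 * k" "b < 2 * k" "c < 2 * k" "c' < 2 * k" "c \<noteq> c'" "tri k e a b c c'" for i j l e a b c c'
  proof -
    have "{(i, a), (j, b), (l, c), (l, c')} \<in> blocksT k (i, j, l, e)" unfolding blocksT_def using that by auto
    then show ?thesis using that(1) by (auto simp: B_def)
  qed
  have II: "{(i, a), (j, b), (l, c), (4, label k i a c)} \<in> B"
    if "(i, j, l, e) \<in> fam" "a < 2 * k" "b < 2 * k" "c < 2 * k" "tri k e a b c c" for i j l e a b c
  proof -
    have "{(i, a), (j, b), (l, c), (4, label k i a c)} \<in> blocksI k (i, j, l, e)" unfolding blocksI_def using that by auto
    then show ?thesis using that(1) by (auto simp: B_def)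
  qed
  have S: "is_SQS Y B"
  proof (rule is_SQS_I[OF finY])
    fix b assume "b \<in> B"
    then consider (F) i where "i < 4" "b \<in> BF i" | (Q) "b \<in> Q" | (T) f where "f \<in> fam" "b \<in> blocksT k f"
      | (I) f where "f \<in> fam" "b \<in> blocksI k f" by (auto simp: B_def)
    then show "b \<subseteq> Y \<and> card b = 4"
    proof cases
      case F
      then obtain c where c: "c \<in> B0" "b = emb i ` c" by (auto simp: BF_def)
      have "c \<subseteq> {0..<2 * k + 2}" "card c = 4" using is_SQS_blockD[OF B0 c(1)] by auto
      then show ?thesis using c emb_Y[OF F(1)] card_image[OF inj_on_subset[OF emb_inj[OF F(1)]]] by auto
    next
      case Q
      have "{0, 1} \<times> {..<2 * k} \<subseteq> Y" "{2, 3} \<times> {..<2 * k} \<subseteq> Y" by (auto simp: Y_def)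
      then show ?thesis using Q quads22_blockD[of b 0 1 "2 * k" "2 * k - 1" \<phi>] quads22_blockD[of b 2 3 "2 * k" "2 * k - 1" \<phi>]
        unfolding Q_def by (elim UnE) auto
    next
      case T
      then show ?thesis by (auto simp: fam_def blocksT_def Y_def)
    next
      case I
      then show ?thesis by (auto simp: fam_def blocksI_def Y_def label_def)
    qed
  next
    have sorted: "\<exists>b\<in>B. P \<in> b \<and> Q' \<in> b \<and> R \<in> b" if PY: "P \<in> Y" "Q' \<in> Y" "R \<in> Y"
      and ne: "P \<noteq> Q'" "P \<noteq> R" "Q' \<noteq> R" and le: "fst P \<le> fst Q'" "fst Q' \<le> fst R" for P Q' R
    proof -
      obtain i a j b l c where pq: "P = (i, a)" "Q' = (j, b)" "R = (l, c)" by (cases P, cases Q', cases R)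
      have Yd: "x < 2 * k" if "(m, x) \<in> Y" "m < 4" for m x using that by (auto simp: Y_def)
      have Y4: "x < 2" if "(4, x) \<in> Y" for x using that by (auto simp: Y_def)
      have le4: "m \<le> 4" if "(m, x) \<in> Y" for m x using that by (auto simp: Y_def)
      have ij: "i \<le> j" "j \<le> l" "l \<le> 4" using le pq le4 PY by auto
      \<comment> \<open>In each copy of \<open>B0\<close> the last two points are the points at
        infinity, which are common to all four.\<close>
      have fill: ?thesis if i4: "i < 4" and h: "j = i \<or> j = 4" "l = i \<or> l = 4"
      proof -
        define h where "h m x = (if m = i then x else 2 * k + x)" for m x :: nat
        have hh: "emb i (h m x) = (m, x)" "h m x < 2 * k + 2" if "(m, x) \<in> Y" "m = i \<or> m = 4" for m x
          using that Yd[OF that(1)] Y4 i4 by (auto simp: h_def emb_def)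
        have e: "emb i (h i a) = P" "emb i (h j b) = Q'" "emb i (h l c) = R" "h i a < 2 * k + 2" "h j b < 2 * k + 2" "h l c < 2 * k + 2"
          using hh PY h pq by auto
        then have d: "h i a \<noteq> h j b" "h i a \<noteq> h l c" "h j b \<noteq> h l c" using ne by auto
        obtain w where w: "{h i a, h j b, h l c, w} \<in> B0" by (rule is_SQS_ex[OF B0, of "h i a" "h j b" "h l c"]) (use e d in auto)
        then have "emb i ` {h i a, h j b, h l c, w} \<in> B" using i4 unfolding B_def BF_def by blast
        then show ?thesis by (rule bexI[rotated]) (use e in simp)
      qed
      have special: "\<exists>B'\<in>B. (m, x) \<in> B' \<and> (l, y) \<in> B' \<and> (l, y') \<in> B'"
        if f: "(i, j, l, e) \<in> fam" "m = i \<or> m = j" and lt: "x < 2 * k" "y < 2 * k" "y' < 2 * k" "y \<noteq> y'" for i j l e m x y y'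
      proof -
        let ?z = "third k e x y y'"
        have z: "?z < 2 * k" "tri k e x ?z y y'" "tri k e ?z x y y'"
          using third_less(1)[OF k] tri_third[OF k] tri_commute(1) by auto
        show ?thesis
        proof (cases "m = i")
          case True
          have "{(i, x), (j, ?z), (l, y), (l, y')} \<in> B" by (rule TI[OF f(1) lt(1) z(1) lt(2,3,4) z(2)])
          then show ?thesis by (rule bexI[rotated]) (use True in simp)
        next
          case False
          have "{(i, ?z), (j, x), (l, y), (l, y')} \<in> B" by (rule TI[OF f(1) z(1) lt(1) lt(2,3,4) z(3)])
          then show ?thesis by (rule bexI[rotated]) (use False f(2) in simp)
        qed
      qed
      have trans: "\<exists>B'\<in>B. (i, x) \<in> B' \<and> (j, y) \<in> B' \<and> (l, z) \<in> B'"
        if f: "(i, j, l, e) \<in> fam" and lt: "x < 2 * k" "y < 2 * k" "z < 2 * k" for i j l e x y z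
      proof -
        obtain z' where z': "z' < 2 * k" "tri k e x y z z'" using tri_fourth[OF k lt(3)] by blast
        show ?thesis
        proof (cases "z' = z")
          case True
          have "{(i, x), (j, y), (l, z), (4, label k i x z)} \<in> B" by (rule II[OF f lt]) (use z' True in simp)
          then show ?thesis by (rule bexI[rotated]) simp
        next
          case False
          have "{(i, x), (j, y), (l, z), (l, z')} \<in> B" by (rule TI[OF f lt z'(1) _ z'(2)]) (use False in simp)
          then show ?thesis by (rule bexI[rotated]) simp
        qed
      qed
      have dv: "x div k = 0 \<or> x div k = 1" if "x < 2 * k" for x
        using less_mult_imp_div_less[of x 2 k] that by linarith
      have infpair: "\<exists>B'\<in>B. (i, x) \<in> B' \<and> (j, y) \<in> B' \<and> (4, t) \<in> B'"
        if f: "(i, j, l, e) \<in> fam" and lt: "x < 2 * k" "y < 2 * k" "t < 2" and par: "(x div k + y div k + e) mod 2 = 0" for i j l e x y t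
      proof -
        define z0 where "z0 = neg k (x + y)"
        have z0: "z0 < k" "k dvd x + y + z0" using neg_props[OF k] by (auto simp: z0_def)
        \<comment> \<open>The two solutions of the diagonal equation differ by \<open>k\<close>; the
          one with the desired label is taken.\<close>
        define z where "z = (if label k i x z0 = t then z0 else z0 + k)"
        have z: "z < 2 * k" "z mod k = z0 mod k" using z0 by (auto simp: z_def)
        have "(z0 + z0) mod (2 * k) = 2 * z0" using z0 by simp
        then have "tri k e x y z0 z0" using z0 par by (simp add: tri_def)
        then have t1: "tri k e x y z z" by (rule tri_diag_shift) (use z in simp)
        have "z0 div k = 0" "(z0 + k) div k = 1" using z0 k by auto
        moreover have "(y + 1 + w) mod 2 = t" if "(y + 0 + w) mod 2 \<noteq> t" for y w using that lt(3) by presburger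
        ultimately have "label k i x z = t" unfolding z_def label_def by (auto split: if_splits)
        then show ?thesis using II[OF f lt(1,2) z(1) t1] by (intro bexI[of _ "{(i, x), (j, y), (l, z), (4, label k i x z)}"]) auto
      qed
      have infspec: "\<exists>B'\<in>B. (m, x) \<in> B' \<and> (l, z) \<in> B' \<and> (4, t) \<in> B'"
        if f: "(i, j, l, e) \<in> fam" and lt: "x < 2 * k" "z < 2 * k"
          and t: "m = i \<and> t = label k i x z \<or> m = j \<and> t = (x div k + e + z div k + i div 2) mod 2" for i j l e m x z t
      proof -
        let ?y = "third k e x z z"
        have y: "?y < 2 * k" "tri k e x ?y z z" "tri k e ?y x z z"
          using third_less(1)[OF k] tri_third[OF k] tri_commute(1) by auto
        have "(z + z) mod (2 * k) = 2 * (z mod k)" by (simp add: mult_2[symmetric])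
        moreover have "(2 * y + x + e) mod 2 = (x + e) mod 2" for x y :: nat by presburger
        ultimately have yd: "?y div k = (x div k + e) mod 2" unfolding third_less(2)[OF k] by simp
        show ?thesis
        proof (cases "m = i \<and> t = label k i x z")
          case True
          then show ?thesis using II[OF f lt(1) y(1) lt(2) y(2)]
            by (intro bexI[of _ "{(i, x), (j, ?y), (l, z), (4, label k i x z)}"]) auto
        next
          case False
          then have m: "m = j" "t = (x div k + e + z div k + i div 2) mod 2" using t by auto
          have "((x + e) mod 2 + y + w) mod 2 = (x + e + y + w) mod 2" for x y w :: nat by (simp add: mod_simps add.assoc)
          then have "label k i ?y z = t" unfolding label_def yd m(2) .
          then show ?thesis using II[OF f y(1) lt(1) lt(2) y(3)] m
            by (intro bexI[of _ "{(i, ?y), (j, x), (l, z), (4, label k i ?y z)}"]) auto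
        qed
      qed
      have par: "(c = (x + y) mod 2 \<or> c = (y + x + 1) mod 2) \<and> (c = (x + y) mod 2 \<or> c = Suc (y + x) mod 2) \<and>
        (c = Suc (x + y) mod 2 \<or> c = (y + x) mod 2) \<and> (c = (x + 1 + y) mod 2 \<or> c = (y + 1 + x + 1) mod 2)" 
        if "c < 2" "x = 0 \<or> x = 1" "y = 0 \<or> y = 1" for c x y :: nat
      proof -
        have "c = 0 \<or> c = 1" using that(1) by linarith
        then show ?thesis using that(2,3) by (elim disjE) simp_all
      qed
      have fm: "(0, 1, 2, 0) \<in> fam" "(0, 1, 3, 1) \<in> fam" "(2, 3, 0, 0) \<in> fam" "(2, 3, 1, 1) \<in> fam" by (auto simp: fam_def)
      have Qs: "Q \<subseteq> B" by (auto simp: B_def)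
      have pairs: "\<exists>B'\<in>B. (m, x) \<in> B' \<and> (m, x') \<in> B' \<and> (m', y) \<in> B'"
        if "(m, m') \<in> {(0, 1), (1, 0), (2, 3), (3, 2)}" "x < 2 * k" "x' < 2 * k" "x \<noteq> x'" "y < 2 * k" for m m' x x' y
      proof -
        note q = quads22_cover[OF col that(2,3,4) \<phi>lt[OF that(2,3,4)] that(5)]
        have "\<exists>B'\<in>Q. (m, x) \<in> B' \<and> (m, x') \<in> B' \<and> (m', y) \<in> B'"
          using that(1) q(1)[of 0 1] q(2)[of 0 1] q(1)[of 2 3] q(2)[of 2 3] q(2)[of 1 0] q(2)[of 3 2]
          unfolding Q_def by auto
        then show ?thesis using Qs by blast
      qed
      show ?thesis
      proof (cases "l = 4")
        case l4: True
        have c2: "c < 2" using Y4 PY pq l4 by simp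
        show ?thesis
        proof (cases "i = j \<or> j = 4")
          case True
          have "i < 4"
          proof (rule ccontr)
            assume "\<not> i < 4"
            then have "i = 4" "j = 4" using ij by auto
            then have "a < 2" "b < 2" using Y4 PY pq by auto
            then show False using c2 ne pq l4 \<open>i = 4\<close> \<open>j = 4\<close> by auto
          qed
          then show ?thesis using fill True l4 by auto
        next
          case False
          then have j4: "j < 4" "i < j" using ij by auto
          have lt: "a < 2 * k" "b < 2 * k" using Yd PY pq j4 by auto
          have ev: "(a div k + b div k + 0) mod 2 = 0 \<or> (a div k + b div k + 1) mod 2 = 0"
            using dv[OF lt(1)] dv[OF lt(2)] by (elim disjE) simp_all
          from \<open>i < j\<close> \<open>j < 4\<close> show ?thesis
          proof (cases rule: less_four_cases)
            case 1
            have "\<exists>B'\<in>B. (0, a) \<in> B' \<and> (1, b) \<in> B' \<and> (4, c) \<in> B'"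
              using infpair[OF fm(1) lt c2] infpair[OF fm(2) lt c2] ev by (elim disjE)
            then show ?thesis unfolding pq l4 1 .
          next
            case 2
            have "\<exists>B'\<in>B. (2, a) \<in> B' \<and> (3, b) \<in> B' \<and> (4, c) \<in> B'"
              using infpair[OF fm(3) lt c2] infpair[OF fm(4) lt c2] ev by (elim disjE)
            then show ?thesis unfolding pq l4 2 .
          next
            case 3
            have "c = label k 0 a b \<or> c = label k 2 b a" using par[OF c2 dv[OF lt(1)] dv[OF lt(2)]] by (simp add: label_def)
            then show ?thesis using infspec[OF fm(1) lt, of 0 c] infspec[OF fm(3) lt(2,1), of 2 c] 3 pq l4 by auto
          next
            case 4
            have "c = label k 0 a b \<or> c = (b div k + 0 + a div k + 2 div 2) mod 2" using par[OF c2 dv[OF lt(1)] dv[OF lt(2)]] by (simp add: label_def)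
            then show ?thesis using infspec[OF fm(2) lt, of 0 c] infspec[OF fm(3) lt(2,1), of 3 c] 4 pq l4 by auto
          next
            case 5
            have "c = (a div k + 0 + b div k + 0 div 2) mod 2 \<or> c = label k 2 b a" using par[OF c2 dv[OF lt(1)] dv[OF lt(2)]] by (simp add: label_def)
            then show ?thesis using infspec[OF fm(1) lt, of 1 c] infspec[OF fm(4) lt(2,1), of 2 c] 5 pq l4 by auto
          next
            case 6
            have "c = (a div k + 1 + b div k + 0 div 2) mod 2 \<or> c = (b div k + 1 + a div k + 2 div 2) mod 2"
              using par[OF c2 dv[OF lt(1)] dv[OF lt(2)]] by (simp add: add.commute)
            then show ?thesis using infspec[OF fm(2) lt, of 1 c] infspec[OF fm(4) lt(2,1), of 3 c] 6 pq l4 by auto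
          qed
        qed
      next
        case False
        then have l4: "l < 4" using ij by simp
        have lt: "a < 2 * k" "b < 2 * k" "c < 2 * k" using Yd PY pq l4 ij by auto
        consider (all) "i = j" "j = l" | (left) "i = j" "j < l" | (right) "i < j" "j = l" | (three) "i < j" "j < l" using ij by linarith
        then show ?thesis
        proof cases
          case all
          then show ?thesis using fill l4 by auto
        next
          case left
          then have ab: "a \<noteq> b" using ne pq by auto
          consider "i = 0" "l = 1" | "i = 2" "l = 3" | "i = 0" "l = 2" | "i = 0" "l = 3" | "i = 1" "l = 2" | "i = 1" "l = 3"
            by (rule less_four_cases[of i l]) (use left l4 in auto)
          then show ?thesis
            using pairs[of i l a b c] special[OF fm(3), of l c a b] special[OF fm(4), of l c a b] left lt ab pq
            by cases auto
        next
          case right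
          then have bc: "b \<noteq> c" using ne pq by auto
          consider "i = 0" "l = 1" | "i = 2" "l = 3" | "i = 0" "l = 2" | "i = 0" "l = 3" | "i = 1" "l = 2" | "i = 1" "l = 3"
            by (rule less_four_cases[of i l]) (use right l4 in auto)
          then show ?thesis
            using pairs[of l i b c a] special[OF fm(1), of i a b c] special[OF fm(2), of i a b c] right lt bc pq
            by cases auto
        next
          case three
          consider "i = 0" "j = 1" "l = 2" | "i = 0" "j = 1" "l = 3" | "i = 0" "j = 2" "l = 3" | "i = 1" "j = 2" "l = 3"
            using three l4 by linarith
          then show ?thesis
            using trans[OF fm(1) lt] trans[OF fm(2) lt] trans[OF fm(3) lt(2,3,1)] trans[OF fm(4) lt(2,3,1)] pq
            by cases auto
        qed
      qed
    qed
    fix P Q' R assume "P \<in> Y" "Q' \<in> Y" "R \<in> Y" "P \<noteq> Q'" "P \<noteq> R" "Q' \<noteq> R"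
    then show "\<exists>b\<in>B. P \<in> b \<and> Q' \<in> b \<and> R \<in> b" by (rule cover_wlog[rotated]) (rule sorted)
  next
    have finB0: "finite B0" using finite_blocks[OF _ is_SQS_blockD[OF B0]] by simp
    have cF: "24 * card (\<Union>i\<in>{..<4::nat}. BF i) \<le> 4 * ((2 * k + 2) * (2 * k + 1) * (2 * k))"
    proof -
      have "card (\<Union>i\<in>{..<4::nat}. BF i) \<le> (\<Sum>i<4::nat. card (BF i))" by (rule card_UN_le) simp
      also have "\<dots> \<le> (\<Sum>i<4::nat. card B0)" by (rule sum_mono) (simp add: BF_def card_image_le[OF finB0])
      finally show ?thesis using is_SQS_card[OF _ B0] by simp
    qed
    have cQ: "4 * card Q \<le> 2 * ((2 * k - 1) * (2 * k) ^ 2)"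
      using card_Un_le[of "quads22 0 1 (2 * k) (2 * k - 1) \<phi>" "quads22 2 3 (2 * k) (2 * k - 1) \<phi>"]
        card_quads22(1)[OF col, of 0 1] card_quads22(1)[OF col, of 2 3] unfolding Q_def by linarith
    have finf: "finite fam" and cf: "card fam = 4" by (auto simp: fam_def)
    have cT: "card (\<Union>f\<in>fam. blocksT k f) \<le> 4 * (2 * k * (k * (2 * k - 1)))"
    proof -
      have "card (\<Union>f\<in>fam. blocksT k f) \<le> (\<Sum>f\<in>fam. card (blocksT k f))" by (rule card_UN_le[OF finf])
      also have "\<dots> \<le> (\<Sum>f\<in>fam. 2 * k * (k * (2 * k - 1)))" by (rule sum_mono) (rule card_blocksT[OF k])
      finally show ?thesis by (simp add: cf)
    qed
    have cI: "card (\<Union>f\<in>fam. blocksI k f) \<le> 4 * (4 * k * k)"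
    proof -
      have "card (\<Union>f\<in>fam. blocksI k f) \<le> (\<Sum>f\<in>fam. card (blocksI k f))" by (rule card_UN_le[OF finf])
      also have "\<dots> \<le> (\<Sum>f\<in>fam. 4 * k * k)" by (rule sum_mono) (rule card_blocksI[OF k])
      finally show ?thesis by (simp add: cf)
    qed
    have "card B \<le> card (\<Union>i\<in>{..<4::nat}. BF i) + card Q + card (\<Union>f\<in>fam. blocksT k f) + card (\<Union>f\<in>fam. blocksI k f)"
      unfolding B_def by (intro order_trans[OF card_Un_le] add_mono order_refl)
    then have "24 * card B \<le> 4 * ((2 * k + 2) * (2 * k + 1) * (2 * k)) + 6 * (2 * ((2 * k - 1) * (2 * k) ^ 2))
      + 24 * (4 * (2 * k * (k * (2 * k - 1)))) + 24 * (4 * (4 * k * k))"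
      using cF cQ cT cI by linarith
    also obtain h where h: "k = Suc h" using k by (cases k) auto
    then have "4 * ((2 * k + 2) * (2 * k + 1) * (2 * k)) + 6 * (2 * ((2 * k - 1) * (2 * k) ^ 2))
      + 24 * (4 * (2 * k * (k * (2 * k - 1)))) + 24 * (4 * (4 * k * k)) = (8 * k + 2) * (8 * k + 1) * (8 * k)"
      by (simp add: h power2_eq_square algebra_simps)
    finally show "24 * card B \<le> card Y * (card Y - 1) * (card Y - 2)" by (simp add: cY)
  qed
  have "quads22 0 1 (2 * k) (2 * k - 1) \<phi> \<subseteq> B" by (auto simp: B_def Q_def)
  from many_quad_trades[OF \<phi>(2) this, of "(4, 0)"]
  obtain F :: "nat \<Rightarrow> (nat \<times> nat) quad_fun" where F: "inj_on F {..<\<tau>}" "F ` {..<\<tau>} \<subseteq> avoiding_trades B (4, 0)" by auto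
  have "rich (8 * k + 2) \<tau>"
    by (rule richI[OF finY cY S _ F]) (auto simp: Y_def)
  then show ?thesis using \<phi>(3) by blast
qed

subsection \<open>Factorizations of circulant graphs\<close>

text \<open>Edges selected by \<open>P\<close> are coloured by \<open>A\<close>. All other edges have an odd difference \<open>d\<close> and are coloured by \<open>C d\<close>,
  except that the differences below \<open>2 r\<close> get no valid colour.\<close>

definition odd_diff :: "nat \<Rightarrow> nat \<Rightarrow> nat \<Rightarrow> nat" where
  "odd_diff g x y = (if even x then dm g y x else dm g x y)"

definition circ :: "nat \<Rightarrow> nat \<Rightarrow> (nat \<Rightarrow> nat \<Rightarrow> bool) \<Rightarrow> (nat \<Rightarrow> nat \<Rightarrow> nat) \<Rightarrow> (nat \<Rightarrow> nat) \<Rightarrow> nat \<Rightarrow> nat \<Rightarrow> nat" where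
  "circ g r P A C x y = (if P x y then A x y
     else if odd_diff g x y < 2 * r \<or> g < odd_diff g x y + 2 * r then g - 1 - 2 * r else C (odd_diff g x y))"

text \<open>\<open>odd_diff\<close> is measured from the even to the odd endpoint, hence it does not
  depend on the order of the endpoints and each of its values is a perfect matching. The lemma asks
  only that every colour occur at every vertex; uniqueness follows from the number of validly
  coloured neighbours.\<close>

lemma circ_colouring:
  assumes g: "even g" "4 * r < g" and a: "a \<le> g - 1 - 2 * r"
    and P: "\<And>x y. P x y \<longleftrightarrow> P y x" "\<And>x y. \<lbrakk>x < g; y < g; x \<noteq> y; \<not> P x y\<rbrakk> \<Longrightarrow> even x \<noteq> even y"
      "\<And>x d. \<lbrakk>x < g; odd d; d < 2 * r\<rbrakk> \<Longrightarrow> \<not> P x (am g x d)"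
    and A: "\<And>x y. P x y \<Longrightarrow> A x y = A y x" "\<And>x y. \<lbrakk>x < g; y < g; x \<noteq> y; P x y\<rbrakk> \<Longrightarrow> A x y < g - 1 - 2 * r"
    and low: "\<And>x c. \<lbrakk>x < g; c < a\<rbrakk> \<Longrightarrow> \<exists>y<g. y \<noteq> x \<and> P x y \<and> A x y = c"
    and high: "\<And>c. \<lbrakk>a \<le> c; c < g - 1 - 2 * r\<rbrakk> \<Longrightarrow>
      \<exists>\<delta>. odd \<delta> \<and> 2 * r < \<delta> \<and> \<delta> + 2 * r < g \<and> C \<delta> = c \<and> (\<forall>x<g. \<not> P x (am g x \<delta>))"
    and C: "\<And>x y. \<lbrakk>x < g; y < g; x \<noteq> y; \<not> P x y; 2 * r < odd_diff g x y; odd_diff g x y + 2 * r < g\<rbrakk> \<Longrightarrow> C (odd_diff g x y) < g - 1 - 2 * r"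
  shows "colouring g (g - 1 - 2 * r) (circ g r P A C)"
    and "\<And>x y. \<lbrakk>x < g; y < g; x \<noteq> y; \<not> circ g r P A C x y < g - 1 - 2 * r\<rbrakk> \<Longrightarrow> \<exists>d. odd d \<and> d < 2 * r \<and> (am g x d = y \<or> am g y d = x)"
proof -
  let ?m = "g - 1 - 2 * r" and ?\<phi> = "circ g r P A C"
  have od: "odd_diff g x y = odd_diff g y x" if "x < g" "y < g" "even x \<noteq> even y" for x y
    using that by (auto simp: odd_diff_def)
  have odo: "odd (odd_diff g x y)" if "x < g" "y < g" "even x \<noteq> even y" for x y
    using that g(1) by (auto simp: odd_diff_def dm_def)
  have sym: "?\<phi> x y = ?\<phi> y x" if "x < g" "y < g" for x y
  proof (cases "x = y \<or> P x y")
    case True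
    then show ?thesis using P(1)[of x y] A(1)[of x y] by (auto simp: circ_def)
  next
    case False
    then have "odd_diff g x y = odd_diff g y x" using od P(2) that by blast
    then show ?thesis using False P(1)[of x y] by (simp add: circ_def)
  qed
  have amp: "am g x d < g" "am g x d \<noteq> x" "even (am g x d) \<longleftrightarrow> odd x" "dm g (am g x d) x = d" "dm g x d < g" "am g (dm g x d) d = x" "dm g x d \<noteq> x" "even (dm g x d) \<longleftrightarrow> odd x" "dm g x (dm g x d) = d"
    if "x < g" "odd d" "d < g" for x d
  proof -
    have "d \<noteq> 0" using that(2) by (cases d) auto
    then show "am g x d < g" "am g x d \<noteq> x" "dm g (am g x d) x = d" "dm g x d < g" "am g (dm g x d) d = x" "dm g x d \<noteq> x" "dm g x (dm g x d) = d"
      using that by (auto simp: am_def dm_def)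
    show "even (am g x d) \<longleftrightarrow> odd x" "even (dm g x d) \<longleftrightarrow> odd x"
      using that g(1) by (auto simp: am_def dm_def)
  qed
  have dd: "am g x (dm g y x) = y" "x \<noteq> y \<Longrightarrow> am g y (g - dm g y x) = x" if "x < g" "y < g" for x y
    using that by (cases "x \<le> y"; simp add: am_def dm_def)+
  have gd: "dm g x (am g x d) = g - d" "dm g (dm g x d) x = g - d" if "x < g" "0 < d" "d < g" for x d
    using that by (auto simp: am_def dm_def)
  show far: "\<exists>d. odd d \<and> d < 2 * r \<and> (am g x d = y \<or> am g y d = x)"
    if xy: "x < g" "y < g" "x \<noteq> y" "\<not> ?\<phi> x y < ?m" for x y
  proof -
    have nP: "\<not> P x y" using xy A(2)[of x y] by (auto simp: circ_def)
    then have par: "even x \<noteq> even y" using P(2) xy by blast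
    let ?d = "odd_diff g x y"
    have o: "odd ?d" using odo xy par by blast
    have dl: "?d < g" using xy by (auto simp: odd_diff_def dm_def)
    have "?d < 2 * r \<or> g < ?d + 2 * r"
    proof (rule ccontr)
      assume n: "\<not> ?thesis"
      then have "2 * r < ?d" "?d + 2 * r < g" using o g(1) by presburger+
      then show False using C[OF xy(1-3) nP] xy(4) nP n by (simp add: circ_def)
    qed
    moreover have e: "am g x ?d = y \<or> am g y ?d = x" "am g x (g - ?d) = y \<or> am g y (g - ?d) = x"
      using dd(1,2)[of x y] dd(1,2)[of y x] xy by (cases "even x"; simp add: odd_diff_def)+
    moreover have "odd (g - ?d)" using o g(1) dl by simp
    moreover have "g - ?d < 2 * r" if "g < ?d + 2 * r" using that dl by linarith
    ultimately show ?thesis using o by metis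
  qed
  have ex: "\<exists>y<g. y \<noteq> x \<and> ?\<phi> x y = c" if x: "x < g" and c: "c < ?m" for x c
  proof (cases "c < a")
    case True
    then show ?thesis using low[OF x True] by (auto simp: circ_def)
  next
    case False
    then obtain \<delta> where d: "odd \<delta>" "2 * r < \<delta>" "\<delta> + 2 * r < g" "C \<delta> = c" "\<forall>x<g. \<not> P x (am g x \<delta>)" using high[of c] c by auto
    have dg: "\<delta> < g" using d by simp
    show ?thesis
    proof (cases "even x")
      case True
      have "\<not> P x (am g x \<delta>)" using d(5) x by blast
      moreover have "odd_diff g x (am g x \<delta>) = \<delta>" using amp(4)[OF x d(1) dg] True by (simp add: odd_diff_def)
      ultimately have "?\<phi> x (am g x \<delta>) = c" using d by (simp add: circ_def)
      then show ?thesis using amp(1,2)[OF x d(1) dg] by blast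
    next
      case False
      let ?y = "dm g x \<delta>"
      have "\<not> P ?y (am g ?y \<delta>)" using d(5) amp(5)[OF x d(1) dg] by blast
      then have "\<not> P x ?y" using amp(6)[OF x d(1) dg] P(1) by simp
      moreover have "odd_diff g x ?y = \<delta>" using amp(9)[OF x d(1) dg] False by (simp add: odd_diff_def)
      ultimately have "?\<phi> x ?y = c" using d by (simp add: circ_def)
      then show ?thesis using amp(5,7)[OF x d(1) dg] by blast
    qed
  qed
  have ex1: "\<exists>!y. y < g \<and> y \<noteq> x \<and> ?\<phi> x y = c" if x: "x < g" and c: "c < ?m" for x c
  proof -
    \<comment> \<open>The neighbours at the excluded distances. They number \<open>2 * r\<close>,
      distinct because \<open>4 * r < g\<close>, so at most \<open>g - 1 - 2 * r\<close> neighbours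
      carry valid colours, as many as there are colours.\<close>
    define N where "N = (\<lambda>v. am g x (2 * v + 1)) ` {..<r} \<union> (\<lambda>v. dm g x (2 * v + 1)) ` {..<r}"
    have bound: "2 * v + 1 < g" if "v < r" for v using that g by linarith
    have cN: "card N = 2 * r"
    proof -
      have 1: "card ((\<lambda>v. am g x (2 * v + 1)) ` {..<r}) = r"
      proof (subst card_image)
        show "inj_on (\<lambda>v. am g x (2 * v + 1)) {..<r}"
        proof (rule inj_onI)
          fix v w assume "v \<in> {..<r}" "w \<in> {..<r}" "am g x (2 * v + 1) = am g x (2 * w + 1)"
          then have "2 * v + 1 = 2 * w + 1" using am_cancel(1)[OF x bound[of v] bound[of w]] by simp
          then show "v = w" by simp
        qed
      qed simp
      have 2: "card ((\<lambda>v. dm g x (2 * v + 1)) ` {..<r}) = r"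
      proof (subst card_image)
        show "inj_on (\<lambda>v. dm g x (2 * v + 1)) {..<r}"
        proof (rule inj_onI)
          fix v w assume vw: "v \<in> {..<r}" "w \<in> {..<r}" "dm g x (2 * v + 1) = dm g x (2 * w + 1)"
          then have "2 * v + 1 = 2 * w + 1" using am_dm(4)[OF x bound[of v]] am_dm(4)[OF x bound[of w]] by simp
          then show "v = w" by simp
        qed
      qed simp
      have "(\<lambda>v. am g x (2 * v + 1)) ` {..<r} \<inter> (\<lambda>v. dm g x (2 * v + 1)) ` {..<r} = {}"
        using x g by (auto simp: am_def dm_def split: if_splits)
      then show ?thesis unfolding N_def by (subst card_Un_disjoint) (use 1 2 in auto)
    qed
    have NH: "y < g" "y \<noteq> x" "\<not> ?\<phi> x y < ?m" if "y \<in> N" for y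
    proof -
      obtain v where v: "v < r" "y = am g x (2 * v + 1) \<or> y = dm g x (2 * v + 1)" using \<open>y \<in> N\<close> by (auto simp: N_def)
      let ?d = "2 * v + 1"
      have d: "odd ?d" "?d < g" "?d < 2 * r" using bound v by auto
      show y: "y < g" "y \<noteq> x" using v amp(1,2,5,7)[OF x d(1,2)] by auto
      have nP: "\<not> P x y"
      proof (cases "y = am g x ?d")
        case True
        then show ?thesis using P(3)[OF x d(1,3)] by simp
      next
        case False
        then have "y = dm g x ?d" using v by blast
        then show ?thesis using P(3)[OF y(1) d(1,3)] P(1)[of x y] amp(6)[OF x d(1,2)] by simp
      qed
      have "odd_diff g x y = ?d \<or> odd_diff g x y = g - ?d"
        using v(2) amp(4,9)[OF x d(1,2)] gd[OF x _ d(2)] by (cases "even x") (auto simp: odd_diff_def)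
      then have "odd_diff g x y < 2 * r \<or> g < odd_diff g x y + 2 * r" using d by linarith
      then show "\<not> ?\<phi> x y < ?m" using nP by (simp add: circ_def)
    qed
    let ?D = "{y. y < g \<and> y \<noteq> x \<and> ?\<phi> x y < ?m}"
    have "?D \<subseteq> ({..<g} - {x}) - N" using NH(3) by auto
    then have "card ?D \<le> card (({..<g} - {x}) - N)" by (intro card_mono) auto
    also have "\<dots> = ?m" using NH x cN by (subst card_Diff_subset) (auto simp: N_def)
    finally have cD: "card ?D \<le> ?m" .
    have img: "?\<phi> x ` ?D = {..<?m}"
    proof (intro equalityI subsetI)
      fix c assume "c \<in> {..<?m}"
      then obtain y where "y < g" "y \<noteq> x" "?\<phi> x y = c" using ex[OF x, of c] by auto
      then show "c \<in> ?\<phi> x ` ?D" using \<open>c \<in> {..<?m}\<close> by (intro image_eqI[of _ _ y]) auto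
    qed auto
    have "card (?\<phi> x ` ?D) = card ?D" using cD card_image_le[of ?D "?\<phi> x"] img by simp
    then have "inj_on (?\<phi> x) ?D" by (intro eq_card_imp_inj_on) auto
    then show ?thesis using ex[OF x c] c by (auto simp: inj_on_def)
  qed
  show "colouring g ?m ?\<phi>" unfolding colouring_def using sym ex1 by blast
qed

text \<open>The even and the odd vertices form two complete graphs of even order \<open>h\<close>,
  both coloured by \<open>\<psi>\<close> with \<open>h - 1\<close> colours; the remaining
  \<open>h - 2 * r\<close> odd differences are matchings. The last clause transports the trades of
  \<open>\<psi>\<close> to the even vertices.\<close>

lemma circulant_even_half:
  assumes h: "even h" "2 * r < h" and c: "one_factorization h \<psi>"
  shows "\<exists>\<phi>. colouring (2 * h) (2 * h - 1 - 2 * r) \<phi> \<and>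
    (\<forall>x y. x < 2 * h \<longrightarrow> y < 2 * h \<longrightarrow> x \<noteq> y \<longrightarrow> \<not> \<phi> x y < 2 * h - 1 - 2 * r \<longrightarrow>
      (\<exists>d. odd d \<and> d < 2 * r \<and> (am (2 * h) x d = y \<or> am (2 * h) y d = x))) \<and>
    (\<forall>x<h. \<forall>y<h. x \<noteq> y \<longrightarrow> \<phi> (2 * x) (2 * y) = \<psi> x y)"
proof -
  define P where "P x y \<longleftrightarrow> even x = even y" for x y :: nat
  define A where "A x y = \<psi> (min x y div 2) (max x y div 2)" for x y :: nat
  define C where "C \<delta> = h - 1 + (\<delta> - 2 * r - 1) div 2" for \<delta> :: nat
  have ps: "\<psi> x y = \<psi> y x" if "x < h" "y < h" for x y using c that by (simp add: one_factorization_def colouring_def)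
  have plt: "\<psi> x y < h - 1" if "x < h" "y < h" "x \<noteq> y" for x y using c that by (simp add: one_factorization_def)
  have pex: "\<exists>y<h. y \<noteq> x \<and> \<psi> x y = d" if "x < h" "d < h - 1" for x d
    using c that unfolding one_factorization_def colouring_def by blast
  have Aeq: "A x y = \<psi> (x div 2) (y div 2)" if "x < 2 * h" "y < 2 * h" for x y
    using ps[of "x div 2" "y div 2"] that by (auto simp: A_def min_def max_def)
  have ne: "x div 2 \<noteq> y div 2" if "even x = even y" "x \<noteq> y" for x y :: nat using that by presburger
  note cc = circ_colouring[of "2 * h" r "h - 1" P A C]
  have prem: "colouring (2 * h) (2 * h - 1 - 2 * r) (circ (2 * h) r P A C) \<and>
    (\<forall>x y. x < 2 * h \<longrightarrow> y < 2 * h \<longrightarrow> x \<noteq> y \<longrightarrow> \<not> circ (2 * h) r P A C x y < 2 * h - 1 - 2 * r \<longrightarrow>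
      (\<exists>d. odd d \<and> d < 2 * r \<and> (am (2 * h) x d = y \<or> am (2 * h) y d = x)))"
  proof -
    have p1: "even (2 * h)" "4 * r < 2 * h" "h - 1 \<le> 2 * h - 1 - 2 * r" using h by auto
    have p2: "\<And>x y. P x y \<longleftrightarrow> P y x" "\<And>x y. \<lbrakk>x < 2 * h; y < 2 * h; x \<noteq> y; \<not> P x y\<rbrakk> \<Longrightarrow> even x \<noteq> even y" by (auto simp: P_def)
    have p3: "\<And>x d. \<lbrakk>x < 2 * h; odd d; d < 2 * r\<rbrakk> \<Longrightarrow> \<not> P x (am (2 * h) x d)" by (auto simp: P_def am_def)
    have p4: "\<And>x y. P x y \<Longrightarrow> A x y = A y x" by (simp add: A_def min.commute max.commute)
    have p5: "A x y < 2 * h - 1 - 2 * r" if "x < 2 * h" "y < 2 * h" "x \<noteq> y" "P x y" for x y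
    proof -
      have "x div 2 < h" "y div 2 < h" using that by auto
      from plt[OF this ne] that(3,4) have "A x y < h - 1" unfolding Aeq[OF that(1,2)] P_def by simp
      then show ?thesis using h(2) by linarith
    qed
    have p6: "\<exists>y<2 * h. y \<noteq> x \<and> P x y \<and> A x y = d" if x: "x < 2 * h" and d: "d < h - 1" for x d
    proof -
      have "x div 2 < h" using x by simp
      then obtain y where y: "y < h" "y \<noteq> x div 2" "\<psi> (x div 2) y = d" using pex d by blast
      let ?y = "2 * y + x mod 2"
      have f: "?y < 2 * h" "?y \<noteq> x" "?y div 2 = y" "even x = even ?y" using y by auto
      have "A x ?y = d" using Aeq[OF x f(1)] f(3) y(3) by simp
      moreover have "P x ?y" unfolding P_def by (rule f(4))
      ultimately show ?thesis using f(1,2) by (intro exI[of _ ?y] conjI)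
    qed
    have p7: "\<exists>\<delta>. odd \<delta> \<and> 2 * r < \<delta> \<and> \<delta> + 2 * r < 2 * h \<and> C \<delta> = d \<and> (\<forall>x<2 * h. \<not> P x (am (2 * h) x \<delta>))"
      if "h - 1 \<le> d" "d < 2 * h - 1 - 2 * r" for d
    proof -
      let ?\<delta> = "2 * (d - (h - 1)) + 2 * r + 1"
      have "?\<delta> + 2 * r < 2 * h" "C ?\<delta> = d" using that h by (auto simp: C_def)
      moreover have "\<not> P x (am (2 * h) x ?\<delta>)" if "x < 2 * h" for x using \<open>?\<delta> + 2 * r < 2 * h\<close> that by (auto simp: P_def am_def)
      ultimately show ?thesis by (intro exI[of _ ?\<delta>]) auto
    qed
    have p8: "C d < 2 * h - 1 - 2 * r" if "2 * r < d" "d + 2 * r < 2 * h" for d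
      using that h by (simp add: C_def)
    have "colouring (2 * h) (2 * h - 1 - 2 * r) (circ (2 * h) r P A C)"
      by (rule cc(1)) ((rule p1 p2 p3 p4 p5 p6 p7 p8; assumption)+)
    moreover have "\<exists>d. odd d \<and> d < 2 * r \<and> (am (2 * h) x d = y \<or> am (2 * h) y d = x)"
      if xy: "x < 2 * h" "y < 2 * h" "x \<noteq> y" "\<not> circ (2 * h) r P A C x y < 2 * h - 1 - 2 * r" for x y
      by (rule cc(2)) ((rule p1 p2 p3 p4 p5 p6 p7 p8 xy; assumption)+)
    ultimately show ?thesis by blast
  qed
  moreover have "circ (2 * h) r P A C (2 * x) (2 * y) = \<psi> x y" if "x < h" "y < h" "x \<noteq> y" for x y
    using Aeq[of "2 * x" "2 * y"] that by (simp add: circ_def P_def)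
  ultimately show ?thesis by blast
qed

text \<open>The parity classes now have odd order. The factorization of order \<open>h + 1\<close>
  is used on both, and the matching of difference \<open>h\<close>, which joins the classes,
  replaces the edges to the extra vertex. For this \<open>lb\<close> must give \<open>x\<close> and
  \<open>x + h\<close> the same label, and \<open>C\<close> has to skip the difference
  \<open>h\<close>.\<close>

lemma circulant_odd_half:
  assumes h: "odd h" "2 * r < h"
  shows "\<exists>\<phi>. colouring (2 * h) (2 * h - 1 - 2 * r) \<phi> \<and>
    (\<forall>x y. x < 2 * h \<longrightarrow> y < 2 * h \<longrightarrow> x \<noteq> y \<longrightarrow> \<not> \<phi> x y < 2 * h - 1 - 2 * r \<longrightarrow>
      (\<exists>d. odd d \<and> d < 2 * r \<and> (am (2 * h) x d = y \<or> am (2 * h) y d = x)))"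
proof -
  let ?g = "2 * h"
  define \<psi> where "\<psi> = cyc h"
  have c: "one_factorization (h + 1) \<psi>" unfolding \<psi>_def by (rule cyc_one_factorization[OF h(1)])
  have ps: "\<psi> x y = \<psi> y x" if "x \<le> h" "y \<le> h" for x y using c that by (simp add: one_factorization_def colouring_def)
  have plt: "\<psi> x y < h" if "x \<le> h" "y \<le> h" "x \<noteq> y" for x y using c that by (simp add: one_factorization_def)
  have pex: "\<exists>y\<le>h. y \<noteq> x \<and> \<psi> x y = d" if "x \<le> h" "d < h" for x d
  proof -
    have "\<exists>!y. y < h + 1 \<and> y \<noteq> x \<and> \<psi> x y = d" using c that by (simp add: one_factorization_def colouring_def)
    then show ?thesis by (elim ex1E) (auto simp: less_Suc_eq_le)
  qed
  define P where "P x y \<longleftrightarrow> even x = even y \<or> (x < ?g \<and> am ?g x h = y) \<or> (y < ?g \<and> am ?g y h = x)" for x y :: nat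
  define lb where "lb x = (if even x then x div 2 else am ?g x h div 2)" for x
  define A where "A x y = (if even x = even y then \<psi> (lb (min x y)) (lb (max x y)) else \<psi> (lb (min x y)) h)" for x y :: nat
  define C where "C \<delta> = h + (\<delta> - 2 * r - 1) div 2 - (if \<delta> < h then 0 else 1)" for \<delta> :: nat
  have amh: "am ?g (am ?g x h) h = x" "am ?g x h < ?g" "even (am ?g x h) \<longleftrightarrow> odd x" "am ?g x h \<noteq> x" if "x < ?g" for x
    using that h by (auto simp: am_def)
  have l: "lb x < h" if "x < ?g" for x using that amh(2)[OF that] by (auto simp: lb_def)
  have lh: "lb (am ?g x h) = lb x" if "x < ?g" for x using amh[OF that] by (auto simp: lb_def)
  have linj: "x = y" if "x < ?g" "y < ?g" "even x = even y" "lb x = lb y" for x y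
  proof (cases "even x")
    case True
    then show ?thesis using that by (auto simp: lb_def elim!: evenE)
  next
    case False
    then have "am ?g x h div 2 = am ?g y h div 2" "even (am ?g x h)" "even (am ?g y h)" using that amh(3) by (auto simp: lb_def)
    then have "am ?g x h = am ?g y h" by (auto elim!: evenE)
    then have "am ?g (am ?g x h) h = am ?g (am ?g y h) h" by (rule arg_cong)
    then show ?thesis unfolding amh(1)[OF that(1)] amh(1)[OF that(2)] .
  qed
  have lsurj: "\<exists>y<?g. even y = e \<and> lb y = z" if "z < h" for z e
  proof (cases e)
    case True
    then show ?thesis using that by (intro exI[of _ "2 * z"]) (auto simp: lb_def)
  next
    case False
    have "2 * z < ?g" using that by simp
    then show ?thesis using False amh[of "2 * z"] lh[of "2 * z"] by (intro exI[of _ "am ?g (2 * z) h"]) (auto simp: lb_def)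
  qed
  have Aeq: "A x y = \<psi> (lb x) (lb y)" if "x < ?g" "y < ?g" "even x = even y" for x y
    using ps[of "lb x" "lb y"] l[OF that(1)] l[OF that(2)] that by (auto simp: A_def min_def max_def)
  have Ah: "A x (am ?g x h) = \<psi> (lb x) h" "A (am ?g x h) x = \<psi> (lb x) h" if "x < ?g" for x
    using amh(3)[OF that] lh[OF that] by (auto simp: A_def min_def max_def)
  note cc = circ_colouring[of ?g r h P A C]
  have p1: "even ?g" "4 * r < ?g" "h \<le> ?g - 1 - 2 * r" using h by auto
  have p2: "\<And>x y. P x y \<longleftrightarrow> P y x" "\<And>x y. \<lbrakk>x < ?g; y < ?g; x \<noteq> y; \<not> P x y\<rbrakk> \<Longrightarrow> even x \<noteq> even y" by (auto simp: P_def)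
  have nP: "\<not> P x (am ?g x d)" if "x < ?g" "odd d" "d < ?g" "d \<noteq> h" for x d
  proof -
    have "even (am ?g x d) \<longleftrightarrow> odd x" using that by (auto simp: am_def)
    moreover have "am ?g x h \<noteq> am ?g x d" "am ?g (am ?g x d) h \<noteq> x" using that h by (auto simp: am_def split: if_splits)
    ultimately show ?thesis by (auto simp: P_def)
  qed
  have p3: "\<not> P x (am ?g x d)" if "x < ?g" "odd d" "d < 2 * r" for x d using nP[of x d] that h by simp
  have p4: "\<And>x y. P x y \<Longrightarrow> A x y = A y x" by (auto simp: A_def min.commute max.commute)
  have Pc: "even x = even y \<or> y = am ?g x h \<or> x = am ?g y h" if "P x y" for x y using that by (auto simp: P_def)
  have p5: "A x y < ?g - 1 - 2 * r" if xy: "x < ?g" "y < ?g" "x \<noteq> y" "P x y" for x y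
  proof -
    have hm: "h \<le> ?g - 1 - 2 * r" using p1 by simp
    have "A x y < h"
    proof (cases "even x = even y")
      case True
      then show ?thesis using Aeq[OF xy(1,2)] plt[of "lb x" "lb y"] linj[OF xy(1,2) True] l[OF xy(1)] l[OF xy(2)] xy(3) by auto
    next
      case False
      then consider "y = am ?g x h" | "x = am ?g y h" using Pc[OF xy(4)] by blast
      then show ?thesis using Ah[OF xy(1)] Ah[OF xy(2)] plt[of "lb x" h] plt[of "lb y" h] l[OF xy(1)] l[OF xy(2)] by cases auto
    qed
    then show ?thesis using hm by simp
  qed
  have p6: "\<exists>y<?g. y \<noteq> x \<and> P x y \<and> A x y = d" if x: "x < ?g" and d: "d < h" for x d
  proof -
    obtain z where z: "z \<le> h" "z \<noteq> lb x" "\<psi> (lb x) z = d" using pex[of "lb x" d] l[OF x] d by auto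
    show ?thesis
    proof (cases "z = h")
      case True
      then show ?thesis using amh[OF x] Ah(1)[OF x] z x by (intro exI[of _ "am ?g x h"]) (auto simp: P_def)
    next
      case False
      then obtain y where y: "y < ?g" "even y = even x" "lb y = z" using lsurj[of z "even x"] z by auto
      then show ?thesis using Aeq[OF x y(1)] z by (intro exI[of _ y]) (auto simp: P_def)
    qed
  qed
  have p7: "\<exists>\<delta>. odd \<delta> \<and> 2 * r < \<delta> \<and> \<delta> + 2 * r < ?g \<and> C \<delta> = d \<and> (\<forall>x<?g. \<not> P x (am ?g x \<delta>))"
    if d: "h \<le> d" "d < ?g - 1 - 2 * r" for d
  proof -
    \<comment> \<open>The odd differences above \<open>2 * r\<close> in order, with \<open>h\<close>
      skipped: from there on all are shifted by 2.\<close>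
    define \<delta> where "\<delta> = (if 2 * (d - h) + 2 * r + 1 < h then 2 * (d - h) + 2 * r + 1 else 2 * (d - h) + 2 * r + 3)"
    have o: "odd \<delta>" "2 * r < \<delta>" by (auto simp: \<delta>_def)
    moreover have "\<delta> + 2 * r < ?g" using d h by (auto simp: \<delta>_def)
    moreover have "\<delta> \<noteq> h" by (auto simp: \<delta>_def)
    moreover have "C \<delta> = d" using d by (auto simp: \<delta>_def C_def)
    ultimately show ?thesis using nP[of _ \<delta>] by (intro exI[of _ \<delta>]) auto
  qed
  have p8: "C (odd_diff ?g x y) < ?g - 1 - 2 * r"
    if "x < ?g" "y < ?g" "x \<noteq> y" "\<not> P x y" "2 * r < odd_diff ?g x y" "odd_diff ?g x y + 2 * r < ?g" for x y
  proof -
    have "odd_diff ?g x y \<noteq> h"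
    proof
      assume "odd_diff ?g x y = h"
      then have "am ?g x h = y \<or> am ?g y h = x" using that(1,2) h by (auto simp: odd_diff_def dm_def am_def split: if_splits)
      then show False using that(1,2,4) by (auto simp: P_def)
    qed
    then show ?thesis using that(5,6) h by (auto simp: C_def)
  qed
  have "colouring ?g (?g - 1 - 2 * r) (circ ?g r P A C)"
    by (rule cc(1)) ((rule p1 p2 p3 p4 p5 p6 p7 p8; assumption)+)
  moreover have "\<exists>d. odd d \<and> d < 2 * r \<and> (am ?g x d = y \<or> am ?g y d = x)"
    if xy: "x < ?g" "y < ?g" "x \<noteq> y" "\<not> circ ?g r P A C x y < ?g - 1 - 2 * r" for x y
    by (rule cc(2)) ((rule p1 p2 p3 p4 p5 p6 p7 p8 xy; assumption)+)
  ultimately show ?thesis by blast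
qed

subsection \<open>Tripling\<close>

text \<open>The point set is three copies of the integers modulo \<open>g\<close> and a stem of \<open>s\<close> points, encoded as copy number 3.
  A transversal triple is classified by its sum: the residues from \<open>6 r\<close> on select a point of the stem, and each
  copy has \<open>2 r\<close> of the other residues, for which the fourth point lies in that copy at an odd distance below
  \<open>2 r\<close>. The pairs at these distances are left out of the colouring.\<close>

definition solve :: "nat \<Rightarrow> nat \<Rightarrow> nat \<Rightarrow> nat" where
  "solve g t w = (t + neg g w) mod g"

lemma solve_props:
  assumes "t < g"
  shows "solve g t w < g" "(w + solve g t w) mod g = t" "b < g \<Longrightarrow> (w + b) mod g = t \<Longrightarrow> b = solve g t w"
proof -
  have g: "g > 0" using assms by simp
  show "solve g t w < g" using g by (simp add: solve_def)
  have "(w + neg g w) mod g = 0" using neg_props(2)[OF g, of w] by (simp add: dvd_eq_mod_eq_0)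
  have "(w + solve g t w) mod g = (t + (w + neg g w)) mod g" by (simp add: solve_def mod_simps algebra_simps)
  also have "\<dots> = (t + (w + neg g w) mod g) mod g" by (simp only: mod_add_right_eq)
  also have "\<dots> = t" using \<open>(w + neg g w) mod g = 0\<close> assms by simp
  finally show *: "(w + solve g t w) mod g = t" .
  assume b: "b < g" "(w + b) mod g = t"
  have "(neg g w + (w + b)) mod g = (neg g w + t) mod g" using b(2) assms by (metis mod_add_right_eq mod_less)
  moreover have "(neg g w + (w + b)) mod g = ((w + neg g w) mod g + b) mod g" by (simp add: mod_simps algebra_simps)
  ultimately show "b = solve g t w" using \<open>(w + neg g w) mod g = 0\<close> b(1) by (simp add: solve_def add.commute)
qed

text \<open>Replacing \<open>c\<close> by \<open>c'\<close> changes the sum from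
  \<open>2 * r * l + v\<close> to \<open>2 * r * l + (2 * r - 1 - v)\<close>. So reflection pairs
  the lower with the upper half of the residues of copy \<open>l\<close>, and each odd distance
  below \<open>2 * r\<close> belongs to exactly one \<open>v\<close>.\<close>

definition trB :: "nat \<Rightarrow> nat \<Rightarrow> nat \<Rightarrow> nat \<Rightarrow> nat \<Rightarrow> nat \<Rightarrow> nat \<Rightarrow> bool" where
  "trB g r l a b c c' \<longleftrightarrow> (\<exists>v<r. (a + b + c) mod g = 2 * r * l + v \<and> c' = am g c (2 * r - 1 - 2 * v))"

definition blocksTr :: "nat \<Rightarrow> nat \<Rightarrow> nat \<times> nat \<times> nat \<Rightarrow> (nat \<times> nat) set set" where
  "blocksTr g r f = (case f of (i, j, l) \<Rightarrow> {{(i, a), (j, b), (l, c), (l, c')} | a b c c'.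
     a < g \<and> b < g \<and> c < g \<and> c' < g \<and> trB g r l a b c c'})"

definition trios :: "(nat \<times> nat \<times> nat) set" where
  "trios = {(0, 1, 2), (0, 2, 1), (1, 2, 0)}"

definition blocksSt :: "nat \<Rightarrow> nat \<Rightarrow> nat \<Rightarrow> (nat \<times> nat) set set" where
  "blocksSt g r s = {{(0, a), (1, b), (2, c), (3, t)} | a b c t. a < g \<and> b < g \<and> c < g \<and> t < s \<and> (a + b + c) mod g = 6 * r + t}"

lemma card_blocksTr:
  assumes "l < 3" "6 * r \<le> g"
  shows "card (blocksTr g r (i, j, l)) \<le> g * g * r"
proof -
  let ?f = "\<lambda>(a, c, v). {(i, a), (j, solve g (2 * r * l + v) (a + c)), (l, c), (l, am g c (2 * r - 1 - 2 * v))}"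
  have sub: "blocksTr g r (i, j, l) \<subseteq> ?f ` ({..<g} \<times> {..<g} \<times> {..<r})"
  proof
    fix B assume "B \<in> blocksTr g r (i, j, l)"
    then obtain a b c v where B: "B = {(i, a), (j, b), (l, c), (l, am g c (2 * r - 1 - 2 * v))}" and
      lt: "a < g" "b < g" "c < g" "v < r" "(a + b + c) mod g = 2 * r * l + v"
      unfolding blocksTr_def trB_def by auto
    have "2 * r * l \<le> 2 * r * 2" using assms(1) by (intro mult_le_mono) auto
    then have tg: "2 * r * l + v < g" using lt(4) assms(2) by linarith
    have "((a + c) + b) mod g = 2 * r * l + v" using lt(5) by (simp add: algebra_simps)
    then have "b = solve g (2 * r * l + v) (a + c)" by (rule solve_props(3)[OF tg lt(2)])
    then show "B \<in> ?f ` ({..<g} \<times> {..<g} \<times> {..<r})" using B lt by (intro image_eqI[of _ _ "(a, c, v)"]) auto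
  qed
  have "card (blocksTr g r (i, j, l)) \<le> card (?f ` ({..<g} \<times> {..<g} \<times> {..<r}))" by (rule card_mono[OF _ sub]) simp
  also have "\<dots> \<le> card ({..<g} \<times> {..<g} \<times> {..<r})" by (rule card_image_le) simp
  finally show ?thesis by (simp add: card_cartesian_product mult.assoc)
qed

lemma card_blocksSt:
  assumes "g = 6 * r + s"
  shows "card (blocksSt g r s) \<le> g * g * s"
proof -
  let ?f = "\<lambda>(a, b, t). {(0::nat, a), (1, b), (2, solve g (6 * r + t) (a + b)), (3, t)}"
  have sub: "blocksSt g r s \<subseteq> ?f ` ({..<g} \<times> {..<g} \<times> {..<s})"
  proof
    fix B assume "B \<in> blocksSt g r s"
    then obtain a b c t where B: "B = {(0, a), (1, b), (2, c), (3, t)}" and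
      lt: "a < g" "b < g" "c < g" "t < s" "(a + b + c) mod g = 6 * r + t"
      unfolding blocksSt_def by auto
    have "c = solve g (6 * r + t) (a + b)" by (rule solve_props(3)[OF _ lt(3,5)]) (use lt assms in simp)
    then show "B \<in> ?f ` ({..<g} \<times> {..<g} \<times> {..<s})" using B lt by (intro image_eqI[of _ _ "(a, b, t)"]) auto
  qed
  have "card (blocksSt g r s) \<le> card (?f ` ({..<g} \<times> {..<g} \<times> {..<s}))" by (rule card_mono[OF _ sub]) simp
  also have "\<dots> \<le> card ({..<g} \<times> {..<g} \<times> {..<s})" by (rule card_image_le) simp
  finally show ?thesis by (simp add: card_cartesian_product mult.assoc)
qed

lemma trB_pair:
  assumes r: "r > 0" and g: "6 * r \<le> g" and l: "l < 3" and lt: "x < g" "x' < g" "y < g"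
    and d: "odd d" "d < 2 * r" "am g x d = x'"
  shows "\<exists>z<g. trB g r l y z x x' \<and> trB g r l z y x x'"
proof -
  define v where "v = (2 * r - 1 - d) div 2"
  have v: "v < r" "2 * r - 1 - 2 * v = d" using d r by (auto simp: v_def elim!: oddE)
  have "2 * r * l \<le> 2 * r * 2" using l by (intro mult_le_mono) auto
  then have tg: "2 * r * l + v < g" using v(1) g by linarith
  let ?z = "solve g (2 * r * l + v) (x + y)"
  have z: "?z < g" "((x + y) + ?z) mod g = 2 * r * l + v" using solve_props[OF tg] by auto
  have "(y + ?z + x) mod g = 2 * r * l + v" "(?z + y + x) mod g = 2 * r * l + v" using z(2) by (simp_all add: algebra_simps)
  then show ?thesis using z(1) v d(3) unfolding trB_def by (intro exI[of _ ?z]) (auto intro!: exI[of _ v])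
qed

lemma trB_triple:
  assumes r: "r > 0" and g: "6 * r \<le> g" and l: "l < 3" and lt: "z < g"
    and t: "(x + y + z) mod g = 2 * r * l + w" "w < 2 * r"
  shows "\<exists>z'<g. trB g r l x y z z' \<or> trB g r l x y z' z"
proof (cases "w < r")
  case True
  have "am g z (2 * r - 1 - 2 * w) < g" using lt g r by (intro am_dm(1)) auto
  then show ?thesis using True t(1) unfolding trB_def by blast
next
  case False
  \<comment> \<open>In the upper half of the residues \<open>z\<close> is the second point of the
    pair; reflection gives the residue of the first.\<close>
  define v where "v = 2 * r - 1 - w"
  define e where "e = 2 * r - 1 - 2 * v"
  have v: "v < r" "v + e = w" "e < g" using False t(2) g r by (auto simp: v_def e_def)
  let ?z = "dm g z e"
  have z: "?z < g" "am g ?z e = z" using am_dm(2,5)[OF lt v(3)] lt v by (auto simp: am_def dm_def)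
  have "2 * r * l \<le> 2 * r * 2" using l by (intro mult_le_mono) auto
  then have tg: "2 * r * l + v < g" using v(1) g by linarith
  have "am g ?z e mod g = (?z + e) mod g" using le_mod_geq[of g "?z + e"] by (simp add: am_def)
  then have ze: "z mod g = (?z + e) mod g" using z by simp
  have "((x + y + ?z) mod g + e) mod g = (x + y + (?z + e)) mod g" by (simp add: mod_simps algebra_simps)
  also have "\<dots> = (x + y + z) mod g" using ze by (metis mod_add_right_eq)
  finally have s: "((x + y + ?z) mod g + e) mod g = 2 * r * l + v + e" using t(1) v(2) by simp
  have gg: "2 * r * l + v + e < g" using v(2) t(2) \<open>2 * r * l \<le> 2 * r * 2\<close> g by linarith
  define m where "m = (x + y + ?z) mod g"
  have "m < g" using gg by (simp add: m_def)
  then have "m = 2 * r * l + v" using s gg v(3) unfolding m_def[symmetric] by (auto simp: mod_if split: if_splits)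
  then have "trB g r l x y ?z z" unfolding trB_def using v(1) z(2) by (intro exI[of _ v]) (simp add: m_def e_def)
  then show ?thesis using z(1) by blast
qed

text \<open>The assumption \<open>stem\<close> says by a count that \<open>S0\<close> carries a
  subsystem: its blocks are common to the three copies of \<open>B0\<close> and count once.
  Uncoloured edges are, by \<open>far\<close>, at short odd distances and are completed by the
  transversal blocks. The conclusion exposes both the coloured blocks and a copy of
  \<open>B0\<close> missing copy 1, so that trades may come from either source.\<close>

lemma triple:
  fixes X0 :: "'a set"
  assumes fin0: "finite X0" and S: "is_SQS X0 B0" and S0: "S0 \<subseteq> X0" "card S0 = s" "card X0 = g + s"
    and stem: "24 * card {b \<in> B0. b \<subseteq> S0} = s * (s - 1) * (s - 2)"
    and g: "g = 6 * r + s" "r > 0" "s \<ge> 2"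
    and \<phi>: "colouring g (g - 1 - 2 * r) \<phi>"
    and far: "\<And>x y. \<lbrakk>x < g; y < g; x \<noteq> y; \<not> \<phi> x y < g - 1 - 2 * r\<rbrakk> \<Longrightarrow> \<exists>d. odd d \<and> d < 2 * r \<and> (am g x d = y \<or> am g y d = x)"
  shows "\<exists>B e. is_SQS ({..<3} \<times> {..<g} \<union> {3} \<times> {..<s}) B \<and> quads22 0 1 g (g - 1 - 2 * r) \<phi> \<subseteq> B \<and>
    inj_on e X0 \<and> (`) e ` B0 \<subseteq> B \<and> (\<forall>x. fst (e x) \<noteq> 1)"
proof -
  let ?m = "g - 1 - 2 * r"
  have finS: "finite S0" using S0(1) fin0 finite_subset by blast
  have cX: "card (X0 - S0) = g" using S0 finS by (simp add: card_Diff_subset)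
  obtain \<beta> where \<beta>: "bij_betw \<beta> (X0 - S0) {0..<g}" using ex_bij_betw_finite_nat[of "X0 - S0"] fin0 cX by auto
  obtain \<sigma> where \<sigma>: "bij_betw \<sigma> S0 {0..<s}" using ex_bij_betw_finite_nat[OF finS] S0(2) by auto
  define emb where "emb i x = (if x \<in> S0 then (3, \<sigma> x) else (i, \<beta> x))" for i :: nat and x
  define Y where "Y = {..<3} \<times> {..<g} \<union> {3::nat} \<times> {..<s}"
  define FB where "FB = (\<Union>i\<in>{..<3}. (`) (emb i) ` B0)"
  define QB where "QB = quads22 0 1 g ?m \<phi> \<union> quads22 0 2 g ?m \<phi> \<union> quads22 1 2 g ?m \<phi>"
  define TB where "TB = (\<Union>f\<in>trios. blocksTr g r f)"
  define B where "B = FB \<union> QB \<union> TB \<union> blocksSt g r s"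
  have \<beta>lt: "\<beta> x < g" if "x \<in> X0" "x \<notin> S0" for x using bij_betwE[OF \<beta>] that by auto
  have \<sigma>lt: "\<sigma> x < s" if "x \<in> S0" for x using bij_betwE[OF \<sigma>] that by auto
  have \<beta>inj: "x = y" if "x \<in> X0 - S0" "y \<in> X0 - S0" "\<beta> x = \<beta> y" for x y using \<beta> that by (meson bij_betw_imp_inj_on inj_onD)
  have \<sigma>inj: "x = y" if "x \<in> S0" "y \<in> S0" "\<sigma> x = \<sigma> y" for x y using \<sigma> that by (meson bij_betw_imp_inj_on inj_onD)
  have embinj: "inj_on (emb i) X0" if "i < 3" for i
  proof (rule inj_onI)
    fix x y assume "x \<in> X0" "y \<in> X0" "emb i x = emb i y"
    then show "x = y" using \<beta>inj[of x y] \<sigma>inj[of x y] that by (auto simp: emb_def split: if_splits)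
  qed
  have embY: "emb i x \<in> Y" if "i < 3" "x \<in> X0" for i x using \<beta>lt[of x] \<sigma>lt[of x] that by (auto simp: emb_def Y_def)
  have embsurj: "\<exists>x\<in>X0. emb i x = (m, y)" if "(m, y) \<in> Y" "m = i \<or> m = 3" "i < 3" for i m y
  proof (cases "m = 3")
    case True
    then have "y \<in> \<sigma> ` S0" using that \<sigma> by (auto simp: Y_def bij_betw_def)
    then obtain x where "x \<in> S0" "\<sigma> x = y" by auto
    then show ?thesis using S0(1) True by (intro bexI[of _ x]) (auto simp: emb_def)
  next
    case False
    then have "y \<in> \<beta> ` (X0 - S0)" using that \<beta> by (auto simp: Y_def bij_betw_def)
    then obtain x where "x \<in> X0 - S0" "\<beta> x = y" by auto
    then show ?thesis using that False by (intro bexI[of _ x]) (auto simp: emb_def)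
  qed
  have finY: "finite Y" by (simp add: Y_def)
  have cY: "card Y = 3 * g + s" unfolding Y_def by (subst card_Un_disjoint) (auto simp: card_cartesian_product)
  have TI: "{(i, a), (j, b), (l, c), (l, c')} \<in> B" if "(i, j, l) \<in> trios" "a < g" "b < g" "c < g" "c' < g" "trB g r l a b c c'" for i j l a b c c'
  proof -
    have "{(i, a), (j, b), (l, c), (l, c')} \<in> blocksTr g r (i, j, l)" unfolding blocksTr_def using that by auto
    then show ?thesis using that(1) by (auto simp: B_def TB_def)
  qed
  have SI: "{(0, a), (1, b), (2, c), (3, t)} \<in> B" if "a < g" "b < g" "c < g" "t < s" "(a + b + c) mod g = 6 * r + t" for a b c t
  proof -
    have "{(0, a), (1, b), (2, c), (3, t)} \<in> blocksSt g r s" unfolding blocksSt_def using that by blast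
    then show ?thesis by (simp add: B_def)
  qed
  have S': "is_SQS Y B"
  proof (rule is_SQS_I[OF finY])
    fix b assume "b \<in> B"
    then consider (F) i where "i < 3" "b \<in> (`) (emb i) ` B0" | (Q) "b \<in> QB" | (T) f where "f \<in> trios" "b \<in> blocksTr g r f"
      | (I) "b \<in> blocksSt g r s" by (auto simp: B_def FB_def TB_def)
    then show "b \<subseteq> Y \<and> card b = 4"
    proof cases
      case F
      then obtain c where c: "c \<in> B0" "b = emb i ` c" by blast
      have "c \<subseteq> X0" "card c = 4" using is_SQS_blockD[OF S c(1)] by auto
      then show ?thesis using c embY[OF F(1)] card_image[OF inj_on_subset[OF embinj[OF F(1)]]] by auto
    next
      case Q
      then have "\<exists>i j. i < 3 \<and> j < 3 \<and> i \<noteq> j \<and> b \<in> quads22 i j g ?m \<phi>"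
        unfolding QB_def
      proof (elim UnE)
        assume "b \<in> quads22 0 1 g ?m \<phi>" then show ?thesis by (intro exI[of _ 0] exI[of _ 1]) simp
      next
        assume "b \<in> quads22 0 2 g ?m \<phi>" then show ?thesis by (intro exI[of _ 0] exI[of _ 2]) simp
      next
        assume "b \<in> quads22 1 2 g ?m \<phi>" then show ?thesis by (intro exI[of _ 1] exI[of _ 2]) simp
      qed
      then obtain i j where ij: "i < 3" "j < 3" "i \<noteq> j" "b \<in> quads22 i j g ?m \<phi>" by blast
      then show ?thesis using quads22_blockD[OF ij(4,3)] by (auto simp: Y_def)
    next
      case T
      then obtain i j l a b' c c' where f: "f = (i, j, l)" and b: "b = {(i, a), (j, b'), (l, c), (l, c')}"
        "a < g" "b' < g" "c < g" "c' < g" "trB g r l a b' c c'"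
        unfolding blocksTr_def by (cases f) auto
      obtain v where v: "v < r" "c' = am g c (2 * r - 1 - 2 * v)" using b(6) by (auto simp: trB_def)
      have "c \<noteq> c'" using v b(4,5) g by (auto simp: am_def split: if_splits)
      then show ?thesis using T(1) f b(1-5) by (auto simp: trios_def Y_def)
    next
      case I
      then show ?thesis by (auto simp: blocksSt_def Y_def)
    qed
  next
    have sorted: "\<exists>b\<in>B. P \<in> b \<and> Q' \<in> b \<and> R \<in> b" if PY: "P \<in> Y" "Q' \<in> Y" "R \<in> Y"
      and ne: "P \<noteq> Q'" "P \<noteq> R" "Q' \<noteq> R" and le: "fst P \<le> fst Q'" "fst Q' \<le> fst R" for P Q' R
    proof -
      obtain i a j b l c where pq: "P = (i, a)" "Q' = (j, b)" "R = (l, c)" by (cases P, cases Q', cases R)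
      have Yd: "x < g" if "(m, x) \<in> Y" "m < 3" for m x using that by (auto simp: Y_def)
      have Y3: "x < s" if "(3, x) \<in> Y" for x using that by (auto simp: Y_def)
      have le3: "m \<le> 3" if "(m, x) \<in> Y" for m x using that by (auto simp: Y_def)
      have ij: "i \<le> j" "j \<le> l" "l \<le> 3" using le pq le3 PY by auto
      have fill: ?thesis if n: "n < 3" and h: "i = n \<or> i = 3" "j = n \<or> j = 3" "l = n \<or> l = 3" for n
      proof -
        obtain x y z where x: "x \<in> X0" "emb n x = P" and y: "y \<in> X0" "emb n y = Q'" and z: "z \<in> X0" "emb n z = R"
          using embsurj[OF _ h(1) n, of a] embsurj[OF _ h(2) n, of b] embsurj[OF _ h(3) n, of c] PY pq by auto
        obtain w where w: "{x, y, z, w} \<in> B0" by (rule is_SQS_ex[OF S x(1) y(1) z(1)]) (use ne x y z in auto)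
        have "emb n ` {x, y, z, w} \<in> B" unfolding B_def FB_def using w n by blast
        then show ?thesis by (rule bexI[rotated]) (use x y z in simp)
      qed
      have pairs: "\<exists>B'\<in>B. (n, x) \<in> B' \<and> (n, x') \<in> B' \<and> (n', y) \<in> B'"
        if n: "n < 3" "n' < 3" "n \<noteq> n'" and lt: "x < g" "x' < g" "y < g" "x \<noteq> x'" for n n' x x' y
      proof (cases "\<phi> x x' < ?m")
        case True
        note q = quads22_cover[OF \<phi> lt(1,2,4) True lt(3)]
        have "n = 0 \<or> n = 1 \<or> n = 2" "n' = 0 \<or> n' = 1 \<or> n' = 2" using n by auto
        moreover have "\<exists>B'\<in>QB. (0, x) \<in> B' \<and> (0, x') \<in> B' \<and> (1, y) \<in> B'"
          using q(1)[where i = 0 and j = 1] unfolding QB_def by blast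
        moreover have "\<exists>B'\<in>QB. (0, x) \<in> B' \<and> (0, x') \<in> B' \<and> (2, y) \<in> B'"
          using q(1)[where i = 0 and j = 2] unfolding QB_def by blast
        moreover have "\<exists>B'\<in>QB. (1, x) \<in> B' \<and> (1, x') \<in> B' \<and> (2, y) \<in> B'"
          using q(1)[where i = 1 and j = 2] unfolding QB_def by blast
        moreover have "\<exists>B'\<in>QB. (1, x) \<in> B' \<and> (1, x') \<in> B' \<and> (0, y) \<in> B'"
          using q(2)[where i = 1 and j = 0] unfolding QB_def by blast
        moreover have "\<exists>B'\<in>QB. (2, x) \<in> B' \<and> (2, x') \<in> B' \<and> (0, y) \<in> B'"
          using q(2)[where i = 2 and j = 0] unfolding QB_def by blast
        moreover have "\<exists>B'\<in>QB. (2, x) \<in> B' \<and> (2, x') \<in> B' \<and> (1, y) \<in> B'"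
          using q(2)[where i = 2 and j = 1] unfolding QB_def by blast
        ultimately have "\<exists>B'\<in>QB. (n, x) \<in> B' \<and> (n, x') \<in> B' \<and> (n', y) \<in> B'"
          using n(3) by (elim disjE) (simp_all only: refl simp_thms)
        then show ?thesis unfolding B_def by blast
      next
        case False
        \<comment> \<open>The distance determines the residue of the sum, and the sum determines the
          missing point in the third copy.\<close>
        obtain d where d: "odd d" "d < 2 * r" "am g x d = x' \<or> am g x' d = x" using far[OF lt(1,2,4) False] by blast
        have key: "\<exists>B'\<in>B. (n, u) \<in> B' \<and> (n, u') \<in> B' \<and> (n', y) \<in> B'" if u: "u < g" "u' < g" "am g u d = u'" for u u'
        proof -
          obtain z where z: "z < g" "trB g r n y z u u'" "trB g r n z y u u'"
            using trB_pair[OF g(2) _ n(1) u(1,2) lt(3) d(1,2) u(3)] g(1) by auto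
          have "\<exists>n''. (n', n'', n) \<in> trios \<or> (n'', n', n) \<in> trios"
          proof -
            have "n = 0 \<or> n = 1 \<or> n = 2" "n' = 0 \<or> n' = 1 \<or> n' = 2" using n by auto
            then show ?thesis using n(3) unfolding trios_def by (elim disjE) auto
          qed
          then obtain n'' where "(n', n'', n) \<in> trios \<or> (n'', n', n) \<in> trios" by blast
          then show ?thesis
          proof
            assume "(n', n'', n) \<in> trios"
            from TI[OF this lt(3) z(1) u(1,2) z(2)] show ?thesis by (rule bexI[rotated]) simp
          next
            assume "(n'', n', n) \<in> trios"
            from TI[OF this z(1) lt(3) u(1,2) z(3)] show ?thesis by (rule bexI[rotated]) simp
          qed
        qed
        show ?thesis using d(3) key[OF lt(1,2)] key[OF lt(2,1)] by blast
      qed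
      consider (fl) n where "n < 3" "i = n \<or> i = 3" "j = n \<or> j = 3" "l = n \<or> l = 3"
        | (st) "i < j" "j < 3" "l = 3" | (left) "i = j" "j < l" "l < 3" | (right) "i < j" "j = l" "l < 3" | (three) "i < j" "j < l" "l < 3"
      proof -
        have "(i = 3 \<or> i < 3) \<and> (j = 3 \<or> j < 3) \<and> (l = 3 \<or> l < 3)" using ij by auto
        then show ?thesis using that ij by (metis le_neq_implies_less le_antisym nat_less_le zero_less_numeral)
      qed
      then show ?thesis
      proof cases
        case fl
        then show ?thesis using fill by blast
      next
        case st
        have lt: "a < g" "b < g" "c < s" using Yd Y3 PY pq st by auto
        have tg: "6 * r + c < g" using lt g by simp
        let ?z = "solve g (6 * r + c) (a + b)"
        have z: "?z < g" "(a + b + ?z) mod g = 6 * r + c" using solve_props[OF tg] by auto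
        consider "i = 0" "j = 1" | "i = 0" "j = 2" | "i = 1" "j = 2" using st by linarith
        then show ?thesis
        proof cases
          case 1
          from SI[OF lt(1,2) z(1) lt(3) z(2)] show ?thesis by (rule bexI[rotated]) (use 1 st pq in simp)
        next
          case 2
          have "(a + ?z + b) mod g = 6 * r + c" using z(2) by (simp add: algebra_simps)
          from SI[OF lt(1) z(1) lt(2) lt(3) this] show ?thesis by (rule bexI[rotated]) (use 2 st pq in simp)
        next
          case 3
          have "(?z + a + b) mod g = 6 * r + c" using z(2) by (simp add: algebra_simps)
          from SI[OF z(1) lt(1,2) lt(3) this] show ?thesis by (rule bexI[rotated]) (use 3 st pq in simp)
        qed
      next
        case left
        have lt: "a < g" "b < g" "c < g" using Yd PY pq left by auto
        have "a \<noteq> b" using ne pq left by auto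
        then show ?thesis using pairs[of i l a b c] left lt pq by auto
      next
        case right
        have lt: "a < g" "b < g" "c < g" using Yd PY pq right by auto
        have "b \<noteq> c" using ne pq right by auto
        then show ?thesis using pairs[of l i b c a] right lt pq by auto
      next
        case three
        then have idx: "i = 0" "j = 1" "l = 2" by linarith+
        have lt: "a < g" "b < g" "c < g" using Yd PY pq three by auto
        define t where "t = (a + b + c) mod g"
        have tg: "t < g" using lt by (simp add: t_def)
        show ?thesis
        proof (cases "t < 6 * r")
          case False
          have "t - 6 * r < s" "t = 6 * r + (t - 6 * r)" using False tg g(1) by linarith+
          from SI[OF lt this[unfolded t_def]] show ?thesis by (rule bexI[rotated]) (use idx pq in simp)
        next
          case True
          \<comment> \<open>The quotient is the copy that receives the fourth point, the remainder
            is the residue within its interval.\<close>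
          define q where "q = t div (2 * r)"
          define w where "w = t mod (2 * r)"
          have w: "w < 2 * r" "t = 2 * r * q + w" using g(2) by (auto simp: w_def q_def)
          have q: "q < 3" using True g(2) by (simp add: q_def less_mult_imp_div_less)
          have g6: "6 * r \<le> g" using g by simp
          consider "q = 0" | "q = 1" | "q = 2" using q by linarith
          then show ?thesis
          proof cases
            case 1
            have "(b + c + a) mod g = 2 * r * q + w" using w(2) by (simp add: t_def algebra_simps)
            from trB_triple[OF g(2) g6 q lt(1) this w(1)] obtain z where z: "z < g" "trB g r q b c a z \<or> trB g r q b c z a" by blast
            have tr: "(1, 2, 0) \<in> trios" by (simp add: trios_def)
            from z(2)[unfolded 1] show ?thesis
            proof
              assume "trB g r 0 b c a z"
              from TI[OF tr lt(2,3,1) z(1) this] show ?thesis by (rule bexI[rotated]) (simp add: idx pq)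
            next
              assume "trB g r 0 b c z a"
              from TI[OF tr lt(2,3) z(1) lt(1) this] show ?thesis by (rule bexI[rotated]) (simp add: idx pq)
            qed
          next
            case 2
            have "(a + c + b) mod g = 2 * r * q + w" using w(2) by (simp add: t_def algebra_simps)
            from trB_triple[OF g(2) g6 q lt(2) this w(1)] obtain z where z: "z < g" "trB g r q a c b z \<or> trB g r q a c z b" by blast
            have tr: "(0, 2, 1) \<in> trios" by (simp add: trios_def)
            from z(2)[unfolded 2] show ?thesis
            proof
              assume "trB g r 1 a c b z"
              from TI[OF tr lt(1,3,2) z(1) this] show ?thesis by (rule bexI[rotated]) (simp add: idx pq)
            next
              assume "trB g r 1 a c z b"
              from TI[OF tr lt(1,3) z(1) lt(2) this] show ?thesis by (rule bexI[rotated]) (simp add: idx pq)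
            qed
          next
            case 3
            have "(a + b + c) mod g = 2 * r * q + w" using w(2) by (simp add: t_def algebra_simps)
            from trB_triple[OF g(2) g6 q lt(3) this w(1)] obtain z where z: "z < g" "trB g r q a b c z \<or> trB g r q a b z c" by blast
            have tr: "(0, 1, 2) \<in> trios" by (simp add: trios_def)
            from z(2)[unfolded 3] show ?thesis
            proof
              assume "trB g r 2 a b c z"
              from TI[OF tr lt(1,2,3) z(1) this] show ?thesis by (rule bexI[rotated]) (simp add: idx pq)
            next
              assume "trB g r 2 a b z c"
              from TI[OF tr lt(1,2) z(1) lt(3) this] show ?thesis by (rule bexI[rotated]) (simp add: idx pq)
            qed
          qed
        qed
      qed
    qed
    fix P Q' R assume "P \<in> Y" "Q' \<in> Y" "R \<in> Y" "P \<noteq> Q'" "P \<noteq> R" "Q' \<noteq> R"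
    then show "\<exists>b\<in>B. P \<in> b \<and> Q' \<in> b \<and> R \<in> b" by (rule cover_wlog[rotated]) (rule sorted)
  next
    define E where "E = {b \<in> B0. b \<subseteq> S0}"
    have finB0: "finite B0" using finite_blocks[OF fin0 is_SQS_blockD[OF S]] .
    have EB: "E \<subseteq> B0" "finite E" using finB0 by (auto simp: E_def)
    \<comment> \<open>The three embeddings agree on the stem, so the blocks in \<open>E\<close> have
      one image instead of three. This saving of \<open>2 * card E\<close> is needed for the exact
      count.\<close>
    have "FB \<subseteq> (`) (emb 0) ` E \<union> (\<Union>i\<in>{..<3}. (`) (emb i) ` (B0 - E))"
    proof
      fix b assume "b \<in> FB"
      then obtain i c where c: "i < 3" "c \<in> B0" "b = emb i ` c" by (auto simp: FB_def)
      show "b \<in> (`) (emb 0) ` E \<union> (\<Union>i\<in>{..<3}. (`) (emb i) ` (B0 - E))"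
      proof (cases "c \<in> E")
        case True
        then have "emb i ` c = emb 0 ` c" by (intro image_cong) (auto simp: E_def emb_def)
        then show ?thesis using True c by blast
      next
        case False
        then show ?thesis using c by blast
      qed
    qed
    then have "card FB \<le> card ((`) (emb 0) ` E \<union> (\<Union>i\<in>{..<3}. (`) (emb i) ` (B0 - E)))"
      using finB0 EB by (intro card_mono) auto
    also have "\<dots> \<le> card ((`) (emb 0) ` E) + card (\<Union>i\<in>{..<3::nat}. (`) (emb i) ` (B0 - E))" by (rule card_Un_le)
    also have "\<dots> \<le> card E + (\<Sum>i<3::nat. card ((`) (emb i) ` (B0 - E)))"
      using EB by (intro add_mono card_image_le card_UN_le) auto
    also have "\<dots> \<le> card E + (\<Sum>i<3::nat. card (B0 - E))"
      using finB0 by (intro add_mono sum_mono card_image_le) auto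
    finally have cF: "card FB + 2 * card E \<le> 3 * card B0" using EB finB0 card_mono[OF finB0 EB(1)] by (simp add: card_Diff_subset)
    have cQ: "4 * card QB \<le> 3 * (?m * g ^ 2)"
      using card_Un_le[of "quads22 0 1 g ?m \<phi> \<union> quads22 0 2 g ?m \<phi>" "quads22 1 2 g ?m \<phi>"]
        card_Un_le[of "quads22 0 1 g ?m \<phi>" "quads22 0 2 g ?m \<phi>"]
        card_quads22(1)[OF \<phi>, of 0 1] card_quads22(1)[OF \<phi>, of 0 2] card_quads22(1)[OF \<phi>, of 1 2] by (simp add: QB_def)
    have cT: "card TB \<le> 3 * (g * g * r)"
    proof -
      have "finite trios" by (simp add: trios_def)
      then have "card TB \<le> (\<Sum>f\<in>trios. card (blocksTr g r f))" unfolding TB_def by (rule card_UN_le)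
      also have "\<dots> \<le> (\<Sum>f\<in>trios. g * g * r)"
      proof (rule sum_mono)
        fix f assume "f \<in> trios"
        then obtain i j l where "f = (i, j, l)" "l < 3" by (auto simp: trios_def)
        then show "card (blocksTr g r f) \<le> g * g * r" using card_blocksTr[of l r g i j] g by simp
      qed
      also have "\<dots> = card trios * (g * g * r)" by simp
      also have "card trios = 3" by (simp add: trios_def)
      finally show ?thesis .
    qed
    have cS: "card (blocksSt g r s) \<le> g * g * s" by (rule card_blocksSt[OF g(1)])
    have "card B \<le> card FB + card QB + card TB + card (blocksSt g r s)"
      unfolding B_def by (intro order_trans[OF card_Un_le] add_mono order_refl)
    moreover have "24 * card B0 = (g + s) * (g + s - 1) * (g + s - 2)" using is_SQS_card[OF fin0 S] S0 by simp
    moreover have "24 * card E = s * (s - 1) * (s - 2)" using stem by (simp add: E_def)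
    ultimately have "24 * card B + 2 * (s * (s - 1) * (s - 2)) \<le> 3 * ((g + s) * (g + s - 1) * (g + s - 2))
      + 6 * (3 * (?m * g ^ 2)) + 24 * (3 * (g * g * r)) + 24 * (g * g * s)"
      using cF cQ cT cS by linarith
    moreover obtain w where w: "s = w + 2" using g(3) by (metis add.commute le_Suc_ex)
    have "?m = 4 * r + w + 1" using g(1) w by simp
    then have "3 * ((g + s) * (g + s - 1) * (g + s - 2)) + 6 * (3 * (?m * g ^ 2)) + 24 * (3 * (g * g * r)) + 24 * (g * g * s)
      = (3 * g + s) * (3 * g + s - 1) * (3 * g + s - 2) + 2 * (s * (s - 1) * (s - 2))"
      unfolding g(1) w by (simp add: power2_eq_square algebra_simps)
    ultimately show "24 * card B \<le> card Y * (card Y - 1) * (card Y - 2)" unfolding cY by linarith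
  qed
  have "quads22 0 1 g ?m \<phi> \<subseteq> B" unfolding B_def QB_def by blast
  moreover have "(`) (emb 0) ` B0 \<subseteq> FB" unfolding FB_def by (rule UN_upper) simp
  then have "(`) (emb 0) ` B0 \<subseteq> B" unfolding B_def by blast
  moreover have "\<forall>x. fst (emb 0 x) \<noteq> 1" by (simp add: emb_def)
  moreover have "inj_on (emb 0) X0" by (rule embinj) simp
  ultimately show ?thesis using S'[unfolded Y_def] by (intro exI[of _ B] exI[of _ "emb 0"] conjI)
qed

subsection \<open>Explicit candelabra systems\<close>

type_synonym block4 = "int \<times> int \<times> int \<times> int"

text \<open>The base blocks below were found by computer search for systems with a cyclic automorphism of order \<open>2 u\<close>
  that is transitive on the first two groups. Hence only the triples through 0 have to be checked.\<close>

definition bmap :: "(int \<Rightarrow> int) \<Rightarrow> block4 \<Rightarrow> block4" where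
  "bmap f b = (case b of (w, x, y, z) \<Rightarrow> (f w, f x, f y, f z))"

definition blist :: "block4 \<Rightarrow> int list" where
  "blist b = (case b of (w, x, y, z) \<Rightarrow> [w, x, y, z])"

definition bset :: "block4 \<Rightarrow> int set" where
  "bset b = set (blist b)"

fun orbit :: "nat \<Rightarrow> ('a \<Rightarrow> 'a) \<Rightarrow> 'a \<Rightarrow> 'a list" where
  "orbit 0 f x = []"
| "orbit (Suc n) f x = x # orbit n f (f x)"

fun iter :: "nat \<Rightarrow> ('a \<Rightarrow> 'a) \<Rightarrow> 'a \<Rightarrow> 'a" where
  "iter 0 f x = x"
| "iter (Suc n) f x = iter n f (f x)"

definition through :: "int \<Rightarrow> block4 \<Rightarrow> (int \<times> int \<times> int) list" where
  "through p b = (case b of (w, x, y, z) \<Rightarrow> if w = p then [(x, y, z)] else if x = p then [(w, y, z)]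
     else if y = p then [(w, x, z)] else if z = p then [(w, x, y)] else [])"

definition partners :: "int \<Rightarrow> int \<times> int \<times> int \<Rightarrow> int list" where
  "partners y t = (case t of (a, b, c) \<Rightarrow> if y = a then [b, c] else if y = b then [a, c]
     else if y = c then [a, b] else [])"

fun all_partners :: "int \<Rightarrow> (int \<times> int \<times> int) list \<Rightarrow> int list" where
  "all_partners y [] = []"
| "all_partners y (t # ts) = partners y t @ all_partners y ts"

fun orbits :: "nat \<Rightarrow> (int \<Rightarrow> int) \<Rightarrow> block4 list \<Rightarrow> block4 list" where
  "orbits l f [] = []"
| "orbits l f (b # bs) = orbit l (bmap f) b @ orbits l f bs"

fun orbit_blocks :: "(int \<Rightarrow> int) \<Rightarrow> (nat \<times> block4 list) list \<Rightarrow> block4 list" where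
  "orbit_blocks f [] = []"
| "orbit_blocks f ((l, bs) # ls) = orbits l f bs @ orbit_blocks f ls"

fun derived :: "nat \<Rightarrow> (int \<Rightarrow> int) \<Rightarrow> block4 list \<Rightarrow> (int \<times> int \<times> int) list" where
  "derived l f [] = []"
| "derived l f (b # bs) = concat (map (through 0) (orbit l (bmap f) b)) @ derived l f bs"

fun all_derived :: "(int \<Rightarrow> int) \<Rightarrow> (nat \<times> block4 list) list \<Rightarrow> (int \<times> int \<times> int) list" where
  "all_derived f [] = []"
| "all_derived f ((l, bs) # ls) = derived l f bs @ all_derived f ls"

fun group_of :: "int \<Rightarrow> int \<Rightarrow> int" where
  "group_of u c = (if c < u then 0 else if c < 2 * u then 1 else if c < 3 * u then 2 else 3)"

fun swap01 :: "int \<Rightarrow> int" where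
  "swap01 i = (if i = 0 then 1 else if i = 1 then 0 else i)"

fun check_perm :: "int \<Rightarrow> int \<Rightarrow> nat \<Rightarrow> (int \<Rightarrow> int) \<Rightarrow> int list \<Rightarrow> bool" where
  "check_perm u n N f [] = True"
| "check_perm u n N f (c # cs) = (0 \<le> f c \<and> f c < n \<and> iter N f c = c \<and>
     group_of u (f c) = swap01 (group_of u c) \<and> check_perm u n N f cs)"

fun check_base :: "int \<Rightarrow> nat \<Rightarrow> (int \<Rightarrow> int) \<Rightarrow> block4 list \<Rightarrow> bool" where
  "check_base n l f [] = True"
| "check_base n l f (b # bs) = (distinct (blist b) \<and> sort (blist (iter l (bmap f) b)) = sort (blist b) \<and>
     list_all (\<lambda>c. 0 \<le> c \<and> c < n) (blist b) \<and> check_base n l f bs)"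

fun check_bases :: "int \<Rightarrow> (int \<Rightarrow> int) \<Rightarrow> (nat \<times> block4 list) list \<Rightarrow> bool" where
  "check_bases n f [] = True"
| "check_bases n f ((l, bs) # ls) = (check_base n l f bs \<and> check_bases n f ls)"

text \<open>The points \<open>z\<close> for which \<open>0\<close>, \<open>y\<close>,
  \<open>z\<close> lie in no union of a group and the stem: for \<open>y\<close> in the group of 0
  or in the stem only the other two groups, otherwise all further points.\<close>

definition needed_partners :: "int \<Rightarrow> int \<Rightarrow> int \<Rightarrow> int list" where
  "needed_partners u n y = (if y < u \<or> 3 * u \<le> y then [u..3 * u - 1] else [1..y - 1] @ [y + 1..n - 1])"

fun check_derived :: "int \<Rightarrow> int \<Rightarrow> (int \<times> int \<times> int) list \<Rightarrow> int list \<Rightarrow> bool" where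
  "check_derived u n D [] = True"
| "check_derived u n D (y # ys) = (sort (all_partners y D) = needed_partners u n y \<and> check_derived u n D ys)"

fun check_fill_pairs :: "int list \<Rightarrow> int \<Rightarrow> (int \<times> int \<times> int) list \<Rightarrow> int list \<Rightarrow> bool" where
  "check_fill_pairs ps x D [] = True"
| "check_fill_pairs ps x D (y # ys) = ((x = y \<or> sort (all_partners y D) = remove1 x (remove1 y ps)) \<and>
     check_fill_pairs ps x D ys)"

fun check_fill :: "int list \<Rightarrow> block4 list \<Rightarrow> int list \<Rightarrow> bool" where
  "check_fill ps bs [] = True"
| "check_fill ps bs (x # xs) = (check_fill_pairs ps x (concat (map (through x) bs)) ps \<and> check_fill ps bs xs)"

fun check_fill_blocks :: "int list \<Rightarrow> block4 list \<Rightarrow> bool" where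
  "check_fill_blocks ps [] = True"
| "check_fill_blocks ps (b # bs) = (distinct (blist b) \<and> list_all (List.member ps) (blist b) \<and> check_fill_blocks ps bs)"

lemma iter_funpow: "iter k f x = (f ^^ k) x"
  by (induction k arbitrary: x) (simp_all add: funpow_swap1)

lemma set_orbit: "set (orbit l f x) = {(f ^^ k) x | k. k < l}"
proof (induction l arbitrary: x)
  case (Suc l)
  have "{(f ^^ k) x | k. k < Suc l} = insert x {(f ^^ k) (f x) | k. k < l}"
  proof (intro equalityI subsetI)
    fix y assume "y \<in> {(f ^^ k) x | k. k < Suc l}"
    then obtain k where "k < Suc l" "y = (f ^^ k) x" by blast
    then show "y \<in> insert x {(f ^^ k) (f x) | k. k < l}" by (cases k) (auto simp: funpow_swap1)
  next
    fix y assume "y \<in> insert x {(f ^^ k) (f x) | k. k < l}"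
    then consider "y = x" | k where "k < l" "y = (f ^^ k) (f x)" by blast
    then show "y \<in> {(f ^^ k) x | k. k < Suc l}"
    proof cases
      case 1
      then show ?thesis by (intro CollectI exI[of _ 0]) simp
    next
      case 2
      then show ?thesis by (intro CollectI exI[of _ "Suc k"]) (simp add: funpow_swap1)
    qed
  qed
  then show ?case using Suc.IH[of "f x"] by simp
qed simp

lemma length_orbit: "length (orbit l f x) = l"
  by (induction l arbitrary: x) auto

lemma bset_bmap: "bset (bmap f b) = f ` bset b"
  by (cases b) (simp add: bset_def blist_def bmap_def)

lemma bset_bmap_funpow: "bset ((bmap f ^^ k) b) = (f ^^ k) ` bset b"
  by (induction k) (auto simp: bset_bmap image_image)

lemma set_orbits: "set (orbits l f bs) = (\<Union>b\<in>set bs. set (orbit l (bmap f) b))"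
  by (induction bs) simp_all

lemma set_orbit_blocks:
  "set (orbit_blocks f ls) = (\<Union>(l, bs)\<in>set ls. \<Union>b\<in>set bs. set (orbit l (bmap f) b))"
  by (induction f ls rule: orbit_blocks.induct) (simp_all add: set_orbits)

lemma length_orbits: "length (orbits l f bs) = l * length bs"
  by (induction bs) (auto simp: length_orbit)

lemma check_perm_iff:
  "check_perm u n N f cs \<longleftrightarrow> (\<forall>c\<in>set cs. 0 \<le> f c \<and> f c < n \<and> iter N f c = c \<and> group_of u (f c) = swap01 (group_of u c))"
  by (induction cs) (simp_all del: group_of.simps swap01.simps)

lemma check_bases_iff:
  "check_bases n f ls \<longleftrightarrow> (\<forall>(l, bs)\<in>set ls. \<forall>b\<in>set bs. distinct (blist b) \<and>
     sort (blist (iter l (bmap f) b)) = sort (blist b) \<and> list_all (\<lambda>c. 0 \<le> c \<and> c < n) (blist b))"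
proof -
  have "check_base n l f bs \<longleftrightarrow> (\<forall>b\<in>set bs. distinct (blist b) \<and>
     sort (blist (iter l (bmap f) b)) = sort (blist b) \<and> list_all (\<lambda>c. 0 \<le> c \<and> c < n) (blist b))" for l bs
    by (induction bs) auto
  then show ?thesis by (induction n f ls rule: check_bases.induct) auto
qed

lemma check_derived_iff:
  "check_derived u n D ys \<longleftrightarrow> (\<forall>y\<in>set ys. sort (all_partners y D) = needed_partners u n y)"
  by (induction ys) auto

lemma set_all_partners: "set (all_partners y D) = (\<Union>t\<in>set D. set (partners y t))"
  by (induction D) auto

lemma set_all_derived: "set (all_derived f ls) = (\<Union>b\<in>set (orbit_blocks f ls). set (through 0 b))"
proof -
  have "set (derived l f bs) = (\<Union>b\<in>set (orbits l f bs). set (through 0 b))" for l bs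
    by (induction bs) auto
  then show ?thesis by (induction f ls rule: orbit_blocks.induct) auto
qed

lemma partners_through:
  assumes "t \<in> set (through x b)" "z \<in> set (partners y t)"
  shows "{x, y, z} \<subseteq> bset b"
  using assms by (cases b; cases t)
    (auto simp: through_def partners_def bset_def blist_def split: if_splits)

text \<open>The powers of \<open>f\<close> permute the blocks, because the orbit lists close up as
  sets, and the holes, because \<open>f\<close> exchanges the first two groups and keeps the third
  and the stem. As the orbit of 0 is the union of the first two groups, any triple with a point
  there can be moved to a triple through 0.\<close>

lemma candelabraI:
  assumes u: "u > 0" and s: "s \<ge> 0" and n: "n = 3 * u + s" and N: "N = nat (2 * u)"
    and perm: "check_perm u n N f [0..n - 1]"
    and trans: "sort (orbit N f 0) = [0..2 * u - 1]"
    and base: "check_bases n f ls"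
    and der: "check_derived u n (all_derived f ls) [1..n - 1]"
  shows "candelabra u s (bset ` set (orbit_blocks f ls))"
proof -
  define K where "K = bset ` set (orbit_blocks f ls)"
  have mem: "c \<in> set [0..n - 1] \<longleftrightarrow> c \<in> {0..<n}" for c by auto
  have fr: "f c \<in> {0..<n}" if "c \<in> {0..<n}" for c
    using perm that unfolding check_perm_iff mem by simp
  have fk: "(f ^^ k) c \<in> {0..<n}" if "c \<in> {0..<n}" for c k
    using that fr by (induction k) auto
  have fN: "(f ^^ N) c = c" if "c \<in> {0..<n}" for c
    using perm that unfolding check_perm_iff mem by (simp add: iter_funpow)
  have grp: "group_of u (f c) = swap01 (group_of u c)" if "c \<in> {0..<n}" for c
    using perm that mem[of c] unfolding check_perm_iff by blast
  have inj: "inj_on (f ^^ k) {0..<n}" for k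
  proof -
    have "inj_on f {0..<n}"
    proof (rule inj_onI)
      fix c d assume c: "c \<in> {0..<n}" and d: "d \<in> {0..<n}" and e: "f c = f d"
      have "N \<noteq> 0" using N u by simp
      then obtain M where M: "N = Suc M" by (cases N) auto
      have "(f ^^ M) (f c) = (f ^^ M) (f d)" using e by simp
      then show "c = d" using fN[OF c] fN[OF d] by (simp add: M funpow_swap1)
    qed
    then show ?thesis
    proof (induction k)
      case (Suc k)
      have "inj_on (f \<circ> (f ^^ k)) {0..<n}"
        by (rule comp_inj_on[OF Suc.IH[OF Suc.prems] inj_on_subset[OF Suc.prems]]) (use fk in auto)
      then show ?case by (simp add: comp_def)
    qed simp
  qed
  have Kel: "\<exists>k b l bs. (l, bs) \<in> set ls \<and> k < l \<and> b \<in> set bs \<and> B = (f ^^ k) ` bset b" if BK: "B \<in> K" for B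
  proof -
    obtain c where c: "c \<in> set (orbit_blocks f ls)" "B = bset c" using BK unfolding K_def by blast
    then obtain l bs b where lb: "(l, bs) \<in> set ls" "b \<in> set bs" "c \<in> set (orbit l (bmap f) b)"
      unfolding set_orbit_blocks by (elim UN_E) (simp split: prod.splits, blast)
    then obtain k where "k < l" "c = (bmap f ^^ k) b" unfolding set_orbit by blast
    then show ?thesis using lb c bset_bmap_funpow[of k f b] by blast
  qed
  have KI: "(f ^^ k) ` bset b \<in> K" if "(l, bs) \<in> set ls" "k < l" "b \<in> set bs" for k b l bs
  proof -
    have "(bmap f ^^ k) b \<in> set (orbit l (bmap f) b)" unfolding set_orbit using that(2) by blast
    then have "(bmap f ^^ k) b \<in> set (orbit_blocks f ls)"
      unfolding set_orbit_blocks using that(1,3) by (intro UN_I[of "(l, bs)"]) (simp, simp, blast)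
    then show ?thesis unfolding K_def using bset_bmap_funpow[of k f b] by (metis image_eqI)
  qed
  have bas: "bset b \<subseteq> {0..<n}" "card (bset b) = 4" "(f ^^ l) ` bset b = bset b"
    if "(l, bs) \<in> set ls" "b \<in> set bs" for l bs b
  proof -
    have *: "distinct (blist b)" "sort (blist (iter l (bmap f) b)) = sort (blist b)" "list_all (\<lambda>c. 0 \<le> c \<and> c < n) (blist b)"
      using base that unfolding check_bases_iff by blast+
    show "bset b \<subseteq> {0..<n}" using *(3) by (auto simp: bset_def list_all_iff)
    show "card (bset b) = 4" using distinct_card[OF *(1)] by (cases b) (simp add: bset_def blist_def)
    have "set (blist (iter l (bmap f) b)) = set (blist b)" using *(2) by (metis set_sort)
    then show "(f ^^ l) ` bset b = bset b" using bset_bmap_funpow[of l f b] by (simp add: bset_def iter_funpow)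
  qed
  have closed: "f ` B \<in> K" if BK: "B \<in> K" for B
  proof -
    obtain k b l bs where B: "(l, bs) \<in> set ls" "k < l" "b \<in> set bs" "B = (f ^^ k) ` bset b"
      using Kel[OF BK] by blast
    have fB: "f ` B = (f ^^ Suc k) ` bset b" by (simp add: B(4) image_image)
    show ?thesis
    proof (cases "Suc k < l")
      case True
      then show ?thesis unfolding fB by (rule KI[OF B(1) _ B(3)])
    next
      case False
      then have "Suc k = l" using B(2) by simp
      then have "f ` B = (f ^^ 0) ` bset b" using fB bas(3)[OF B(1,3)] by simp
      then show ?thesis using KI[OF B(1) _ B(3), of 0] B(2) by simp
    qed
  qed
  have closedk: "(f ^^ k) ` B \<in> K" if "B \<in> K" for B k
  proof (induction k)
    case (Suc k)
    have "(f ^^ Suc k) ` B = f ` ((f ^^ k) ` B)" by (simp add: image_image)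
    then show ?case using closed[OF Suc.IH] by simp
  qed (use that in simp)
  have clsg: "cls u c = (if group_of u c = 3 then None else Some (group_of u c))" if "c \<in> {0..<n}" for c
  proof -
    have "c div u = 0" if "0 \<le> c" "c < u" using that by simp
    moreover have "c div u = 1" if "u \<le> c" "c < 2 * u"
      using that div_pos_pos_trivial[of "c - u" u] div_add_self2[of u "c - u"] u by simp
    moreover have "c div u = 2" if "2 * u \<le> c" "c < 3 * u"
      using that div_pos_pos_trivial[of "c - 2 * u" u] div_mult_self1[of u "c - 2 * u" 2] u by simp
    ultimately show ?thesis using that by (auto simp: cls_def)
  qed
  have gr: "group_of u c \<in> {0, 1, 2, 3}" for c by simp
  have hole_f: "in_hole u T" if T: "T \<subseteq> {0..<n}" and h: "in_hole u (f ` T)" for T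
  proof -
    obtain i where i: "\<forall>c\<in>f ` T. cls u c = Some i \<or> cls u c = None" using h unfolding in_hole_def by (rule exE)
    have *: "cls u c = Some (swap01 i) \<or> cls u c = None" if c: "c \<in> T" for c
    proof -
      have cn: "c \<in> {0..<n}" "f c \<in> {0..<n}" using c T fr by auto
      have "cls u (f c) = Some i \<or> cls u (f c) = None" by (rule bspec[OF i imageI[OF c]])
      then show ?thesis using clsg[OF cn(1)] clsg[OF cn(2)] grp[OF cn(1)] gr[of c]
        by (auto simp del: group_of.simps split: if_splits)
    qed
    show ?thesis unfolding in_hole_def by (intro exI[of _ "swap01 i"] ballI) (rule *)
  qed
  have hole_fk: "in_hole u ((f ^^ k) ` T) \<Longrightarrow> in_hole u T" if T: "T \<subseteq> {0..<n}" for T k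
  proof (induction k)
    case (Suc k)
    have "(f ^^ Suc k) ` T = f ` ((f ^^ k) ` T)" by (simp add: image_image)
    moreover have "(f ^^ k) ` T \<subseteq> {0..<n}" using fk T by blast
    ultimately show ?case using Suc hole_f by metis
  qed simp
  have cov0: "\<exists>B\<in>K. {0, y, z} \<subseteq> B"
    if yz: "y \<in> {0..<n}" "z \<in> {0..<n}" "y \<noteq> 0" "z \<noteq> 0" "y \<noteq> z" and nh: "\<not> in_hole u {0, y, z}" for y z
  proof -
    have "z \<in> set (needed_partners u n y)"
    proof (cases "y < u \<or> 3 * u \<le> y")
      case True
      have "\<not> (z < u \<or> 3 * u \<le> z)"
      proof
        assume "z < u \<or> 3 * u \<le> z"
        then have "\<forall>c\<in>{0, y, z}. cls u c = Some 0 \<or> cls u c = None" using True yz u by (auto simp: cls_def)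
        then have "in_hole u {0, y, z}" unfolding in_hole_def by (rule exI[of _ 0])
        then show False using nh by (rule notE[rotated])
      qed
      then show ?thesis using True by (auto simp: needed_partners_def)
    next
      case False
      then show ?thesis using yz by (auto simp: needed_partners_def)
    qed
    moreover have "y \<in> set [1..n - 1]" using yz by auto
    then have "sort (all_partners y (all_derived f ls)) = needed_partners u n y"
      using der unfolding check_derived_iff by blast
    then have "set (all_partners y (all_derived f ls)) = set (needed_partners u n y)" by (metis set_sort)
    ultimately obtain b t where "b \<in> set (orbit_blocks f ls)" "t \<in> set (through 0 b)" "z \<in> set (partners y t)"
      unfolding set_all_partners set_all_derived by blast
    then show ?thesis using partners_through[of t 0 b z y] by (auto simp: K_def)
  qed
  have covp: "\<exists>B\<in>K. {p, y, z} \<subseteq> B"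
    if r: "p \<in> {0..<n}" "y \<in> {0..<n}" "z \<in> {0..<n}" and d: "p \<noteq> y" "p \<noteq> z" "y \<noteq> z" and p: "p < 2 * u"
      and nh: "\<not> in_hole u {p, y, z}" for p y z
  proof -
    have "p \<in> set (orbit N f 0)" using p r trans by (metis set_sort atLeastAtMost_iff atLeastLessThan_iff set_upto zle_diff1_eq)
    then obtain j where j: "j < N" "p = (f ^^ j) 0" by (auto simp: set_orbit)
    \<comment> \<open>\<open>f ^^ k\<close> moves \<open>p\<close> to 0 and \<open>f ^^ j\<close>
      moves back, since \<open>f ^^ N\<close> is the identity.\<close>
    define k where "k = N - j"
    have kj: "k + j = N" "j + k = N" using j by (auto simp: k_def)
    have zero: "0 \<in> {0..<n}" using u s n by simp
    have "(f ^^ k) p = (f ^^ N) 0" unfolding j(2) kj(1)[symmetric] funpow_add by simp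
    then have kp: "(f ^^ k) p = 0" using fN[OF zero] by simp
    have return: "(f ^^ j) ((f ^^ k) c) = c" if "c \<in> {0..<n}" for c
      using fN[OF that] unfolding kj(2)[symmetric] funpow_add by simp
    let ?y = "(f ^^ k) y" and ?z = "(f ^^ k) z"
    have "?y \<noteq> 0" "?z \<noteq> 0" "?y \<noteq> ?z"
      using inj_onD[OF inj[of k] _ r(2,1)] inj_onD[OF inj[of k] _ r(3,1)] inj_onD[OF inj[of k] _ r(2,3)] d kp by auto
    moreover have "\<not> in_hole u {0, ?y, ?z}"
    proof
      assume "in_hole u {0, ?y, ?z}"
      then have "in_hole u ((f ^^ k) ` {p, y, z})" by (simp add: kp)
      then have "in_hole u {p, y, z}" by (rule hole_fk[rotated]) (use r in auto)
      then show False using nh by simp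
    qed
    ultimately obtain B where B: "B \<in> K" "{0, ?y, ?z} \<subseteq> B" using cov0[of ?y ?z] fk r by blast
    have "{p, y, z} = (f ^^ j) ` {0, ?y, ?z}" using return[OF r(1)] return[OF r(2)] return[OF r(3)] kp by simp
    then have "{p, y, z} \<subseteq> (f ^^ j) ` B" using B(2) by blast
    then show ?thesis using closedk[OF B(1)] by blast
  qed
  have "candelabra u s K" unfolding candelabra_def n[symmetric]
  proof (intro conjI ballI allI impI)
    fix B assume "B \<in> K"
    then obtain k b l bs where B: "(l, bs) \<in> set ls" "k < l" "b \<in> set bs" "B = (f ^^ k) ` bset b" using Kel by blast
    show "B \<subseteq> {0..<n}" using B(4) bas(1)[OF B(1,3)] fk by auto
    show "card B = 4" using B(4) bas(2)[OF B(1,3)] card_image[OF inj_on_subset[OF inj bas(1)[OF B(1,3)]]] by simp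
  next
    fix x y z assume r: "x \<in> {0..<n}" "y \<in> {0..<n}" "z \<in> {0..<n}" and d: "x \<noteq> y" "x \<noteq> z" "y \<noteq> z"
      and nh: "\<not> in_hole u {x, y, z}"
    \<comment> \<open>A triple without a point in the first two groups lies in the hole formed by
      the third group and the stem.\<close>
    have "x < 2 * u \<or> y < 2 * u \<or> z < 2 * u"
    proof (rule ccontr)
      assume "\<not> ?thesis"
      then have "\<forall>c\<in>{x, y, z}. cls u c = Some 2 \<or> cls u c = None" using clsg[OF r(1)] clsg[OF r(2)] clsg[OF r(3)] u by auto
      then have "in_hole u {x, y, z}" unfolding in_hole_def by (rule exI[of _ 2])
      then show False using nh by (rule notE[rotated])
    qed
    then show "\<exists>B\<in>K. {x, y, z} \<subseteq> B"
      using covp[OF r(1,2,3) d _ nh] covp[OF r(2,1,3)] covp[OF r(3,1,2)] d nh by (auto simp: insert_commute)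
  qed
  then show ?thesis by (simp add: K_def)
qed

lemma fillingI:
  assumes u: "u > 0" and ps: "ps = [0..u - 1] @ [3 * u..3 * u + s - 1]"
    and fill: "check_fill ps bs ps" and blocks: "check_fill_blocks ps bs"
  shows "filling u s (bset ` set bs)"
proof -
  have ps': "set ps = {0..<u} \<union> {3 * u..<3 * u + s}" "distinct ps" using u by (auto simp: ps)
  have cf: "check_fill ps bs xs \<Longrightarrow> x \<in> set xs \<Longrightarrow> check_fill_pairs ps x (concat (map (through x) bs)) ps" for x xs
    by (induction xs) auto
  have cp: "check_fill_pairs ps x D ys \<Longrightarrow> y \<in> set ys \<Longrightarrow> x \<noteq> y \<Longrightarrow> sort (all_partners y D) = remove1 x (remove1 y ps)" for x y D ys
    by (induction ys) auto
  have cb: "check_fill_blocks ps cs \<Longrightarrow> b \<in> set cs \<Longrightarrow> distinct (blist b) \<and> set (blist b) \<subseteq> set ps" for b cs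
    by (induction cs) (auto simp: list_all_iff)
  show ?thesis unfolding filling_def ps'(1)[symmetric]
  proof (intro conjI ballI allI impI)
    fix B assume "B \<in> bset ` set bs"
    then obtain b where b: "b \<in> set bs" "B = bset b" by blast
    show "B \<subseteq> set ps" using cb[OF blocks b(1)] b by (simp add: bset_def)
    show "card B = 4" using distinct_card[of "blist b"] cb[OF blocks b(1)] b by (cases b rule: prod_cases4) (simp add: bset_def blist_def)
  next
    fix x y z assume r: "x \<in> set ps" "y \<in> set ps" "z \<in> set ps" and d: "x \<noteq> y" "x \<noteq> z" "y \<noteq> z"
    have "sort (all_partners y (concat (map (through x) bs))) = remove1 x (remove1 y ps)"
      by (rule cp[OF cf[OF fill r(1)] r(2) d(1)])
    then have "set (all_partners y (concat (map (through x) bs))) = set (remove1 x (remove1 y ps))" by (metis set_sort)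
    moreover have "z \<in> set (remove1 x (remove1 y ps))" using r d ps'(2) by simp
    ultimately have "z \<in> (\<Union>t\<in>set (concat (map (through x) bs)). set (partners y t))"
      unfolding set_all_partners by simp
    then obtain b t where "b \<in> set bs" "t \<in> set (through x b)" "z \<in> set (partners y t)"
      unfolding set_concat set_map by blast
    then show "\<exists>B\<in>bset ` set bs. {x, y, z} \<subseteq> B" using partners_through[of t x b z y] by blast
  qed
qed

text \<open>The two numbers in these names are the group size \<open>u\<close> and the number of
  images of each base block that are listed.\<close>

definition base_2_1 :: "block4 list" where
  "base_2_1 =
    [(0,1,2,3)]"

definition base_2_2 :: "block4 list" where
  "base_2_2 =
    [(0,1,4,5)]"

definition base_2_4 :: "block4 list" where
  "base_2_4 =
    [(0,2,4,6), (0,2,5,7)]"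

definition base_6_3 :: "block4 list" where
  "base_6_3 =
    [(0,3,7,10)]"

definition base_6_6 :: "block4 list" where
  "base_6_6 =
    [(0,3,12,17), (0,3,13,16), (0,3,14,15)]"

definition base_6_12 :: "block4 list" where
  "base_6_12 =
    [(0,1,6,9), (0,1,7,8), (0,1,12,16), (0,1,13,14), (0,1,15,17), (0,2,6,16), (0,2,7,15),
     (0,2,8,10), (0,2,12,13), (0,2,14,17), (0,6,13,18), (0,6,14,19), (0,6,15,21), (0,6,17,20),
     (0,7,12,19), (0,7,13,21), (0,7,14,18), (0,7,16,20), (0,8,12,18), (0,8,13,19),
     (0,8,14,16), (0,8,15,20), (0,8,17,21)]"

definition base_12_12 :: "block4 list" where
  "base_12_12 =
    [(0,6,12,18), (0,6,13,19), (0,6,14,20), (0,6,24,33), (0,6,25,28), (0,6,26,31),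
     (0,6,27,30), (0,6,29,34), (0,6,32,35)]"

definition base_12_24 :: "block4 list" where
  "base_12_24 =
    [(0,1,12,26), (0,1,13,30), (0,1,14,18), (0,1,15,16), (0,1,17,22), (0,1,19,28),
     (0,1,23,32), (0,1,24,34), (0,1,25,27), (0,1,29,33), (0,1,31,35), (0,2,12,16),
     (0,2,13,27), (0,2,14,21), (0,2,15,17), (0,2,18,35), (0,2,19,23), (0,2,24,32),
     (0,2,25,26), (0,2,28,29), (0,2,30,31), (0,2,33,34), (0,3,12,30), (0,3,13,29),
     (0,3,14,27), (0,3,15,32), (0,3,16,34), (0,3,17,24), (0,3,18,33), (0,3,19,35),
     (0,3,20,26), (0,3,21,31), (0,3,22,25), (0,3,23,28), (0,4,12,17), (0,4,14,19),
     (0,4,15,20), (0,4,24,35), (0,4,25,33), (0,4,26,29), (0,4,27,34), (0,4,28,31),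
     (0,4,30,32), (0,5,17,33), (0,5,22,27), (0,5,24,26), (0,5,25,30), (0,5,28,35),
     (0,5,29,32), (0,5,31,34), (0,12,27,37), (0,12,31,36), (0,13,25,37), (0,13,31,32),
     (0,13,35,36), (0,14,25,36), (0,14,26,32), (0,14,28,34), (0,14,29,37), (0,14,31,33),
     (0,15,24,28), (0,15,25,31), (0,15,26,30), (0,15,34,36), (0,15,35,37), (0,16,24,29),
     (0,16,26,33), (0,16,27,36), (0,16,30,37), (0,17,27,35), (0,17,28,36), (0,17,31,37)]"

text \<open>A quadruple system of order 10 on the group \<open>0, ..., 5\<close> and the stem
  \<open>18, ..., 21\<close>, without the block formed by the stem itself: that block is shared by
  all groups and added once.\<close>

definition fill_10 :: "block4 list" where
  "fill_10 =
    [(0,1,18,19), (2,5,18,19), (3,4,18,19), (0,4,18,20), (1,2,18,20), (3,5,18,20), (0,2,3,18),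
     (0,5,18,21), (1,3,18,21), (1,4,5,18), (2,4,18,21), (0,2,19,20), (1,3,19,20), (4,5,19,20),
     (0,4,19,21), (0,3,5,19), (1,2,4,19), (1,5,19,21), (2,3,19,21), (0,1,5,20), (0,3,20,21),
     (1,4,20,21), (2,5,20,21), (2,3,4,20), (0,1,2,21), (0,1,3,4), (0,2,4,5), (1,2,3,5),
     (3,4,5,21)]"

definition fill_14 :: "block4 list" where
  "fill_14 =
    [(0,1,2,4), (0,1,3,6), (0,1,5,9), (0,1,7,8), (0,1,10,11), (0,1,36,37), (0,2,3,11),
     (0,2,5,6), (0,2,7,9), (0,2,8,37), (0,2,10,36), (0,3,4,5), (0,3,7,10), (0,3,8,36),
     (0,3,9,37), (0,4,6,8), (0,4,7,11), (0,4,9,36), (0,4,10,37), (0,5,7,36), (0,5,8,10),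
     (0,5,11,37), (0,6,7,37), (0,6,9,10), (0,6,11,36), (0,8,9,11), (1,2,3,5), (1,2,6,10),
     (1,2,7,37), (1,2,8,9), (1,2,11,36), (1,3,4,36), (1,3,7,9), (1,3,8,10), (1,3,11,37),
     (1,4,5,6), (1,4,7,10), (1,4,8,11), (1,4,9,37), (1,5,7,11), (1,5,8,36), (1,5,10,37),
     (1,6,7,36), (1,6,8,37), (1,6,9,11), (1,9,10,36), (2,3,4,6), (2,3,7,8), (2,3,9,10),
     (2,3,36,37), (2,4,5,37), (2,4,7,36), (2,4,8,10), (2,4,9,11), (2,5,7,10), (2,5,8,11),
     (2,5,9,36), (2,6,7,11), (2,6,8,36), (2,6,9,37), (2,10,11,37), (3,4,7,37), (3,4,8,9),
     (3,4,10,11), (3,5,6,7), (3,5,8,37), (3,5,9,11), (3,5,10,36), (3,6,8,11), (3,6,9,36),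
     (3,6,10,37), (3,7,11,36), (4,5,7,8), (4,5,9,10), (4,5,11,36), (4,6,7,9), (4,6,10,36),
     (4,6,11,37), (4,8,36,37), (5,6,8,9), (5,6,10,11), (5,6,36,37), (5,7,9,37), (6,7,8,10),
     (7,8,9,36), (7,8,11,37), (7,9,10,11), (7,10,36,37), (8,9,10,37), (8,10,11,36),
     (9,11,36,37)]"

text \<open>These generators act on the first two groups as one cycle of length \<open>2 u\<close>,
  which alternates between them; on the third group and the stem their cycle lengths divide
  \<open>2 u\<close>.\<close>

definition gen_2 :: "int \<Rightarrow> int" where
  "gen_2 c = (if c < 2 then c + 2 else if c = 2 then 1 else if c = 3 then 0
     else if c = 4 then 5 else if c = 5 then 4 else c)"

definition gen_6 :: "int \<Rightarrow> int" where
  "gen_6 c = (if c = 0 then 11 else if c < 6 then c + 5 else if c < 12 then c - 6 else if c < 17 then c + 1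
     else if c = 17 then 12 else if c = 18 then 21 else if c = 19 then 18 else if c = 21 then 19 else c)"

definition gen_12 :: "int \<Rightarrow> int" where
  "gen_12 c = (if c < 12 then c + 12 else if c < 23 then c - 11 else if c = 23 then 0
     else if c = 29 then 24 else if c = 35 then 30 else if c < 36 then c + 1 else c)"

lemma candelabra_2: "candelabra 2 2 (bset ` set (orbit_blocks gen_2 [(1, base_2_1), (2, base_2_2), (4, base_2_4)]))"
  by (rule candelabraI[OF _ _ refl refl]; code_simp)

lemma candelabra_6: "candelabra 6 4 (bset ` set (orbit_blocks gen_6 [(3, base_6_3), (6, base_6_6), (12, base_6_12)]))"
  by (rule candelabraI[OF _ _ refl refl]; code_simp)

lemma candelabra_12: "candelabra 12 2 (bset ` set (orbit_blocks gen_12 [(12, base_12_12), (24, base_12_24)]))"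
  by (rule candelabraI[OF _ _ refl refl]; code_simp)

lemma filling_2: "filling 2 2 (bset ` set [(0,1,6,7)])"
  by (rule fillingI[OF _ refl]; code_simp)

lemma filling_6: "filling 6 4 (bset ` set (fill_10 @ [(18,19,20,21)]))"
  by (rule fillingI[OF _ refl]; code_simp)

lemma filling_12: "filling 12 2 (bset ` set fill_14)"
  by (rule fillingI[OF _ refl]; code_simp)

lemma card_bset_orbit_blocks:
  "card (bset ` set (orbit_blocks f ls)) \<le> (\<Sum>(l, bs)\<leftarrow>ls. l * length bs)"
proof -
  have "length (orbit_blocks f ls) = (\<Sum>(l, bs)\<leftarrow>ls. l * length bs)"
    by (induction f ls rule: orbit_blocks.induct) (auto simp: length_orbits)
  then show ?thesis using card_image_le[of "set (orbit_blocks f ls)" bset] card_length[of "orbit_blocks f ls"]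
    by simp
qed

subsection \<open>The recursion\<close>

text \<open>Each trade avoiding \<open>o'\<close> lifts in \<open>u ^ 4\<close> ways: three free
  starting levels and a slope \<open>h\<close>. The levels at indices \<open>i\<close>,
  \<open>j\<close>, \<open>k\<close>, \<open>l\<close> add up to \<open>(i + j + k + l) * h\<close>,
  which is 0, so the lifted quadruples are transversals in the new system. A point of the stem is
  the new point to be avoided, which requires \<open>s > 0\<close>.\<close>

lemma inflate_rich:
  fixes u s :: int
  assumes R: "rich v \<tau>" and v: "v \<ge> 2" "v \<noteq> 3" and u: "u > 0" "u dvd 12" and s: "s > 0"
    and K: "candelabra u s K" "card K \<le> k0"
    and F: "filling u s (F1 \<union> F0)" "\<And>b. b \<in> F0 \<Longrightarrow> b \<subseteq> {3 * u..<3 * u + s}"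
      "card F1 \<le> f1" "card F0 \<le> f0"
    and n: "n = (v - 1) * nat u + nat s"
    and num: "nat u ^ 3 * ((v - 1) * (v - 2) * (v - 4)) + 4 * k0 * ((v - 1) * (v - 2)) + 24 * f1 * (v - 1) + 24 * f0
      \<le> n * (n - 1) * (n - 2)"
  shows "rich n (nat u ^ 4 * \<tau>)"
proof -
  obtain B o' where B: "is_SQS {0..<v} B" "o' < v" "\<tau> \<le> card (avoiding_trades B o')"
    using R unfolding rich_def by blast
  let ?X = "{0..<v} - {o'}"
  have "\<exists>B'. is_SQS (blow_points u s ?X) B' \<and> (\<forall>b\<in>B. o' \<notin> b \<longrightarrow> transversals u b \<subseteq> B')"
  proof (rule inflate[OF _ B(1) _ v _ u(1) _ K F n num])
    show "card {0..<v} = v" by simp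
  qed (use B(2) s in simp_all)
  then obtain B' where B': "is_SQS (blow_points u s ?X) B'" "\<And>b. b \<in> B \<Longrightarrow> o' \<notin> b \<Longrightarrow> transversals u b \<subseteq> B'" by blast
  let ?U = "{0..<u}"
  define A where "A = avoiding_trades B o' \<times> ?U \<times> ?U \<times> ?U \<times> ?U"
  define G :: "nat quad_fun \<times> int \<times> int \<times> int \<times> int \<Rightarrow> (nat option \<times> int) quad_fun" where
    "G = (\<lambda>((p, q, r, t), (x, y, z, h)). ((\<lambda>i. (Some (p i), (x + i * h) mod u)), (\<lambda>i. (Some (q i), (y + i * h) mod u)),
       (\<lambda>i. (Some (r i), (z + i * h) mod u)), (\<lambda>i. (Some (t i), (- x - y - z + i * h) mod u))))"
  \<comment> \<open>Divisibility of 12 by \<open>u\<close> makes the levels periodic for every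
    slope.\<close>
  have per: "(a + (i + 12) * h) mod u = (a + i * h) mod u" for a i h
  proof -
    obtain c where c: "12 = u * c" using u(2) by (rule dvdE)
    have "a + (i + 12) * h = (a + i * h) + u * (c * h)" unfolding c by (simp add: algebra_simps)
    then show ?thesis by (simp only: mod_mult_self2)
  qed
  have sum_mod: "(a mod u + b mod u + c mod u + d mod u) mod u = (a + b + c + d) mod u" for a b c d
    by (intro mod_add_cong mod_mod_trivial)
  have sub: "G ` A \<subseteq> avoiding_trades B' (None, 0)"
  proof
    fix g assume "g \<in> G ` A"
    then obtain p q r t x y z h where t: "trade B p q r t" "\<And>i. o' \<notin> {p i, q i, r i, t i}"
      and g: "g = G ((p, q, r, t), (x, y, z, h))" unfolding A_def by auto
    have "{(Some (p i), (x + i * h) mod u), (Some (q j), (y + j * h) mod u), (Some (r k), (z + k * h) mod u),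
       (Some (t l), (- x - y - z + l * h) mod u)} \<in> B'" if l: "l = - i - j - k" for i j k l
    proof -
      have b: "{p i, q j, r k, t l} \<in> B" by (rule trade_block[OF t(1)]) (simp add: l)
      have "(x + i * h) + (y + j * h) + (z + k * h) + (- x - y - z + l * h) = 0" by (simp add: l algebra_simps)
      then have "((x + i * h) mod u + (y + j * h) mod u + (z + k * h) mod u + (- x - y - z + l * h) mod u) mod u = 0"
        by (simp only: sum_mod mod_0)
      then have "u dvd (x + i * h) mod u + (y + j * h) mod u + (z + k * h) mod u + (- x - y - z + l * h) mod u"
        by (simp only: dvd_eq_mod_eq_0)
      then have "{(Some (p i), (x + i * h) mod u), (Some (q j), (y + j * h) mod u), (Some (r k), (z + k * h) mod u),
         (Some (t l), (- x - y - z + l * h) mod u)} \<in> transversals u {p i, q j, r k, t l}"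
        using is_SQS_blockD[OF B(1) b] u(1) by (intro transversalsI) auto
      moreover have "o' \<notin> {p i, q j, r k, t l}" using t(2)[of i] t(2)[of j] t(2)[of k] t(2)[of l] by auto
      ultimately show ?thesis using B'(2)[OF b] by blast
    qed
    then show "g \<in> avoiding_trades B' (None, 0)"
      using t(1) unfolding g G_def by (auto simp: trade_def per)
  qed
  have cancel: "a = b" if "a mod u = b mod u" "a \<in> ?U" "b \<in> ?U" for a b using that by simp
  have inj: "inj_on G A"
  proof (rule inj_onI)
    fix a b assume ab: "a \<in> A" "b \<in> A" "G a = G b"
    obtain p q r t x y z h where a: "a = ((p, q, r, t), (x, y, z, h))" by (cases a) auto
    obtain p' q' r' t' x' y' z' h' where b: "b = ((p', q', r', t'), (x', y', z', h'))" by (cases b) auto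
    have e: "p i = p' i" "q i = q' i" "r i = r' i" "t i = t' i" "(x + i * h) mod u = (x' + i * h') mod u"
      "(y + i * h) mod u = (y' + i * h') mod u" "(z + i * h) mod u = (z' + i * h') mod u" for i
      using ab(3) unfolding a b G_def by (auto simp: fun_eq_iff)
    have U: "x \<in> ?U" "y \<in> ?U" "z \<in> ?U" "h \<in> ?U" "x' \<in> ?U" "y' \<in> ?U" "z' \<in> ?U" "h' \<in> ?U"
      using ab(1,2) unfolding a b A_def by auto
    have xyz: "x = x'" "y = y'" "z = z'"
      using e(5)[of 0] e(6)[of 0] e(7)[of 0] U by simp_all
    have "(x + h) mod u = (x + h') mod u" using e(5)[of 1] xyz by simp
    then have "((x + h) - x) mod u = ((x + h') - x) mod u" by (rule mod_diff_cong) simp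
    then have "h = h'" using U by simp
    then show "a = b" using xyz e(1-4) unfolding a b by (simp add: fun_eq_iff)
  qed
  have cA: "nat u ^ 4 * \<tau> \<le> card A"
    using B(3) unfolding A_def card_cartesian_product by (simp add: power4_eq_xxxx algebra_simps)
  have cn: "card (blow_points u s ?X) = n" using card_blow_points(2)[of ?X u s] B(2) n by simp
  show ?thesis
    by (rule richI[OF card_blow_points(1) cn B'(1) _ inj sub cA]) (use s in \<open>simp_all add: blow_points_def\<close>)
qed

lemma card_bset_le: "card (bset ` set bs) \<le> length bs"
  by (rule order_trans[OF card_image_le card_length]) simp

text \<open>Here \<open>u = 2\<close>, \<open>s = 2\<close>. The constant
  \<open>11 = 1 + 2 + 4 * 2\<close> counts the candelabra blocks by orbits, and one block fills a
  group with the stem.\<close>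

lemma rich_double:
  assumes "rich v \<tau>" "v = 2 \<or> v \<ge> 4"
  shows "rich (2 * v) (2 ^ 4 * \<tau>)"
proof -
  have num: "nat 2 ^ 3 * ((v - 1) * (v - 2) * (v - 4)) + 4 * 11 * ((v - 1) * (v - 2)) + 24 * 1 * (v - 1) + 24 * 0
    \<le> (2 * v) * (2 * v - 1) * (2 * v - 2)"
  proof (cases "v = 2")
    case False
    then obtain w where "v = w + 4" using assms(2) by (metis add.commute le_Suc_ex)
    then show ?thesis by (simp add: algebra_simps)
  qed simp
  have f: "filling 2 2 (bset ` set [(0,1,6,7)] \<union> {})" using filling_2 by simp
  have "rich (2 * v) (nat 2 ^ 4 * \<tau>)"
  proof (rule inflate_rich[OF assms(1) _ _ _ _ _ candelabra_2 _ f _ _ _ _ num])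
    show "card (bset ` set (orbit_blocks gen_2 [(1, base_2_1), (2, base_2_2), (4, base_2_4)])) \<le> 11"
      by (rule order_trans[OF card_bset_orbit_blocks]) (simp add: base_2_1_def base_2_2_def base_2_4_def)
    show "card (bset ` set [(0,1,6,7)]) \<le> 1" using card_bset_le[of "[(0,1,6,7)]"] by simp
  qed (use assms(2) in auto)
  then show ?thesis by simp
qed

text \<open>Here \<open>u = 6\<close>, \<open>s = 4\<close>. The constant 297 is
  \<open>3 + 6 * 3 + 12 * 23\<close>; the filling of order 10 has 30 blocks, one of them the
  stem.\<close>

lemma rich_sextuple:
  assumes "rich v \<tau>" "v = 2 \<or> v \<ge> 4"
  shows "rich (6 * v - 2) (6 ^ 4 * \<tau>)"
proof -
  have num: "nat 6 ^ 3 * ((v - 1) * (v - 2) * (v - 4)) + 4 * 297 * ((v - 1) * (v - 2)) + 24 * 29 * (v - 1) + 24 * 1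
    \<le> (6 * v - 2) * (6 * v - 2 - 1) * (6 * v - 2 - 2)"
  proof (cases "v = 2")
    case False
    then obtain w where "v = w + 4" using assms(2) by (metis add.commute le_Suc_ex)
    then show ?thesis by (simp add: algebra_simps)
  qed simp
  have f: "filling 6 4 (bset ` set fill_10 \<union> {bset (18,19,20,21)})" using filling_6 by (simp add: image_Un)
  have "rich (6 * v - 2) (nat 6 ^ 4 * \<tau>)"
  proof (rule inflate_rich[OF assms(1) _ _ _ _ _ candelabra_6 _ f _ _ _ _ num])
    show "card (bset ` set (orbit_blocks gen_6 [(3, base_6_3), (6, base_6_6), (12, base_6_12)])) \<le> 297"
      by (rule order_trans[OF card_bset_orbit_blocks]) (simp add: base_6_3_def base_6_6_def base_6_12_def)
    show "card (bset ` set fill_10) \<le> 29" by (rule order_trans[OF card_bset_le]) (simp add: fill_10_def)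
    show "b \<subseteq> {3 * 6..<3 * 6 + 4}" if "b \<in> {bset (18,19,20,21)}" for b using that by (auto simp: bset_def blist_def)
  qed (use assms(2) in auto)
  then show ?thesis by simp
qed

text \<open>Here \<open>u = 12\<close>, \<open>s = 2\<close>. The constant 1836 is
  \<open>12 * 9 + 24 * 72\<close>, and 91 is the number of blocks of a system of order 14.\<close>

lemma rich_twelvefold:
  assumes "rich v \<tau>" "v = 2 \<or> v \<ge> 4"
  shows "rich (12 * v - 10) (12 ^ 4 * \<tau>)"
proof -
  have num: "nat 12 ^ 3 * ((v - 1) * (v - 2) * (v - 4)) + 4 * 1836 * ((v - 1) * (v - 2)) + 24 * 91 * (v - 1) + 24 * 0
    \<le> (12 * v - 10) * (12 * v - 10 - 1) * (12 * v - 10 - 2)"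
  proof (cases "v = 2")
    case False
    then obtain w where "v = w + 4" using assms(2) by (metis add.commute le_Suc_ex)
    then show ?thesis by (simp add: algebra_simps)
  qed simp
  have f: "filling 12 2 (bset ` set fill_14 \<union> {})" using filling_12 by simp
  have "rich (12 * v - 10) (nat 12 ^ 4 * \<tau>)"
  proof (rule inflate_rich[OF assms(1) _ _ _ _ _ candelabra_12 _ f _ _ _ _ num])
    show "card (bset ` set (orbit_blocks gen_12 [(12, base_12_12), (24, base_12_24)])) \<le> 1836"
      by (rule order_trans[OF card_bset_orbit_blocks]) (simp add: base_12_12_def base_12_24_def)
    show "card (bset ` set fill_14) \<le> 91" by (rule order_trans[OF card_bset_le]) (simp add: fill_14_def)
  qed (use assms(2) in auto)
  then show ?thesis by simp
qed

text \<open>A single block with constant sequences is a trade, and \<open>n \<ge> 5\<close> leaves a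
  point outside it. This suffices for small orders.\<close>

lemma rich_one:
  assumes "rich n 0" "n \<ge> 5"
  shows "rich n 1"
proof -
  obtain B where B: "is_SQS {0..<n} B" using assms(1) unfolding rich_def by blast
  obtain w where w: "{0, 1, 2, w} \<in> B" by (rule is_SQS_ex[OF B, of 0 1 2]) (use assms(2) in auto)
  have "{0, 1, 2, w} \<subseteq> {0..<n}" "card {0, 1, 2, w} = 4" using is_SQS_blockD[OF B w] by blast+
  then have "card ({0..<n} - {0, 1, 2, w}) \<noteq> 0" using assms(2) by (subst card_Diff_subset) auto
  then have "{0..<n} - {0, 1, 2, w} \<noteq> {}" by (metis card.empty)
  then obtain o' where o': "o' \<in> {0..<n} - {0, 1, 2, w}" by blast
  let ?t = "((\<lambda>_. 0, \<lambda>_. 1, \<lambda>_. 2, \<lambda>_. w) :: nat quad_fun)"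
  have "trade B (\<lambda>_. 0) (\<lambda>_. 1) (\<lambda>_. 2) (\<lambda>_. w)" unfolding trade_def using w by blast
  then have t: "id ` {?t} \<subseteq> avoiding_trades B o'" using o' by simp
  show ?thesis by (rule richI[OF _ _ B _ _ t]) (use o' in simp_all)
qed

lemma many_colour_trades_double:
  assumes C: "many \<tau> (colour_trades h (h - 1) \<psi>)" and m: "h - 1 \<le> m"
    and e: "\<And>x y. x < h \<Longrightarrow> y < h \<Longrightarrow> x \<noteq> y \<Longrightarrow> \<phi> (2 * x) (2 * y) = \<psi> x y"
  shows "many \<tau> (colour_trades (2 * h) m \<phi>)"
proof -
  obtain F where F: "inj_on F {..<\<tau>}" "F ` {..<\<tau>} \<subseteq> colour_trades h (h - 1) \<psi>" using C by (auto simp: many_def)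
  define G :: "nat quad_fun \<Rightarrow> nat quad_fun"
    where "G = (\<lambda>(p, q, r, s). (\<lambda>i. 2 * p i, \<lambda>i. 2 * q i, \<lambda>i. 2 * r i, \<lambda>i. 2 * s i))"
  have G: "G t \<in> colour_trades (2 * h) m \<phi>" if "t \<in> colour_trades h (h - 1) \<psi>" for t
  proof -
    obtain p q r s where t: "t = (p, q, r, s)" by (cases t)
    have l: "\<forall>i. p i < h \<and> q i < h \<and> r i < h \<and> s i < h"
      and c: "\<forall>i j k l. i + j + k + l = 0 \<longrightarrow> p i \<noteq> q j \<and> r k \<noteq> s l \<and> \<psi> (p i) (q j) < h - 1 \<and> \<psi> (p i) (q j) = \<psi> (r k) (s l)"
      and per: "\<forall>i. p (i + 12) = p i \<and> q (i + 12) = q i \<and> r (i + 12) = r i \<and> s (i + 12) = s i"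
      using that unfolding t colour_trades_def mem_Collect_eq prod.case by - (elim conjE, assumption)+
    have "2 * p i \<noteq> 2 * q j \<and> 2 * r k \<noteq> 2 * s l' \<and> \<phi> (2 * p i) (2 * q j) < m \<and> \<phi> (2 * p i) (2 * q j) = \<phi> (2 * r k) (2 * s l')"
      if "i + j + k + l' = 0" for i j k l'
    proof -
      have c': "p i \<noteq> q j" "r k \<noteq> s l'" "\<psi> (p i) (q j) < h - 1" "\<psi> (p i) (q j) = \<psi> (r k) (s l')" using c that by blast+
      have "\<phi> (2 * p i) (2 * q j) = \<psi> (p i) (q j)" by (rule e) (use l c' in simp_all)
      moreover have "\<phi> (2 * r k) (2 * s l') = \<psi> (r k) (s l')" by (rule e) (use l c' in simp_all)
      ultimately show ?thesis using c' m by simp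
    qed
    then have "\<forall>i j k l. i + j + k + l = 0 \<longrightarrow> 2 * p i \<noteq> 2 * q j \<and> 2 * r k \<noteq> 2 * s l \<and>
      \<phi> (2 * p i) (2 * q j) < m \<and> \<phi> (2 * p i) (2 * q j) = \<phi> (2 * r k) (2 * s l)" by blast
    moreover have "\<forall>i. 2 * p i < 2 * h \<and> 2 * q i < 2 * h \<and> 2 * r i < 2 * h \<and> 2 * s i < 2 * h" using l by simp
    moreover have "\<forall>i. 2 * p (i + 12) = 2 * p i \<and> 2 * q (i + 12) = 2 * q i \<and> 2 * r (i + 12) = 2 * r i \<and> 2 * s (i + 12) = 2 * s i"
      using per by simp
    ultimately show ?thesis unfolding t G_def colour_trades_def prod.case mem_Collect_eq by (intro conjI)
  qed
  have "inj G" by (auto simp: inj_on_def G_def fun_eq_iff)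
  then have "inj_on (G \<circ> F) {..<\<tau>}" using F(1) by (intro comp_inj_on) (auto intro: inj_on_subset)
  moreover have "(G \<circ> F) ` {..<\<tau>} \<subseteq> colour_trades (2 * h) m \<phi>" 
    by (rule image_subsetI) (use F(2) G in \<open>simp add: image_subset_iff\<close>)
  ultimately show ?thesis unfolding many_def by blast
qed

text \<open>Tripling with \<open>s = 2\<close>, where \<open>g = 6 * r + 2 = 24 * j + 20\<close> and
  the half \<open>h\<close> is even. The trades are new ones, from a rich factorization of order
  \<open>h\<close> on the even vertices; the system to be tripled need not have any.\<close>

lemma triple_two:
  assumes "rich (24 * j + 22) 0"
  shows "\<exists>\<tau>. rich (72 * j + 62) \<tau> \<and> (12 * j + 10) ^ 4 \<le> 4096 * \<tau>"
proof -
  define h r g where "h = 12 * j + 10" and "r = 4 * j + 3" and "g = 2 * h"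
  obtain B0 where B0: "is_SQS {0..<24 * j + 22} B0" using assms unfolding rich_def by blast
  obtain \<psi> \<tau> where \<psi>: "one_factorization h \<psi>" "many \<tau> (colour_trades h (h - 1) \<psi>)" "h ^ 4 \<le> 4096 * \<tau>"
    using rich_one_factorization[of h] unfolding h_def by auto
  have h: "even h" "2 * r < h" by (auto simp: h_def r_def)
  obtain \<phi> where col: "colouring g (g - 1 - 2 * r) \<phi>"
    and far: "\<And>x y. \<lbrakk>x < g; y < g; x \<noteq> y; \<not> \<phi> x y < g - 1 - 2 * r\<rbrakk> \<Longrightarrow> \<exists>d. odd d \<and> d < 2 * r \<and> (am g x d = y \<or> am g y d = x)"
    and ext: "\<And>x y. x < h \<Longrightarrow> y < h \<Longrightarrow> x \<noteq> y \<Longrightarrow> \<phi> (2 * x) (2 * y) = \<psi> x y"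
    using circulant_even_half[OF h \<psi>(1)] unfolding g_def by blast
  have "{b \<in> B0. b \<subseteq> {0, 1}} = {}"
  proof (rule equals0I)
    fix b assume "b \<in> {b \<in> B0. b \<subseteq> {0, 1}}"
    then have b: "b \<in> B0" "b \<subseteq> {0, 1}" by simp_all
    have "card b \<le> card {0::nat, 1}" by (rule card_mono[OF _ b(2)]) simp
    then show False using is_SQS_blockD[OF B0 b(1)] by simp
  qed
  then have stem: "24 * card {b \<in> B0. b \<subseteq> {0, 1}} = 2 * (2 - 1) * (2 - 2)" by (simp only: card.empty) simp
  have "\<exists>B e. is_SQS ({..<3} \<times> {..<g} \<union> {3} \<times> {..<2}) B \<and> quads22 0 1 g (g - 1 - 2 * r) \<phi> \<subseteq> B \<and>
    inj_on e {0..<24 * j + 22} \<and> (`) e ` B0 \<subseteq> B \<and> (\<forall>x. fst (e x) \<noteq> 1)"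
    by (rule triple[OF _ B0 _ _ _ stem _ _ _ col far]) (auto simp: g_def h_def r_def)
  then obtain B where B: "is_SQS ({..<3} \<times> {..<g} \<union> {3} \<times> {..<2}) B" "quads22 0 1 g (g - 1 - 2 * r) \<phi> \<subseteq> B" by blast
  have "h - 1 \<le> g - 1 - 2 * r" using h(2) by (simp add: g_def)
  then have "many \<tau> (colour_trades g (g - 1 - 2 * r) \<phi>)"
    unfolding g_def using many_colour_trades_double[OF \<psi>(2) _ ext] by (simp add: g_def)
  from many_quad_trades[OF this B(2), of "(3, 0)"]
  obtain F :: "nat \<Rightarrow> (nat \<times> nat) quad_fun" where F: "inj_on F {..<\<tau>}" "F ` {..<\<tau>} \<subseteq> avoiding_trades B (3, 0)" by auto
  have cn: "card ({..<3} \<times> {..<g} \<union> {3::nat} \<times> {..<2::nat}) = 72 * j + 62"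
    by (subst card_Un_disjoint) (auto simp: card_cartesian_product g_def h_def)
  have "rich (72 * j + 62) \<tau>"
    by (rule richI[OF _ cn B(1) _ F]) auto
  then show ?thesis using \<psi>(3) unfolding h_def by blast
qed

text \<open>Tripling with a block as stem, \<open>s = 4\<close>. The half \<open>h\<close> is odd,
  so no rich factorization of that order can be placed on the even vertices; the trades are
  inherited through the embedded copy of the given system and avoid a point of copy 1.\<close>

lemma triple_four:
  assumes "rich (24 * j + 26) \<tau>"
  shows "rich (72 * j + 70) \<tau>"
proof -
  define h r g where "h = 12 * j + 11" and "r = 4 * j + 3" and "g = 2 * h"
  obtain B0 o' where B0: "is_SQS {0..<24 * j + 26} B0" "\<tau> \<le> card (avoiding_trades B0 o')"
    using assms unfolding rich_def by blast
  have h: "odd h" "2 * r < h" by (auto simp: h_def r_def)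
  obtain \<phi> where col: "colouring g (g - 1 - 2 * r) \<phi>"
    and far: "\<And>x y. \<lbrakk>x < g; y < g; x \<noteq> y; \<not> \<phi> x y < g - 1 - 2 * r\<rbrakk> \<Longrightarrow> \<exists>d. odd d \<and> d < 2 * r \<and> (am g x d = y \<or> am g y d = x)"
    using circulant_odd_half[OF h] unfolding g_def by blast
  obtain w where w: "{0, 1, 2, w} \<in> B0" by (rule is_SQS_ex[OF B0(1), of 0 1 2]) auto
  define S0 where "S0 = {0, 1, 2, w}"
  have S0: "S0 \<in> B0" "S0 \<subseteq> {0..<24 * j + 26}" "card S0 = 4" using w is_SQS_blockD[OF B0(1) w] unfolding S0_def by blast+
  have "{b \<in> B0. b \<subseteq> S0} = {S0}"
  proof -
    have "b = S0" if "b \<in> B0" "b \<subseteq> S0" for b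
      using card_subset_eq[of S0 b] that S0 is_SQS_blockD[OF B0(1) that(1)] by (simp add: S0_def)
    then show ?thesis using S0(1) by blast
  qed
  then have stem: "24 * card {b \<in> B0. b \<subseteq> S0} = 4 * (4 - 1) * (4 - 2)" by simp
  have "\<exists>B e. is_SQS ({..<3} \<times> {..<g} \<union> {3} \<times> {..<4}) B \<and> quads22 0 1 g (g - 1 - 2 * r) \<phi> \<subseteq> B \<and>
    inj_on e {0..<24 * j + 26} \<and> (`) e ` B0 \<subseteq> B \<and> (\<forall>x. fst (e x) \<noteq> 1)"
    by (rule triple[OF _ B0(1) S0(2,3) _ stem _ _ _ col far]) (auto simp: g_def h_def r_def)
  then obtain B e where Be: "is_SQS ({..<3} \<times> {..<g} \<union> {3} \<times> {..<4}) B \<and> quads22 0 1 g (g - 1 - 2 * r) \<phi> \<subseteq> B \<and>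
    inj_on e {0..<24 * j + 26} \<and> (`) e ` B0 \<subseteq> B \<and> (\<forall>x. fst (e x) \<noteq> 1)" by (elim exE) (rule that)
  have B: "is_SQS ({..<3} \<times> {..<g} \<union> {3} \<times> {..<4}) B" and e: "inj_on e {0..<24 * j + 26}" "(`) e ` B0 \<subseteq> B"
    "fst (e x) \<noteq> 1" for x using Be by simp_all
  let ?G = "\<lambda>(p, q, r, s). (e \<circ> p, e \<circ> q, e \<circ> r, e \<circ> s)"
  have sub: "?G ` avoiding_trades B0 o' \<subseteq> avoiding_trades B (1, 0)"
  proof
    fix t assume "t \<in> ?G ` avoiding_trades B0 o'"
    then obtain p q r s where t: "t = (e \<circ> p, e \<circ> q, e \<circ> r, e \<circ> s)" "trade B0 p q r s" by auto
    have "trade B (e \<circ> p) (e \<circ> q) (e \<circ> r) (e \<circ> s)" using trade_image[OF t(2), of e] e(2) unfolding trade_def by blast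
    moreover have "(1, 0) \<noteq> e x" for x using e(3)[of x] by (metis fst_conv)
    ultimately show "t \<in> avoiding_trades B (1, 0)" unfolding t(1) by simp
  qed
  have cn: "card ({..<3} \<times> {..<g} \<union> {3::nat} \<times> {..<4::nat}) = 72 * j + 70"
    by (subst card_Un_disjoint) (auto simp: card_cartesian_product g_def h_def)
  show ?thesis
    by (rule richI[OF _ cn B _ inj_on_comp_trades[OF B0(1) e(1)] sub B0(2)]) (auto simp: g_def h_def)
qed

lemma rich_two: "rich 2 0"
proof -
  have "is_SQS {0..<2::nat} {}"
    unfolding is_SQS_def
  proof (intro conjI allI impI)
    fix T :: "nat set" assume T: "T \<subseteq> {0..<2} \<and> card T = 3"
    have "card T \<le> card {0..<2::nat}" by (rule card_mono) (use T in simp_all)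
    then show "\<exists>!b. b \<in> {} \<and> T \<subseteq> b" using T by simp
  qed simp
  then show ?thesis unfolding rich_def by (intro exI[of _ "{}"] exI[of _ 0]) simp
qed

lemma power4_bound:
  fixes n c m t :: nat
  assumes "n \<le> c * m" "m ^ 4 \<le> d * t" "c ^ 4 * d \<le> D"
  shows "n ^ 4 \<le> D * t"
proof -
  have "n ^ 4 \<le> (c * m) ^ 4" using assms(1) by (intro power_mono) auto
  also have "\<dots> = c ^ 4 * m ^ 4" by (simp add: power_mult_distrib)
  also have "\<dots> \<le> c ^ 4 * (d * t)" using assms(2) by simp
  also have "\<dots> = (c ^ 4 * d) * t" by simp
  also have "\<dots> \<le> D * t" using assms(3) by (rule mult_le_mono1)
  finally show ?thesis .
qed

text \<open>Modulo 72, doubling covers the residues 4 and 8 modulo 12, and quadrupling those that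
  are 2 modulo 8. What remains are 14 and 38 for the factor 12, 22 and 46 for the factor 6, and 62
  and 70 for tripling. The order 2 starts the recursion.\<close>

lemma residue_cases:
  fixes n :: nat
  assumes "n mod 6 = 2 \<or> n mod 6 = 4"
  obtains v where "n = 2 * v" "v mod 6 = 2 \<or> v mod 6 = 4"
  | "n = 2"
  | k where "n = 8 * k + 2" "k > 0" "(2 * k + 2) mod 6 = 2 \<or> (2 * k + 2) mod 6 = 4"
  | v where "n = 12 * v - 10" "v mod 6 = 2 \<or> v mod 6 = 4"
  | v where "n = 6 * v - 2" "v mod 6 = 2 \<or> v mod 6 = 4"
  | j where "n = 72 * j + 62"
  | j where "n = 72 * j + 70"
proof -
  define t where "t = n div 72"
  define m where "m = n mod 72"
  have n: "n = 72 * t + m" "m < 72" by (simp_all add: t_def m_def)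
  have "n = m + 6 * (12 * t)" using n(1) by simp
  then have "n mod 6 = m mod 6" by (simp only: mod_mult_self2)
  then have m6: "m mod 6 = 2 \<or> m mod 6 = 4" using assms by simp
  have md: "(6 * a + 2) mod 6 = 2" "(6 * a + 4) mod 6 = 4" for a :: nat by presburger+
  consider "m mod 12 = 4 \<or> m mod 12 = 8" | "m mod 8 = 2" | "m = 14" | "m = 38" | "m = 22" | "m = 46" | "m = 62" | "m = 70"
  proof -
    have "\<forall>m\<in>set [0..<72]. m mod 6 = 2 \<or> m mod 6 = 4 \<longrightarrow> m mod 12 = 4 \<or> m mod 12 = 8 \<or> m mod 8 = 2 \<or>
      m \<in> {14, 38, 22, 46, 62, 70 :: nat}" by code_simp
    moreover have "m \<in> set [0..<72]" using n(2) by simp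
    ultimately show ?thesis using m6 that by blast
  qed
  then show thesis
  proof cases
    case 1
    have "n = m + 12 * (6 * t)" using n(1) by simp
    then have "n mod 12 = m mod 12" by (simp only: mod_mult_self2)
    then have n12: "n mod 12 = 4 \<or> n mod 12 = 8" using 1 by simp
    define c where "c = n div 12"
    have "n = 12 * c + n mod 12" by (simp add: c_def)
    then have "n = 2 * (6 * c + 2) \<or> n = 2 * (6 * c + 4)" using n12 by (elim disjE) simp_all
    then show thesis using that(1)[of "6 * c + 2"] that(1)[of "6 * c + 4"] md[of c] by (elim disjE) simp_all
  next
    case 2
    show thesis
    proof (cases "n = 2")
      case False
      have "n = m + 8 * (9 * t)" using n(1) by simp
      then have "n mod 8 = m mod 8" by (simp only: mod_mult_self2)
      then have "n mod 8 = 2" using 2 by simp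
      then obtain k where k: "n = 8 * k + 2" by (metis add.commute mod_mult_div_eq)
      have "k > 0" using False k by simp
      moreover have "n = (2 * k + 2) + 6 * k" using k by simp
      then have "n mod 6 = (2 * k + 2) mod 6" by (simp only: mod_mult_self2)
      then have "(2 * k + 2) mod 6 = 2 \<or> (2 * k + 2) mod 6 = 4" using assms by simp
      ultimately show thesis using that(3) k by blast
    qed (rule that(2))
  next
    case 3
    show thesis
    proof (rule that(4)[of "6 * t + 2"])
      show "n = 12 * (6 * t + 2) - 10" using n(1) 3 by simp
      show "(6 * t + 2) mod 6 = 2 \<or> (6 * t + 2) mod 6 = 4" using md(1)[of t] by simp
    qed
  next
    case 4
    show thesis
    proof (rule that(4)[of "6 * t + 4"])
      show "n = 12 * (6 * t + 4) - 10" using n(1) 4 by simp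
      show "(6 * t + 4) mod 6 = 2 \<or> (6 * t + 4) mod 6 = 4" using md(2)[of t] by simp
    qed
  next
    case 5
    show thesis
    proof (rule that(5)[of "12 * t + 4"])
      show "n = 6 * (12 * t + 4) - 2" using n(1) 5 by simp
      show "(12 * t + 4) mod 6 = 2 \<or> (12 * t + 4) mod 6 = 4" using md(2)[of "2 * t"] by simp
    qed
  next
    case 6
    show thesis
    proof (rule that(5)[of "12 * t + 8"])
      show "n = 6 * (12 * t + 8) - 2" using n(1) 6 by simp
      show "(12 * t + 8) mod 6 = 2 \<or> (12 * t + 8) mod 6 = 4" using md(1)[of "2 * t + 1"] by (simp add: add.commute)
    qed
  next
    case 7
    show thesis by (rule that(6)[of t]) (use 7 n in simp)
  next
    case 8
    show thesis by (rule that(7)[of t]) (use 8 n in simp)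
  qed
qed

text \<open>The constant only has to survive the steps that create trades: these need
  \<open>5 ^ 4\<close>, \<open>7 ^ 4\<close> or \<open>12 ^ 4\<close> times 4096, the last being
  84934656. The bound starts at 8, because a system of order 2 or 4 has no trade that avoids a
  point.\<close>

lemma rich_all:
  assumes "n mod 6 = 2 \<or> n mod 6 = 4"
  shows "\<exists>\<tau>. rich n \<tau> \<and> (8 \<le> n \<longrightarrow> n ^ 4 \<le> 100000000 * \<tau>)"
  using assms
proof (induction n rule: less_induct)
  case (less n)
  have zero: "rich v 0" if "v < n" "v mod 6 = 2 \<or> v mod 6 = 4" for v
    using less.IH[OF that] rich_mono by blast
  \<comment> \<open>Inflation from order \<open>v\<close> gives \<open>n \<le> c * v\<close> and
    \<open>c ^ 4\<close> times as many trades, so the ratio does not get worse. If \<open>v\<close>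
    is still too small, then \<open>n \<le> 38\<close>, the largest value being
    \<open>12 * 4 - 10\<close>, and one trade is enough because
    \<open>38 ^ 4 < 10 ^ 8\<close>.\<close>
  have step: ?case if v: "v < n" "v mod 6 = 2 \<or> v mod 6 = 4" and n: "n \<le> c * v" "v < 8 \<Longrightarrow> n \<le> 38"
    and R: "\<And>\<tau>. rich v \<tau> \<Longrightarrow> v = 2 \<or> v \<ge> 4 \<Longrightarrow> rich n (c ^ 4 * \<tau>)" for v c
  proof -
    have v4: "v = 2 \<or> v \<ge> 4" using v(2) by presburger
    obtain \<tau> where \<tau>: "rich v \<tau>" "8 \<le> v \<longrightarrow> v ^ 4 \<le> 100000000 * \<tau>" using less.IH[OF v] by blast
    show ?case
    proof (cases "8 \<le> v")
      case True
      have "n ^ 4 \<le> c ^ 4 * (100000000 * \<tau>)"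
        using power4_bound[OF n(1), of 100000000 \<tau> "c ^ 4 * 100000000"] \<tau>(2) True by simp
      then show ?thesis using R[OF \<tau>(1) v4] by (intro exI[of _ "c ^ 4 * \<tau>"]) simp
    next
      case False
      have r0: "rich n 0" using R[OF \<tau>(1) v4] by (rule rich_mono) simp
      show ?thesis
      proof (cases "8 \<le> n")
        case True
        have "n ^ 4 \<le> 38 ^ 4" using n(2) False by (intro power_mono) auto
        then show ?thesis using rich_one[OF r0] True by (intro exI[of _ 1]) simp
      qed (use r0 in auto)
    qed
  qed
  from less.prems show ?case
  proof (cases rule: residue_cases)
    case (1 v)
    have "v > 0" using 1(2) by (cases v) auto
    then show ?thesis using rich_double[of v] 1 by (intro step[of v 2]) simp_all
  next
    case 2
    then show ?thesis using rich_two by (intro exI[of _ 0]) simp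
  next
    case (3 k)
    have "rich (2 * k + 2) 0" by (rule zero) (use 3 in simp_all)
    from quadruple[OF 3(2) this] obtain \<tau> where \<tau>: "rich n \<tau>" "(2 * k) ^ 4 \<le> 4096 * \<tau>" using 3(1) by auto
    have "n ^ 4 \<le> 100000000 * \<tau>" by (rule power4_bound[OF _ \<tau>(2), of _ 5]) (use 3 in simp_all)
    then show ?thesis using \<tau>(1) by blast
  next
    case (4 v)
    have "v \<ge> 2" using 4(2) by presburger
    show ?thesis
    proof (rule step[OF _ 4(2)])
      show "v < n" "n \<le> 12 * v" unfolding 4(1) using \<open>v \<ge> 2\<close> by linarith+
      show "n \<le> 38" if "v < 8"
      proof -
        have "v \<le> 4" using that 4(2) by presburger
        then show ?thesis unfolding 4(1) by linarith
      qed
      show "rich n (12 ^ 4 * \<tau>)" if "rich v \<tau>" "v = 2 \<or> v \<ge> 4" for \<tau>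
        unfolding 4(1) by (rule rich_twelvefold[OF that])
    qed
  next
    case (5 v)
    have "v \<ge> 2" using 5(2) by presburger
    show ?thesis
    proof (rule step[OF _ 5(2)])
      show "v < n" "n \<le> 6 * v" unfolding 5(1) using \<open>v \<ge> 2\<close> by linarith+
      show "n \<le> 38" if "v < 8"
      proof -
        have "v \<le> 4" using that 5(2) by presburger
        then show ?thesis unfolding 5(1) by linarith
      qed
      show "rich n (6 ^ 4 * \<tau>)" if "rich v \<tau>" "v = 2 \<or> v \<ge> 4" for \<tau>
        unfolding 5(1) by (rule rich_sextuple[OF that])
    qed
  next
    case (6 j)
    have "rich (24 * j + 22) 0"
    proof (rule zero)
      show "(24 * j + 22) mod 6 = 2 \<or> (24 * j + 22) mod 6 = 4" by presburger
    qed (use 6 in simp)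
    from triple_two[OF this] obtain \<tau> where \<tau>: "rich n \<tau>" "(12 * j + 10) ^ 4 \<le> 4096 * \<tau>" using 6 by auto
    have "n ^ 4 \<le> 100000000 * \<tau>" by (rule power4_bound[OF _ \<tau>(2), of _ 7]) (use 6 in simp_all)
    then show ?thesis using \<tau>(1) by blast
  next
    case (7 j)
    \<comment> \<open>The order \<open>24 * j + 26\<close> to be tripled is
      \<open>8 * k + 2\<close>. Taking its trades from \<open>quadruple\<close> instead of the
      induction hypothesis keeps the loss caused by tripling from accumulating.\<close>
    define k where "k = 3 * j + 3"
    have "rich (2 * k + 2) 0"
    proof (rule zero)
      show "(2 * k + 2) mod 6 = 2 \<or> (2 * k + 2) mod 6 = 4" unfolding k_def by presburger
    qed (use 7 in \<open>simp add: k_def\<close>)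
    from quadruple[OF _ this] obtain \<tau> where \<tau>: "rich (8 * k + 2) \<tau>" "(2 * k) ^ 4 \<le> 4096 * \<tau>" by (auto simp: k_def)
    have "8 * k + 2 = 24 * j + 26" by (simp add: k_def)
    then have "rich n \<tau>" unfolding 7 using \<tau>(1) by (intro triple_four) (simp only:)
    moreover have "n ^ 4 \<le> 100000000 * \<tau>" by (rule power4_bound[OF _ \<tau>(2), of _ 12]) (use 7 in \<open>simp_all add: k_def\<close>)
    ultimately show ?thesis by blast
  qed
qed

theorem theorem4:
  shows "\<exists>c1 c2 :: real. \<exists>n0 :: nat. 0 < c1 \<and> c1 \<le> c2 \<and>
    (\<forall>n \<ge> n0. (n mod 6 = 2 \<or> n mod 6 = 4) \<longrightarrow>
       c1 * real n ^ 3 * ln (real n) \<le> ln (real (num_SQS n)) \<and>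
       ln (real (num_SQS n)) \<le> c2 * real n ^ 3 * ln (real n))"
proof (intro exI conjI allI impI)
  let ?D = "100000000 :: nat"
  show "0 < 1 / (16 * real ?D * 1000000000)" "1 / (16 * real ?D * 1000000000) \<le> 1" by simp_all
  \<comment> \<open>With \<open>D = 10 ^ 8\<close> this threshold is \<open>4 * 10 ^ 17\<close>,
    which also exceeds \<open>16 * D ^ 2\<close>.\<close>
  fix n :: nat assume n: "4 * ?D * 1000000000 \<le> n" and m: "n mod 6 = 2 \<or> n mod 6 = 4"
  obtain \<tau> where \<tau>: "rich n \<tau>" "n ^ 4 \<le> ?D * \<tau>" using rich_all[OF m] n by auto
  have "real n ^ 3 * ln (real n) / (16 * real ?D * 1000000000) \<le> ln (real (num_SQS n))"
    by (rule ln_num_SQS_lower[OF \<tau>]) (use n in simp_all)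
  then show "1 / (16 * real ?D * 1000000000) * real n ^ 3 * ln (real n) \<le> ln (real (num_SQS n))" by simp
  have n0: "n > 0" using n by simp
  show "ln (real (num_SQS n)) \<le> 1 * real n ^ 3 * ln (real n)"
  \<comment> \<open>The convention \<open>ln 0 = 0\<close> settles the first case at once.\<close>
  proof (cases "num_SQS n = 0")
    case True
    then show ?thesis using n0 by simp
  next
    case False
    have "real (num_SQS n) \<le> real n ^ (n ^ 3)" using num_SQS_upper[OF n0] by (metis of_nat_le_iff of_nat_power)
    then have "ln (real (num_SQS n)) \<le> ln (real n ^ (n ^ 3))"
      using False n0 by (intro ln_le_cancel_iff[THEN iffD2]) simp_all
    also have "\<dots> = real n ^ 3 * ln (real n)" using n0 by (simp add: ln_realpow)
    finally show ?thesis by simp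
  qed
qed

end
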